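(* Let $R\in(0,\infty)$, $p\geq1$ real, and $k\geq1$ an integer. (1) Every $u\in W^{k,p}_{\mathbb H,\mathrm{rad}}(B_R^{\mathbb H})$ is almost everywhere equal to a function $U\in C^{k-1}(\overline{B_R^{\mathbb H}}\setminus\{0\})$; moreover all partial derivatives of $U$ of order $k$ (in the classical sense) exist almost everywhere for $d(x)\in(0,R)$. (2) If $N>kp$, then $W^{k,p}_{\mathbb H,\mathrm{rad}}(B_R^{\mathbb H})$ is continuously embedded in $L^q_{\sinh^\theta}(B_R^{\mathbb H})$ for every $\theta\geq0$ and $1\leq q\leq\frac{(\theta+N)p}{N-kp}$. (3) If $N=kp$ and $p>1$, then $W^{k,p}_{\mathbb H,\mathrm{rad}}(B_R^{\mathbb H})$ is compactly embedded in $L^q_{\sinh^\theta}(B_R^{\mathbb H})$ for all $\theta\geq0$ and $1\leq q<\infty$. (4) If $N=kp$ and $p=1$, then $W^{N,1}_{\mathbb H,\mathrm{rad}}(B_R^{\mathbb H})$ is continuously embedded in $C(\overline{B_R^{\mathbb H}})$.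
   Context: $\mathbb H^N$ is the Poincaré ball $\{x\in\mathbb R^N:|x|<1\}$ with metric $g_{ij}=\left(\frac{2}{1-|x|^2}\right)^2\delta_{ij}$, volume element $\mathrm dV_g=\left(\frac{2}{1-|x|^2}\right)^N\mathrm dx$, and $d(x)=\log\frac{1+|x|}{1-|x|}$. $B_R^{\mathbb H}=\{x\in\mathbb H^N:d(x)<R\}$. A function $u$ is radial if $u(x)=v(d(x))$ for some $v$. $W^{k,p}(M)$ is the completion of smooth functions with finite norm $\|u\|_{W^{k,p}(M)}=\left(\sum_{j=0}^k\int_M|\nabla^ju|_g^p\mathrm dV_g\right)^{1/p}$ ($\nabla^j$ the $j$-th covariant derivative, $|\cdot|_g$ the induced tensor norm); $W^{k,p}_{\mathbb H,\mathrm{rad}}(B_R^{\mathbb H})$ is its subspace of radial functions. For $\Omega\subset\mathbb H^N$, $L^q_{\sinh^\theta}(\Omega)$ is the space of measurable $u$ with $\int_\Omega|u|^q\sinh^\theta d(x)\,\mathrm dV_g<\infty$, normed accordingly. *)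

theory Defs
  imports "HOL-Analysis.Analysis"
begin

text \<open>Poincare ball model of hyperbolic space in coordinates x :: real^'n, N = CARD('n).\<close>

definition hdist0 :: "real^'n \<Rightarrow> real" where
  "hdist0 x = ln ((1 + norm x) / (1 - norm x))"

definition hball :: "real \<Rightarrow> (real^'n) set" where
  "hball R = {x. norm x < 1 \<and> hdist0 x < R}"

definition conf :: "real^'n \<Rightarrow> real" where
  "conf x = 2 / (1 - (norm x)^2)"

definition gmet :: "real^'n \<Rightarrow> 'n \<Rightarrow> 'n \<Rightarrow> real" where
  "gmet x i j = (conf x)^2 * (if i = j then 1 else 0)"

definition ginv :: "real^'n \<Rightarrow> 'n \<Rightarrow> 'n \<Rightarrow> real" where
  "ginv x i j = (1 / conf x)^2 * (if i = j then 1 else 0)"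

definition pdv :: "'n \<Rightarrow> (real^'n \<Rightarrow> real) \<Rightarrow> real^'n \<Rightarrow> real" where
  "pdv i f x = deriv (\<lambda>t. f (x + t *\<^sub>R axis i 1)) 0"

fun pdl :: "'n list \<Rightarrow> (real^'n \<Rightarrow> real) \<Rightarrow> real^'n \<Rightarrow> real" where
  "pdl [] f = f"
| "pdl (i # is) f = pdv i (pdl is f)"

fun pdl_ex :: "'n list \<Rightarrow> (real^'n \<Rightarrow> real) \<Rightarrow> real^'n \<Rightarrow> bool" where
  "pdl_ex [] f x = True"
| "pdl_ex (i # is) f x =
     ((\<forall>\<^sub>F t in nhds 0. pdl_ex is f (x + t *\<^sub>R axis i 1)) \<and>
      (\<lambda>t. pdl is f (x + t *\<^sub>R axis i 1)) differentiable (at 0))"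

definition smooth_on :: "(real^'n) set \<Rightarrow> (real^'n \<Rightarrow> real) \<Rightarrow> bool" where
  "smooth_on S u \<longleftrightarrow> (\<forall>is. (\<forall>x\<in>S. pdl_ex is u x) \<and> continuous_on S (pdl is u))"

definition Ck_on :: "nat \<Rightarrow> (real^'n) set \<Rightarrow> (real^'n \<Rightarrow> real) \<Rightarrow> bool" where
  "Ck_on m S u \<longleftrightarrow> continuous_on S u \<and>
     (\<forall>is. length is \<le> m \<longrightarrow> (\<forall>x\<in>interior S. pdl_ex is u x) \<and>
        (\<exists>g. continuous_on S g \<and> (\<forall>x\<in>interior S. g x = pdl is u x)))"

definition christoffel :: "real^'n \<Rightarrow> 'n \<Rightarrow> 'n \<Rightarrow> 'n \<Rightarrow> real" where
  "christoffel x l i j = (1/2) * (\<Sum>m\<in>UNIV. ginv x l m *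
      (pdv i (\<lambda>y. gmet y j m) x + pdv j (\<lambda>y. gmet y i m) x - pdv m (\<lambda>y. gmet y i j) x))"

text \<open>components of the j-th covariant derivative (a (0,j)-tensor, indexed by lists of length j)\<close>
fun covd :: "nat \<Rightarrow> (real^'n \<Rightarrow> real) \<Rightarrow> real^'n \<Rightarrow> 'n list \<Rightarrow> real" where
  "covd 0 u x is = u x"
| "covd (Suc j) u x is = (case is of [] \<Rightarrow> 0 | a # rest \<Rightarrow>
      pdv a (\<lambda>y. covd j u y rest) x -
      (\<Sum>m<length rest. \<Sum>l\<in>UNIV. christoffel x l a (rest ! m) * covd j u x (rest[m := l])))"

definition tnorm :: "nat \<Rightarrow> real^'n \<Rightarrow> ('n list \<Rightarrow> real) \<Rightarrow> real" where
  "tnorm j x T = sqrt (\<Sum>is\<in>{is. length is = j}. \<Sum>js\<in>{js. length js = j}.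
       (\<Prod>m<j. ginv x (is ! m) (js ! m)) * T is * T js)"

text \<open>p-th power of the W^{k,p}(B_R) norm, integrated against dV_g = conf^N dx\<close>
definition Wnorm_pow :: "nat \<Rightarrow> real \<Rightarrow> real \<Rightarrow> (real^'n \<Rightarrow> real) \<Rightarrow> ennreal" where
  "Wnorm_pow k p R u = (\<Sum>j\<le>k. \<integral>\<^sup>+ x. indicator (hball R) x *
      ennreal (tnorm j x (covd j u x) powr p * conf x ^ CARD('n)) \<partial>lebesgue)"

definition Wnorm :: "nat \<Rightarrow> real \<Rightarrow> real \<Rightarrow> (real^'n \<Rightarrow> real) \<Rightarrow> real" where
  "Wnorm k p R u = enn2real (Wnorm_pow k p R u) powr (1 / p)"

definition smoothW :: "nat \<Rightarrow> real \<Rightarrow> real \<Rightarrow> (real^'n \<Rightarrow> real) \<Rightarrow> bool" where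
  "smoothW k p R u \<longleftrightarrow> smooth_on (hball R) u \<and> Wnorm_pow k p R u < \<infinity>"

definition Lp_dist :: "real \<Rightarrow> real \<Rightarrow> (real^'n \<Rightarrow> real) \<Rightarrow> (real^'n \<Rightarrow> real) \<Rightarrow> ennreal" where
  "Lp_dist p R f g = (\<integral>\<^sup>+ x. indicator (hball R) x *
      ennreal (\<bar>f x - g x\<bar> powr p * conf x ^ CARD('n)) \<partial>lebesgue)"

text \<open>phi is a W^{k,p}-Cauchy sequence of smooth finite-norm functions whose (L^p) limit is u;
  this realises u as an element of the completion W^{k,p}(B_R)\<close>
definition approxW :: "nat \<Rightarrow> real \<Rightarrow> real \<Rightarrow> (nat \<Rightarrow> real^'n \<Rightarrow> real) \<Rightarrow> (real^'n \<Rightarrow> real) \<Rightarrow> bool" where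
  "approxW k p R \<phi> u \<longleftrightarrow> (\<forall>n. smoothW k p R (\<phi> n)) \<and>
     (\<forall>e>0. \<exists>M. \<forall>m\<ge>M. \<forall>n\<ge>M. Wnorm k p R (\<lambda>x. \<phi> m x - \<phi> n x) < e) \<and>
     set_borel_measurable lebesgue (hball R) u \<and>
     (\<lambda>n. Lp_dist p R (\<phi> n) u) \<longlonglongrightarrow> 0"

definition radial :: "real \<Rightarrow> (real^'n \<Rightarrow> real) \<Rightarrow> bool" where
  "radial R u \<longleftrightarrow> (\<exists>v. AE x in lebesgue. x \<in> hball R \<longrightarrow> u x = v (hdist0 x))"

definition Wrad :: "nat \<Rightarrow> real \<Rightarrow> real \<Rightarrow> (real^'n \<Rightarrow> real) \<Rightarrow> bool" where
  "Wrad k p R u \<longleftrightarrow> (\<exists>\<phi>. approxW k p R \<phi> u) \<and> radial R u"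

definition Wnormc :: "nat \<Rightarrow> real \<Rightarrow> real \<Rightarrow> (real^'n \<Rightarrow> real) \<Rightarrow> real" where
  "Wnormc k p R u = (SOME c. \<exists>\<phi>. approxW k p R \<phi> u \<and> (\<lambda>n. Wnorm k p R (\<phi> n)) \<longlonglongrightarrow> c)"

definition Lqs_pow :: "real \<Rightarrow> real \<Rightarrow> real \<Rightarrow> (real^'n \<Rightarrow> real) \<Rightarrow> ennreal" where
  "Lqs_pow q \<theta> R u = (\<integral>\<^sup>+ x. indicator (hball R) x *
      ennreal (\<bar>u x\<bar> powr q * sinh (hdist0 x) powr \<theta> * conf x ^ CARD('n)) \<partial>lebesgue)"

definition in_Lqs :: "real \<Rightarrow> real \<Rightarrow> real \<Rightarrow> (real^'n \<Rightarrow> real) \<Rightarrow> bool" where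
  "in_Lqs q \<theta> R u \<longleftrightarrow> set_borel_measurable lebesgue (hball R) u \<and> Lqs_pow q \<theta> R u < \<infinity>"

definition Lqs_norm :: "real \<Rightarrow> real \<Rightarrow> real \<Rightarrow> (real^'n \<Rightarrow> real) \<Rightarrow> real" where
  "Lqs_norm q \<theta> R u = enn2real (Lqs_pow q \<theta> R u) powr (1 / q)"

definition cont_embed :: "nat \<Rightarrow> real \<Rightarrow> real \<Rightarrow> real \<Rightarrow> real \<Rightarrow> ('n::finite) itself \<Rightarrow> bool" where
  "cont_embed k p R q \<theta> _ \<longleftrightarrow> (\<exists>C. \<forall>u::real^'n \<Rightarrow> real. Wrad k p R u \<longrightarrow>
      in_Lqs q \<theta> R u \<and> Lqs_norm q \<theta> R u \<le> C * Wnormc k p R u)"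

definition compact_embed :: "nat \<Rightarrow> real \<Rightarrow> real \<Rightarrow> real \<Rightarrow> real \<Rightarrow> ('n::finite) itself \<Rightarrow> bool" where
  "compact_embed k p R q \<theta> T \<longleftrightarrow> cont_embed k p R q \<theta> T \<and>
     (\<forall>(u :: nat \<Rightarrow> real^'n \<Rightarrow> real) B. (\<forall>n. Wrad k p R (u n) \<and> Wnormc k p R (u n) \<le> B) \<longrightarrow>
        (\<exists>r w. strict_mono r \<and> in_Lqs q \<theta> R w \<and>
            (\<lambda>n. Lqs_norm q \<theta> R (\<lambda>x. u (r n) x - w x)) \<longlonglongrightarrow> 0))"

end

theory Submission
  imports Defs "HOL-Complex_Analysis.Great_Picard"
begin

text \<open>
  On the ball of hyperbolic radius R the conformal factor is bounded above and below together with all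
  its derivatives, so the covariant W^{k,p} norm is equivalent to the Euclidean one. The approximants of a radial
  function u need not be radial; instead of symmetrising them, restrict them to a ray. By Tonelli almost
  every ray inherits the convergence, and by Fatou some ray has weighted energy, with respect to the weight s^(N-1),
  bounded by the norm of u. On that ray the k-th radial derivative of an approximant is controlled by
  its k-th differential, and everything reduces to one variable: the limit profile W_0 has k-1
  continuous derivatives, the last of which is an indefinite integral and hence differentiable
  almost everywhere. Iterating the Hardy inequality k times from the weight s^(N-1) down to
  s^(N-kp-1) yields both a pointwise bound by s^(-(N-kp)/p) and an integral bound, whose
  interpolation is the critical embedding. If N = kp, the pointwise bound holds with any positive power,
  and compactness follows from equicontinuity away from 0 and dominated convergence.
\<close>

text \<open>One ray is enough because u is radial: if the approximants converge almost everywhere on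
  a ray, their limit there is the profile of u, and null sets of radii lift to null sets of points.
  That ray must satisfy countably many conditions at once, hence the fast subsequence: increments of
  energy 4^(-np) stay summable after multiplication by 2^(np), so on almost every ray they are
  O(2^(-np)). The norm bound survives only as a liminf, since Fatou yields no more; every estimate
  is therefore proved for smooth chains and then passed to the limit.

  The ball is Euclidean of radius tanh(R/2), and sinh d(x) is |x| times the conformal factor, so
  sinh^theta dV becomes s^(N-1+theta) ds up to constants. Hardy's inequality requires a positive
  exponent, which fails at the k-th step if N = kp; this is why the last step carries a free
  exponent b. If moreover p = 1, the weight is gone after k-1 steps and the first derivative is
  integrable up to 0, which gives uniform convergence there.\<close>

section \<open>Partial derivatives with controlled coefficients\<close>

text \<open>\<open>pdv\<close> goes through \<open>deriv\<close>, which has a value even where no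
  derivative exists; this relation carries existence together with the value.\<close>

definition has_pd :: "'n \<Rightarrow> (real^'n \<Rightarrow> real) \<Rightarrow> real^'n \<Rightarrow> real \<Rightarrow> bool" where
  "has_pd i f x d \<longleftrightarrow> ((\<lambda>t. f (x + t *\<^sub>R axis i 1)) has_real_derivative d) (at 0)"

lemma has_pd_imp_pdv: "has_pd i f x d \<Longrightarrow> pdv i f x = d"
  unfolding has_pd_def pdv_def by (rule DERIV_imp_deriv)

lemma has_pd_eventually_line:
  fixes x :: "real^'n"
  assumes "open S" "x \<in> S"
  shows "\<forall>\<^sub>F t in nhds 0. x + t *\<^sub>R axis i 1 \<in> S"
proof -
  have "((\<lambda>t. x + t *\<^sub>R axis i 1) \<longlongrightarrow> x) (nhds 0)"
    using tendsto_add[OF tendsto_const[of x] tendsto_scaleR[OF filterlim_ident tendsto_const[of "axis i 1"]], of "0::real"]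
    by simp
  then show ?thesis
    using assms by (auto simp: tendsto_def)
qed

lemma has_pd_cong:
  assumes "open S" "x \<in> S" "\<And>y. y \<in> S \<Longrightarrow> f y = g y" "has_pd i f x d"
  shows "has_pd i g x d"
proof -
  have ev: "\<forall>\<^sub>F t in nhds 0. f (x + t *\<^sub>R axis i 1) = g (x + t *\<^sub>R axis i 1)"
    using has_pd_eventually_line[OF assms(1,2)] by eventually_elim (rule assms(3))
  then show ?thesis
    using assms(4) DERIV_cong_ev[OF refl ev refl] unfolding has_pd_def by blast
qed

lemma has_pd_const: "has_pd i (\<lambda>x. c) x 0"
  by (simp add: has_pd_def)

lemma has_pd_coord: "has_pd i (\<lambda>x. x $ j) x (if i = j then 1 else 0)"
  unfolding has_pd_def by (auto simp: axis_def intro!: derivative_eq_intros)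

lemma has_pd_add:
  "has_pd i f x d \<Longrightarrow> has_pd i g x e \<Longrightarrow> has_pd i (\<lambda>x. f x + g x) x (d + e)"
  unfolding has_pd_def by (rule DERIV_add)

lemma has_pd_diff:
  "has_pd i f x d \<Longrightarrow> has_pd i g x e \<Longrightarrow> has_pd i (\<lambda>x. f x - g x) x (d - e)"
  unfolding has_pd_def by (rule DERIV_diff)

lemma has_pd_mult:
  "has_pd i f x d \<Longrightarrow> has_pd i g x e \<Longrightarrow> has_pd i (\<lambda>x. f x * g x) x (d * g x + e * f x)"
  unfolding has_pd_def by (drule (1) DERIV_mult) simp

lemma has_pd_chain:
  assumes "has_pd i f x d" "(h has_real_derivative e) (at (f x))"
  shows "has_pd i (\<lambda>x. h (f x)) x (e * d)"
  using assms DERIV_chain2[of h e "\<lambda>t. f (x + t *\<^sub>R axis i 1)" 0 d UNIV]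
  unfolding has_pd_def by simp

lemma has_pd_norm:
  assumes "x \<noteq> 0"
  shows "has_pd i norm x (x $ i / norm x)"
proof -
  have "((\<lambda>t. norm (x + t *\<^sub>R axis i 1)) has_derivative (\<lambda>t. (x \<bullet> (t *\<^sub>R axis i 1)) / norm x)) (at 0)"
  proof -
    have "(norm has_derivative (\<lambda>h. h \<bullet> sgn (x + 0 *\<^sub>R axis i 1))) (at (x + 0 *\<^sub>R axis i 1))"
      using assms by (intro has_derivative_norm) auto
    moreover have "((\<lambda>t. x + t *\<^sub>R axis i 1) has_derivative (\<lambda>t. t *\<^sub>R axis i 1)) (at 0)"
      by (auto intro!: derivative_eq_intros)
    ultimately have "((\<lambda>t. norm (x + t *\<^sub>R axis i 1)) has_derivative (\<lambda>t. (t *\<^sub>R axis i 1) \<bullet> sgn (x + 0 *\<^sub>R axis i 1))) (at 0)"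
      by (rule has_derivative_compose[rotated])
    then show ?thesis
      by (simp add: sgn_div_norm inner_commute divide_inverse mult.commute)
  qed
  then show ?thesis
    unfolding has_pd_def has_field_derivative_def
    by (rule has_derivative_eq_rhs) (auto simp: inner_axis mult.commute)
qed

text \<open>Polynomials in the coordinates and one further function b, which is \<open>conf\<close>
  for the metric and 1/|x| for radial functions. Members are continuous wherever b is, hence bounded
  on compact sets, and the class is stable under differentiation as soon as the derivatives of b
  itself lie in it.\<close>

inductive alg :: "(real^'n \<Rightarrow> real) \<Rightarrow> (real^'n \<Rightarrow> real) \<Rightarrow> bool" for b where
  alg_const: "alg b (\<lambda>x. c)"
| alg_coord: "alg b (\<lambda>x. x $ i)"
| alg_base: "alg b b"
| alg_add: "alg b f \<Longrightarrow> alg b g \<Longrightarrow> alg b (\<lambda>x. f x + g x)"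
| alg_mult: "alg b f \<Longrightarrow> alg b g \<Longrightarrow> alg b (\<lambda>x. f x * g x)"

lemma alg_uminus: "alg b f \<Longrightarrow> alg b (\<lambda>x. - f x)"
  using alg_mult[OF alg_const[of b "-1"]] by simp

lemma alg_diff: "alg b f \<Longrightarrow> alg b g \<Longrightarrow> alg b (\<lambda>x. f x - g x)"
  using alg_add[OF _ alg_uminus, of b f g] by simp

lemma alg_sum: "finite A \<Longrightarrow> (\<And>a. a \<in> A \<Longrightarrow> alg b (f a)) \<Longrightarrow> alg b (\<lambda>x. \<Sum>a\<in>A. f a x)"
  by (induction A rule: finite_induct) (auto intro: alg_const alg_add)

lemma alg_power: "alg b f \<Longrightarrow> alg b (\<lambda>x. f x ^ n)"
  by (induction n) (auto intro: alg_const alg_mult)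

lemma alg_continuous_on:
  assumes "alg b f" "continuous_on S b"
  shows "continuous_on S f"
  using assms by induction (auto intro!: continuous_intros)

definition pd_closed :: "(real^'n) set \<Rightarrow> (real^'n \<Rightarrow> real) \<Rightarrow> bool" where
  "pd_closed S b \<longleftrightarrow> (\<forall>i. \<exists>g. alg b g \<and> (\<forall>x\<in>S. has_pd i b x (g x)))"

lemma alg_has_pd:
  assumes "alg b f" "pd_closed S b"
  shows "\<exists>g. alg b g \<and> (\<forall>x\<in>S. has_pd i f x (g x))"
  using assms(1)
proof induction
  case (alg_const c)
  show ?case by (rule exI[of _ "\<lambda>x. 0"]) (auto intro: has_pd_const alg.alg_const)
next
  case (alg_coord j)
  show ?case by (rule exI[of _ "\<lambda>x. if i = j then 1 else 0"]) (intro conjI alg.alg_const ballI has_pd_coord)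
next
  case alg_base
  then show ?case using assms(2) by (auto simp: pd_closed_def)
next
  case (alg_add f g)
  then obtain f' g' where "alg b f'" "alg b g'" "\<forall>x\<in>S. has_pd i f x (f' x)" "\<forall>x\<in>S. has_pd i g x (g' x)" by blast
  then show ?case
    by (intro exI[of _ "\<lambda>x. f' x + g' x"]) (auto intro: has_pd_add alg.alg_add)
next
  case (alg_mult f g)
  then obtain f' g' where "alg b f'" "alg b g'" "\<forall>x\<in>S. has_pd i f x (f' x)" "\<forall>x\<in>S. has_pd i g x (g' x)" by blast
  then show ?case using alg_mult.hyps
    by (intro exI[of _ "\<lambda>x. f' x * g x + g' x * f x"])
      (auto intro: has_pd_mult alg.alg_add alg.alg_mult)
qed

lemma pd_closed_inverse_norm: "pd_closed (- {0}) (\<lambda>x::real^'n. inverse (norm x))"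
  unfolding pd_closed_def
proof (intro allI exI conjI ballI)
  fix i and x :: "real^'n" assume "x \<in> - {0}"
  then have x: "x \<noteq> 0" by simp
  show "has_pd i (\<lambda>x. inverse (norm x)) x (- (inverse (norm x) ^ 3 * x $ i))"
    by (rule has_pd_chain[OF has_pd_norm[OF x], THEN back_subst[of "has_pd i _ x"]])
      (use x in \<open>auto intro!: derivative_eq_intros simp: field_simps power2_eq_square power3_eq_cube\<close>)
qed (intro alg_uminus alg_mult alg_power alg_base alg_coord)

lemma norm_eq_sum_squares: "(norm (x::real^'n))^2 = (\<Sum>i\<in>UNIV. (x $ i)^2)"
  by (simp add: norm_vec_def L2_set_def sum_nonneg)

lemma has_pd_norm_sq: "has_pd i (\<lambda>x. (norm x)\<^sup>2) x (2 * x $ i)"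
proof -
  have "((\<lambda>t. (x + t *\<^sub>R axis i 1) \<bullet> (x + t *\<^sub>R axis i 1)) has_real_derivative 2 * x $ i) (at 0)"
    unfolding has_field_derivative_def
    by (auto intro!: derivative_eq_intros simp: fun_eq_iff inner_axis inner_axis')
  then show ?thesis
    by (simp add: has_pd_def power2_norm_eq_inner)
qed

lemma pd_closed_conf: "pd_closed (ball 0 1) (conf :: real^'n \<Rightarrow> real)"
  unfolding pd_closed_def
proof (intro allI exI conjI ballI)
  fix i and x :: "real^'n" assume "x \<in> ball 0 1"
  then have x: "(norm x)\<^sup>2 < 1" by (simp add: power_less_one_iff)
  show "has_pd i conf x (conf x ^ 2 * x $ i)"
    unfolding conf_def
    by (rule has_pd_chain[OF has_pd_norm_sq, where h="\<lambda>y. 2 / (1 - y)", THEN back_subst[of "has_pd i _ x"]])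
      (use x in \<open>auto intro!: derivative_eq_intros simp: field_simps power2_eq_square\<close>)
qed (intro alg_mult alg_power alg_base alg_coord)

lemma continuous_on_conf: "continuous_on (ball 0 1) (conf :: real^'n \<Rightarrow> real)"
  unfolding conf_def by (intro continuous_intros) (auto simp: abs_square_eq_1)

section \<open>Coefficients of the hyperbolic metric\<close>

lemma alg_ginv: "alg conf (\<lambda>x::real^'n. ginv x i j)"
proof -
  \<comment> \<open>1/\<open>conf\<close> is the polynomial (1 - |x|^2)/2, so no second generator is
    required. The identity also holds on the unit sphere, where both sides are 0 by the convention
    for division by 0.\<close>
  have "ginv x i j = ((1 - (\<Sum>i\<in>UNIV. (x $ i)^2)) * (1/2))^2 * (if i = j then 1 else 0)" for x :: "real^'n"
    by (simp add: ginv_def conf_def flip: norm_eq_sum_squares)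
  moreover have "alg conf (\<lambda>x::real^'n. ((1 - (\<Sum>i\<in>UNIV. (x $ i)^2)) * (1/2))^2 * (if i = j then 1 else 0))"
    by (intro alg_mult alg_power alg_diff alg_const alg_sum alg_coord finite)
  ultimately show ?thesis by simp
qed

lemma alg_gmet: "alg conf (\<lambda>x::real^'n. gmet x i j)"
  unfolding gmet_def by (intro alg_mult alg_power alg_base alg_const)

lemma alg_pdv_eq:
  assumes "alg b f" "pd_closed S b"
  obtains g where "alg b g" "\<And>x. x \<in> S \<Longrightarrow> pdv i f x = g x"
  using alg_has_pd[OF assms, of i] has_pd_imp_pdv by blast

lemma alg_christoffel:
  fixes l i j :: "'n::finite"
  obtains g where "alg conf g" "\<And>x. x \<in> ball 0 1 \<Longrightarrow> christoffel x l i j = g x"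
proof -
  have "\<exists>g. alg conf g \<and> (\<forall>x\<in>ball 0 1. pdv i (\<lambda>y. gmet y j m) x = g x)"  for i j m :: 'n
    by (rule alg_pdv_eq[OF alg_gmet pd_closed_conf]) blast
  then obtain D :: "'n \<Rightarrow> 'n \<Rightarrow> 'n \<Rightarrow> real^'n \<Rightarrow> real" where D: "\<And>i j m. alg conf (D i j m)"
    "\<And>i j m x. x \<in> ball 0 1 \<Longrightarrow> pdv i (\<lambda>y. gmet y j m) x = D i j m x" by metis
  show ?thesis
  proof
    show "alg conf (\<lambda>x. (1/2) * (\<Sum>m\<in>UNIV. ginv x l m * (D i j m x + D j i m x - D m i j x)))"
      by (intro alg_mult alg_const alg_sum alg_add alg_diff D alg_ginv finite)
  qed (simp add: christoffel_def D(2))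
qed

text \<open>
  Linear operators acting on a family B of functions, with coefficients in \<open>alg b\<close>. The family is either
  B_js = pdl js u, for the covariant derivatives, or B_j = W_j(norm x), for the derivatives of a radial
  function; coefficients never depend on B, which makes the resulting bounds uniform.
\<close>

inductive rep :: "(real^'n \<Rightarrow> real) \<Rightarrow> ('i \<Rightarrow> bool) \<Rightarrow> (('i \<Rightarrow> real^'n \<Rightarrow> real) \<Rightarrow> real^'n \<Rightarrow> real) \<Rightarrow> bool"
  for b ok where
  rep_zero: "rep b ok (\<lambda>B x. 0)"
| rep_term: "alg b P \<Longrightarrow> ok \<iota> \<Longrightarrow> rep b ok (\<lambda>B x. P x * B \<iota> x)"
| rep_add: "rep b ok T \<Longrightarrow> rep b ok T' \<Longrightarrow> rep b ok (\<lambda>B x. T B x + T' B x)"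

lemma rep_scale: "rep b ok T \<Longrightarrow> alg b P \<Longrightarrow> rep b ok (\<lambda>B x. P x * T B x)"
proof (induction rule: rep.induct)
  case rep_zero
  show ?case using rep.rep_zero by simp
next
  case (rep_term Q \<iota>)
  have "rep b ok (\<lambda>B x. (P x * Q x) * B \<iota> x)"
    by (rule rep.rep_term[where ok=ok, OF alg_mult[OF rep_term.prems rep_term.hyps(1)] rep_term.hyps(2)])
  then show ?case by (simp only: mult.assoc)
next
  case (rep_add T T')
  from rep.rep_add[OF rep_add.IH(1)[OF rep_add.prems] rep_add.IH(2)[OF rep_add.prems]]
  show ?case by (simp only: distrib_left)
qed

lemma rep_sum: "finite A \<Longrightarrow> (\<And>a. a \<in> A \<Longrightarrow> rep b ok (T a)) \<Longrightarrow> rep b ok (\<lambda>B x. \<Sum>a\<in>A. T a B x)"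
proof (induction A rule: finite_induct)
  case (insert a A)
  have "rep b ok (T a)" "rep b ok (\<lambda>B x. \<Sum>a\<in>A. T a B x)"
    by (rule insert.prems insert.IH insertI1 insertI2 | assumption)+
  from rep_add[OF this] show ?case using insert.hyps by simp
qed (simp add: rep_zero)

lemma rep_diff: "rep b ok T \<Longrightarrow> rep b ok T' \<Longrightarrow> rep b ok (\<lambda>B x. T B x - T' B x)"
  using rep_add[OF _ rep_scale[OF _ alg_const[of _ "-1"]], of b ok T T'] by simp

lemma rep_mono: "rep b ok T \<Longrightarrow> (\<And>\<iota>. ok \<iota> \<Longrightarrow> ok' \<iota>) \<Longrightarrow> rep b ok' T"
proof (induction rule: rep.induct)
  case (rep_add T T')
  from rep_add.IH[OF rep_add.prems] show ?case by (rule rep.rep_add)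
qed (auto intro: rep_zero rep_term)

lemma rep_single: "ok \<iota> \<Longrightarrow> rep b ok (\<lambda>B x. B \<iota> x)"
  using rep_term[OF alg_const[of b 1], of ok \<iota>] by simp

text \<open>The product rule, where \<open>D\<close> says how the family itself is differentiated
  and \<open>ok'\<close> admits the indices that are one order higher. The operator
  \<open>T'\<close> is chosen before the family B, and this order of quantifiers is what later makes
  constants independent of u.\<close>

lemma rep_deriv:
  assumes "rep b ok T" and S: "pd_closed S b" and ok: "\<And>\<iota>. ok \<iota> \<Longrightarrow> ok' \<iota>"
    and D: "\<And>\<iota>. ok \<iota> \<Longrightarrow> rep b ok' (D \<iota>)"
  shows "\<exists>T'. rep b ok' T' \<and> (\<forall>B. \<forall>x\<in>S. (\<forall>\<iota>. ok \<iota> \<longrightarrow> has_pd i (B \<iota>) x (D \<iota> B x)) \<longrightarrow> has_pd i (T B) x (T' B x))"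
  using assms(1)
proof induction
  case rep_zero
  show ?case by (rule exI[of _ "\<lambda>B x. 0"]) (auto intro: has_pd_const rep.rep_zero)
next
  case (rep_term P \<iota>)
  from alg_has_pd[OF this(1) S, of i] obtain P' where P': "alg b P'" "\<forall>x\<in>S. has_pd i P x (P' x)" by blast
  show ?case
  proof (intro exI conjI allI ballI impI)
    show "rep b ok' (\<lambda>B x. P' x * B \<iota> x + P x * D \<iota> B x)"
      by (intro rep.rep_add rep.rep_term rep_scale D P' rep_term ok)
    fix B x assume "x \<in> S" "\<forall>\<iota>. ok \<iota> \<longrightarrow> has_pd i (B \<iota>) x (D \<iota> B x)"
    then show "has_pd i (\<lambda>x. P x * B \<iota> x) x (P' x * B \<iota> x + P x * D \<iota> B x)"
      using has_pd_mult[of i P x "P' x" "B \<iota>" "D \<iota> B x"] P' rep_term by (simp add: mult.commute)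
  qed
next
  case (rep_add T1 T2)
  then obtain T1' T2' where T: "rep b ok' T1'" "rep b ok' T2'"
    "\<forall>B. \<forall>x\<in>S. (\<forall>\<iota>. ok \<iota> \<longrightarrow> has_pd i (B \<iota>) x (D \<iota> B x)) \<longrightarrow> has_pd i (T1 B) x (T1' B x)"
    "\<forall>B. \<forall>x\<in>S. (\<forall>\<iota>. ok \<iota> \<longrightarrow> has_pd i (B \<iota>) x (D \<iota> B x)) \<longrightarrow> has_pd i (T2 B) x (T2' B x)" by blast
  show ?case
    by (rule exI[of _ "\<lambda>B x. T1' B x + T2' B x"]) (use T in \<open>auto intro!: has_pd_add rep.rep_add[of _ _ T1' T2']\<close>)
qed

lemma rep_continuous_on:
  assumes "rep b ok T" "continuous_on S b" "\<And>\<iota>. ok \<iota> \<Longrightarrow> continuous_on S (B \<iota>)"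
  shows "continuous_on S (T B)"
  using assms(1)
proof induction
  case (rep_term P \<iota>)
  then show ?case by (intro continuous_on_mult alg_continuous_on[OF rep_term(1)] assms)
qed (simp_all add: continuous_on_add)

text \<open>Only the coefficients enter the constant, and they are bounded on the compact set; B
  stays arbitrary.\<close>

lemma rep_bound:
  assumes "rep b ok T" "continuous_on K b" "compact K" "finite {\<iota>. ok \<iota>}"
  shows "\<exists>C\<ge>0. \<forall>B. \<forall>x\<in>K. \<bar>T B x\<bar> \<le> C * (\<Sum>\<iota> | ok \<iota>. \<bar>B \<iota> x\<bar>)"
  using assms(1)
proof induction
  case rep_zero
  show ?case by (rule exI[of _ 0]) auto
next
  case (rep_term P \<iota>)
  have "bounded (P ` K)"
    by (intro compact_imp_bounded compact_continuous_image alg_continuous_on[OF rep_term(1)] assms)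
  then obtain C where C: "C \<ge> 0" "\<And>x. x \<in> K \<Longrightarrow> \<bar>P x\<bar> \<le> C"
    by (metis bounded_pos imageI less_imp_le real_norm_def)
  show ?case
  proof (intro exI[of _ C] conjI allI ballI C)
    fix B :: "'b \<Rightarrow> real^'a \<Rightarrow> real" and x assume "x \<in> K"
    have "\<bar>B \<iota> x\<bar> \<le> (\<Sum>\<iota> | ok \<iota>. \<bar>B \<iota> x\<bar>)"
      using rep_term assms(4) by (intro member_le_sum[where f="\<lambda>\<iota>. \<bar>B \<iota> x\<bar>"]) auto
    then show "\<bar>P x * B \<iota> x\<bar> \<le> C * (\<Sum>\<iota> | ok \<iota>. \<bar>B \<iota> x\<bar>)"
      unfolding abs_mult using C \<open>x \<in> K\<close> by (intro mult_mono) auto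
  qed
next
  case (rep_add T1 T2)
  then obtain C1 C2 where C: "C1 \<ge> 0" "C2 \<ge> 0"
    "\<forall>B. \<forall>x\<in>K. \<bar>T1 B x\<bar> \<le> C1 * (\<Sum>\<iota> | ok \<iota>. \<bar>B \<iota> x\<bar>)"
    "\<forall>B. \<forall>x\<in>K. \<bar>T2 B x\<bar> \<le> C2 * (\<Sum>\<iota> | ok \<iota>. \<bar>B \<iota> x\<bar>)" by blast
  show ?case
  proof (intro exI[of _ "C1 + C2"] conjI allI ballI)
    fix B x assume "x \<in> K"
    then have "\<bar>T1 B x\<bar> \<le> C1 * (\<Sum>\<iota> | ok \<iota>. \<bar>B \<iota> x\<bar>)" "\<bar>T2 B x\<bar> \<le> C2 * (\<Sum>\<iota> | ok \<iota>. \<bar>B \<iota> x\<bar>)"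
      using C by auto
    then show "\<bar>T1 B x + T2 B x\<bar> \<le> (C1 + C2) * (\<Sum>\<iota> | ok \<iota>. \<bar>B \<iota> x\<bar>)"
      unfolding distrib_right by linarith
  qed (use C in auto)
qed

section \<open>Iterated partial derivatives and covariant derivatives\<close>

lemma smooth_has_pd:
  assumes "smooth_on S u" "x \<in> S"
  shows "has_pd i (pdl is u) x (pdl (i # is) u x)"
proof -
  have "pdl_ex (i # is) u x" using assms by (auto simp: smooth_on_def simp del: pdl_ex.simps)
  then show ?thesis
    by (auto simp: has_pd_def pdv_def DERIV_deriv_iff_real_differentiable)
qed

lemma smooth_continuous_on: "smooth_on S u \<Longrightarrow> continuous_on S (pdl is u)"
  by (simp add: smooth_on_def)

lemma smooth_pdl_diff:
  assumes "open S" "smooth_on S u" "smooth_on S w" "x \<in> S"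
  shows "pdl is (\<lambda>x. u x - w x) x = pdl is u x - pdl is w x"
    and "pdl_ex is (\<lambda>x. u x - w x) x"
proof -
  \<comment> \<open>Value and existence are proved together and for all points of S, since a
    derivative of the next order looks at neighbouring points.\<close>
  have "\<forall>x\<in>S. pdl is (\<lambda>x. u x - w x) x = pdl is u x - pdl is w x \<and> pdl_ex is (\<lambda>x. u x - w x) x"
  proof (induction "is")
    case (Cons i "is")
    show ?case
    proof
      fix x assume x: "x \<in> S"
      have "has_pd i (\<lambda>x. pdl is u x - pdl is w x) x (pdl (i # is) u x - pdl (i # is) w x)"
        by (rule has_pd_diff[OF smooth_has_pd[OF assms(2) x] smooth_has_pd[OF assms(3) x]])
      from has_pd_cong[OF assms(1) x _ this] have pd: "has_pd i (pdl is (\<lambda>x. u x - w x)) x (pdl (i # is) u x - pdl (i # is) w x)"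
        using Cons.IH by auto
      moreover have "\<forall>\<^sub>F t in nhds 0. pdl_ex is (\<lambda>x. u x - w x) (x + t *\<^sub>R axis i 1)"
        using has_pd_eventually_line[OF assms(1) x] by eventually_elim (use Cons.IH in auto)
      ultimately show "pdl (i # is) (\<lambda>x. u x - w x) x = pdl (i # is) u x - pdl (i # is) w x
          \<and> pdl_ex (i # is) (\<lambda>x. u x - w x) x"
        by (auto simp: has_pd_imp_pdv has_pd_def real_differentiable_def)
    qed
  qed auto
  then show "pdl is (\<lambda>x. u x - w x) x = pdl is u x - pdl is w x" "pdl_ex is (\<lambda>x. u x - w x) x"
    using assms(4) by auto
qed

lemma smooth_on_diff:
  assumes "open S" "smooth_on S u" "smooth_on S w"
  shows "smooth_on S (\<lambda>x. u x - w x)"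
  unfolding smooth_on_def
proof (intro allI conjI ballI)
  fix "is"
  have "continuous_on S (\<lambda>x. pdl is u x - pdl is w x)"
    by (intro continuous_intros smooth_continuous_on assms)
  then show "continuous_on S (pdl is (\<lambda>x. u x - w x))"
    by (rule continuous_on_eq) (simp add: smooth_pdl_diff[OF assms])
qed (rule smooth_pdl_diff[OF assms])

text \<open>Triangular structure: a component of the j-th covariant derivative is the matching
  partial derivative plus terms of order strictly below j. This is what allows the partial
  derivatives to be recovered by induction on the order. T does not depend on S, u or x.\<close>

lemma covd_rep:
  fixes "is" :: "'n::finite list"
  assumes "length is = j"
  shows "\<exists>T. rep conf (\<lambda>js. length js < j) T \<and>
    (\<forall>S u x. open S \<and> S \<subseteq> ball 0 1 \<and> smooth_on S u \<and> x \<in> S \<longrightarrow>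
      covd j u x is = pdl is u x + T (\<lambda>js. pdl js u) x)"
  using assms
proof (induction j arbitrary: "is")
  case 0
  then show ?case by (intro exI[of _ "\<lambda>B x. 0"]) (auto intro: rep_zero)
next
  case (Suc j)
  then obtain a rest where ar: "is = a # rest" "length rest = j" by (cases "is") auto
  define ok where "ok = (\<lambda>js::'n list. length js < j)"
  define ok' where "ok' = (\<lambda>js::'n list. length js < Suc j)"
  have "\<exists>T. \<forall>is. length is = j \<longrightarrow> rep conf ok (T is) \<and>
    (\<forall>S u x. open S \<and> S \<subseteq> ball 0 1 \<and> smooth_on S u \<and> x \<in> S \<longrightarrow>
      covd j u x is = pdl is u x + T is (\<lambda>js. pdl js u) x)"
    unfolding ok_def using Suc.IH by (intro choice) blast
  then obtain T where T: "\<And>is. length is = j \<Longrightarrow> rep conf ok (T is)"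
    "\<And>is S u x. length is = j \<Longrightarrow> open S \<Longrightarrow> S \<subseteq> ball 0 1 \<Longrightarrow> smooth_on S u \<Longrightarrow> x \<in> S \<Longrightarrow>
      covd j u x is = pdl is u x + T is (\<lambda>js. pdl js u) x"
    by blast
  have "\<exists>g. alg conf g \<and> (\<forall>x\<in>ball 0 1. christoffel x l a i = g x)" for l i
    by (rule alg_christoffel) blast
  then obtain g where g: "\<And>l i. alg conf (g l i)" "\<And>l i x. x \<in> ball 0 1 \<Longrightarrow> christoffel x l a i = g l i x"
    by metis
  have D: "rep conf ok' (\<lambda>B x. B (a # js) x)" if "ok js" for js
    using that by (intro rep_single) (auto simp: ok_def ok'_def)
  have oki: "ok js \<Longrightarrow> ok' js" for js by (auto simp: ok_def ok'_def)
  obtain T' where T': "rep conf ok' T'" "\<And>B x. x \<in> ball 0 1 \<Longrightarrow> (\<And>js. ok js \<Longrightarrow> has_pd a (B js) x (B (a # js) x)) \<Longrightarrow>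
      has_pd a (T rest B) x (T' B x)"
    using rep_deriv[where i=a and D="\<lambda>js B x. B (a # js) x", OF T(1)[OF ar(2)] pd_closed_conf oki D] by blast
  \<comment> \<open>The correction has two sources: the derivative of the previous lower-order part,
    and the Christoffel terms, whose lists \<open>rest[m := l]\<close> have length j and hence count
    as lower order at level j + 1.\<close>
  define Q where "Q = (\<lambda>B x. T' B x - (\<Sum>m<length rest. \<Sum>l\<in>UNIV. g l (rest ! m) x * (B (rest[m := l]) x + T (rest[m := l]) B x)))"
  show ?case
  proof (intro exI[of _ Q] conjI allI impI)
    have "rep conf ok' Q"
      unfolding Q_def
      by (intro rep_diff rep_sum rep_scale rep_add rep_single T' g finite finite_lessThan)
        (auto simp: ok'_def ar intro!: rep_mono[OF T(1)] simp: ok_def)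
    then show "rep conf (\<lambda>js. length js < Suc j) Q" by (simp add: ok'_def)
    fix S and u :: "real^'n \<Rightarrow> real" and x assume A: "open S \<and> S \<subseteq> ball 0 1 \<and> smooth_on S u \<and> x \<in> S"
    then have x: "x \<in> ball 0 1" by auto
    have "has_pd a (\<lambda>y. pdl rest u y + T rest (\<lambda>js. pdl js u) y) x (pdl (a # rest) u x + T' (\<lambda>js. pdl js u) x)"
      using A by (intro has_pd_add T'(2)[OF x] smooth_has_pd[of S]) auto
    from has_pd_cong[OF _ _ _ this, of S] have "has_pd a (\<lambda>y. covd j u y rest) x (pdl (a # rest) u x + T' (\<lambda>js. pdl js u) x)"
      using A T(2)[OF ar(2)] by auto
    then have "pdv a (\<lambda>y. covd j u y rest) x = pdl (a # rest) u x + T' (\<lambda>js. pdl js u) x"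
      by (rule has_pd_imp_pdv)
    moreover have "(\<Sum>m<length rest. \<Sum>l\<in>UNIV. christoffel x l a (rest ! m) * covd j u x (rest[m := l])) =
       (\<Sum>m<length rest. \<Sum>l\<in>UNIV. g l (rest ! m) x * (pdl (rest[m := l]) u x + T (rest[m := l]) (\<lambda>js. pdl js u) x))"
      using A by (intro sum.cong refl) (simp add: g(2)[OF x] T(2)[of _ S] ar)
    ultimately show "covd (Suc j) u x is = pdl is u x + Q (\<lambda>js. pdl js u) x"
      by (simp add: Q_def ar(1))
  qed
qed

section \<open>Equivalence of the hyperbolic and the Euclidean norm\<close>

lemma hball_eq_ball:
  assumes "R > 0"
  shows "(hball R :: (real^'n) set) = ball 0 (tanh (R/2))"
proof -
  have "hdist0 x < R \<longleftrightarrow> norm x < tanh (R/2)" if "norm x < 1" for x :: "real^'n"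
  proof -
    define s where "s = norm x"
    have s: "0 \<le> s" "s < 1" using that by (auto simp: s_def)
    have "hdist0 x < R \<longleftrightarrow> (1 + s) / (1 - s) < exp R"
      unfolding hdist0_def s_def[symmetric] using s ln_less_cancel_iff[of "(1 + s) / (1 - s)" "exp R"] by simp
    also have "\<dots> \<longleftrightarrow> s < (exp R - 1) / (exp R + 1)"
      using s exp_gt_zero[of R] by (simp add: field_simps add_pos_pos)
    also have "(exp R - 1) / (exp R + 1) = tanh (R/2)"
    proof -
      have "exp R + 1 \<noteq> 0" "exp R \<noteq> 0" using exp_gt_zero[of R] by linarith+
      then show ?thesis by (simp add: tanh_real_altdef exp_minus divide_simps add.commute)
    qed
    finally show ?thesis by (simp add: s_def)
  qed
  then show ?thesis
    using tanh_real_lt_1[of "R/2"] by (auto simp: hball_def dist_norm)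
qed

lemma open_hball: "R > 0 \<Longrightarrow> open (hball R :: (real^'n) set)"
  by (simp add: hball_eq_ball)

lemma closure_hball: "R > 0 \<Longrightarrow> closure (hball R :: (real^'n) set) = cball 0 (tanh (R/2))"
  by (simp add: hball_eq_ball)

lemma hball_subset: "hball R \<subseteq> ball (0 :: real^'n) 1"
  by (auto simp: hball_def)

lemma conf_ge: "x \<in> ball 0 1 \<Longrightarrow> conf x \<ge> 2"
  by (auto simp: conf_def field_simps abs_square_less_1)

lemma conf_le:
  assumes "R > 0" "x \<in> hball R"
  shows "conf x \<le> 2 / (1 - (tanh (R/2))\<^sup>2)"
proof -
  have "(norm x)\<^sup>2 \<le> (tanh (R/2))\<^sup>2"
    using assms by (intro power_mono) (auto simp: hball_eq_ball)
  moreover have "(tanh (R/2))\<^sup>2 < 1"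
    using assms tanh_real_lt_1[of "R/2"] by (simp add: power_less_one_iff)
  ultimately show ?thesis
    unfolding conf_def by (intro divide_left_mono) (auto intro!: mult_pos_pos)
qed

lemma finite_lists_le: "finite {js::'n::finite list. length js \<le> k}"
  using finite_lists_length_le[of "UNIV::'n set" k] by simp

lemma finite_lists_less: "finite {js::'n::finite list. length js < k}"
  by (rule finite_subset[OF _ finite_lists_le[of k]]) auto

lemma finite_lists_eq: "finite {js::'n::finite list. length js = k}"
  by (rule finite_subset[OF _ finite_lists_le[of k]]) auto

text \<open>The inverse metric is a multiple of the identity, so the product over m vanishes unless
  the two index lists coincide, and the double sum collapses to its diagonal.\<close>

lemma tnorm_eq:
  fixes x :: "real^'n"
  assumes "x \<in> ball 0 1"
  shows "tnorm j x T = (1 / conf x)^j * L2_set T {is. length is = j}"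
proof -
  let ?L = "{is::'n list. length is = j}"
  have pos: "conf x > 0" using conf_ge[OF assms] by simp
  have prod: "(\<Prod>m<j. ginv x (is ! m) (js ! m)) = (if is = js then ((1 / conf x)^j)\<^sup>2 else 0)"
    if L: "is \<in> ?L" "js \<in> ?L" for "is" js
  proof (cases "is = js")
    case True
    then show ?thesis by (simp add: ginv_def power_mult[symmetric] mult.commute)
  next
    case False
    then obtain m where "m < j" "is ! m \<noteq> js ! m"
      using L by (metis (mono_tags) mem_Collect_eq nth_equalityI)
    then show ?thesis using False by (auto simp: ginv_def intro!: prod_zero)
  qed
  have "(\<Sum>is\<in>?L. \<Sum>js\<in>?L. (\<Prod>m<j. ginv x (is ! m) (js ! m)) * T is * T js)
     = (\<Sum>is\<in>?L. \<Sum>js\<in>?L. if is = js then ((1 / conf x)^j)\<^sup>2 * (T js)\<^sup>2 else 0)"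
    by (intro sum.cong refl) (simp add: prod power2_eq_square)
  also have "\<dots> = ((1 / conf x)^j)\<^sup>2 * (\<Sum>is\<in>?L. (T is)\<^sup>2)"
    unfolding sum_distrib_left by (intro sum.cong refl) (simp add: finite_lists_eq)
  finally show ?thesis
    unfolding tnorm_def L2_set_def using pos by (simp add: real_sqrt_mult)
qed

definition jet :: "nat \<Rightarrow> (real^'n \<Rightarrow> real) \<Rightarrow> real^'n \<Rightarrow> real" where
  "jet k u x = (\<Sum>js | length js \<le> k. \<bar>pdl js u x\<bar>)"

lemma jet_nonneg: "jet k u x \<ge> 0"
  by (auto simp: jet_def intro: sum_nonneg)

lemma jet_mono: "j \<le> k \<Longrightarrow> jet j u x \<le> jet k u x"
  unfolding jet_def by (intro sum_mono2 finite_lists_le) auto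

lemma jet_Suc: "jet (Suc k) u x = jet k u x + (\<Sum>js | length js = Suc k. \<bar>pdl js u x\<bar>)"
proof -
  have "{js::'a list. length js \<le> Suc k} = {js. length js \<le> k} \<union> {js. length js = Suc k}" by auto
  then show ?thesis
    unfolding jet_def by (simp add: sum.union_disjoint[OF finite_lists_le finite_lists_eq] disjoint_iff)
qed

lemma jet_continuous_on: "smooth_on S u \<Longrightarrow> continuous_on S (jet k u)"
  unfolding jet_def[abs_def] by (intro continuous_intros smooth_continuous_on)

text \<open>The closed ball of radius tanh(R/2) is a compact subset of the unit ball, which bounds
  the coefficients of \<open>covd_rep\<close>. Adding the constants of the finitely many index lists
  gives one constant for all of them.\<close>

lemma covd_rep_bound:
  assumes "R > 0"
  shows "\<exists>C\<ge>0. \<forall>u. smooth_on (hball R) u \<longrightarrow> (\<forall>x\<in>hball R. \<forall>is. length is = j \<longrightarrow>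
     \<bar>covd j u x is - pdl is u x\<bar> \<le> C * (\<Sum>js::'n::finite list | length js < j. \<bar>pdl js u x\<bar>))"
proof -
  have "\<exists>C\<ge>0. \<forall>u. smooth_on (hball R) u \<longrightarrow> (\<forall>x\<in>hball R.
     \<bar>covd j u x is - pdl is u x\<bar> \<le> C * (\<Sum>js | length js < j. \<bar>pdl js u x\<bar>))"
    if len: "length is = j" for "is" :: "'n list"
  proof -
    obtain T where T: "rep conf (\<lambda>js. length js < j) T"
      "\<And>S u x. open S \<and> S \<subseteq> ball 0 1 \<and> smooth_on S u \<and> x \<in> S \<Longrightarrow>
        covd j u x is = pdl is u x + T (\<lambda>js. pdl js u) x"
      using covd_rep[OF len] by blast
    have sub: "cball 0 (tanh (R/2)) \<subseteq> ball (0::real^'n) 1"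
      using tanh_real_lt_1[of "R/2"] by (auto simp: dist_norm)
    obtain C where "C \<ge> 0" and C: "\<And>B x. x \<in> cball 0 (tanh (R/2)) \<Longrightarrow> \<bar>T B x\<bar> \<le> C * (\<Sum>js | length js < j. \<bar>B js x\<bar>)"
      using rep_bound[OF T(1) continuous_on_subset[OF continuous_on_conf sub] compact_cball finite_lists_less]
      by blast
    show ?thesis
    proof (intro exI[of _ C] conjI allI impI ballI \<open>C \<ge> 0\<close>)
      fix u :: "real^'n \<Rightarrow> real" and x :: "real^'n" assume u: "smooth_on (hball R) u" and x: "x \<in> hball R"
      have "x \<in> cball 0 (tanh (R/2))" using x assms by (simp add: hball_eq_ball)
      from C[OF this, of "\<lambda>js. pdl js u"] T(2)[of "hball R" u x] u x open_hball[OF assms, where 'n='n] hball_subset[of R, where 'n='n]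
      show "\<bar>covd j u x is - pdl is u x\<bar> \<le> C * (\<Sum>js | length js < j. \<bar>pdl js u x\<bar>)"
        by auto
    qed
  qed
  then have "\<exists>C. \<forall>is. length is = j \<longrightarrow> C is \<ge> 0 \<and> (\<forall>u. smooth_on (hball R) u \<longrightarrow> (\<forall>x\<in>hball R.
     \<bar>covd j u x is - pdl is u x\<bar> \<le> C is * (\<Sum>js::'n list | length js < j. \<bar>pdl js u x\<bar>)))"
    by (intro choice) blast
  then obtain C where C: "\<And>is. length is = j \<Longrightarrow> C is \<ge> 0" "\<And>is u x. length is = j \<Longrightarrow> smooth_on (hball R) u \<Longrightarrow>
     x \<in> hball R \<Longrightarrow> \<bar>covd j u x is - pdl is u x\<bar> \<le> C is * (\<Sum>js::'n list | length js < j. \<bar>pdl js u x\<bar>)"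
    by blast
  show ?thesis
  proof (intro exI[of _ "\<Sum>is | length is = j. C is"] conjI allI impI ballI)
    show "(\<Sum>is | length is = j. C is) \<ge> 0" using C by (auto intro: sum_nonneg)
    fix u :: "real^'n \<Rightarrow> real" and x :: "real^'n" and "is" :: "'n list" assume *: "smooth_on (hball R) u" "x \<in> hball R" "length is = j"
    have "C is \<le> (\<Sum>is | length is = j. C is)"
      using * C by (intro member_le_sum finite_lists_eq) auto
    then have "C is * (\<Sum>js::'n list | length js < j. \<bar>pdl js u x\<bar>) \<le> (\<Sum>is | length is = j. C is) * (\<Sum>js::'n list | length js < j. \<bar>pdl js u x\<bar>)"
      by (intro mult_right_mono sum_nonneg) auto
    with C(2)[OF *(3,1,2)]
    show "\<bar>covd j u x is - pdl is u x\<bar> \<le> (\<Sum>is | length is = j. C is) * (\<Sum>js::'n list | length js < j. \<bar>pdl js u x\<bar>)"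
      by linarith
  qed
qed

lemma covd_continuous_on:
  fixes "is" :: "'n::finite list"
  assumes "R > 0" "smooth_on (hball R) u" "length is = j"
  shows "continuous_on (hball R) (\<lambda>x. covd j u x is)"
proof -
  obtain T where T: "rep conf (\<lambda>js. length js < j) T"
    "\<And>S u x. open S \<and> S \<subseteq> ball 0 1 \<and> smooth_on S u \<and> x \<in> S \<Longrightarrow>
      covd j u x is = pdl is u x + T (\<lambda>js. pdl js u) x"
    using covd_rep[OF assms(3)] by blast
  have "continuous_on (hball R) (T (\<lambda>js. pdl js u))"
    by (intro rep_continuous_on[OF T(1)] continuous_on_subset[OF continuous_on_conf hball_subset]
        smooth_continuous_on assms)
  then have "continuous_on (hball R) (\<lambda>x. pdl is u x + T (\<lambda>js. pdl js u) x)"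
    by (intro continuous_on_add smooth_continuous_on assms)
  then show ?thesis
    using T(2)[of "hball R" u] assms open_hball[OF assms(1)] hball_subset by (subst continuous_on_cong[OF refl]) auto
qed

text \<open>Induction on the order: a partial derivative of top order is the covariant one up to
  terms that are already controlled by the induction hypothesis.\<close>

lemma jet_le_tnorm:
  assumes "R > 0"
  shows "\<exists>C\<ge>0. \<forall>u::real^'n \<Rightarrow> real. smooth_on (hball R) u \<longrightarrow> (\<forall>x\<in>hball R.
     jet k u x \<le> C * (\<Sum>j\<le>k. tnorm j x (covd j u x)))"
proof (induction k)
  case 0
  have "{js::'n list. js = []} = {[]}" by auto
  moreover have "tnorm 0 x T = \<bar>T []\<bar>" if "x \<in> ball 0 1" for x :: "real^'n" and T
    using tnorm_eq[OF that, of 0 T] by (simp add: L2_set_def \<open>{js::'n list. js = []} = {[]}\<close>)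
  ultimately show ?case
    using hball_subset[of R] by (intro exI[of _ 1]) (auto simp: jet_def)
next
  case (Suc k)
  then obtain C where C: "C \<ge> 0" "\<And>u x. smooth_on (hball R) u \<Longrightarrow> x \<in> hball R \<Longrightarrow>
     jet k u x \<le> C * (\<Sum>j\<le>k. tnorm j x (covd j (u::real^'n \<Rightarrow> real) x))" by blast
  obtain C1 where C1: "C1 \<ge> 0" "\<And>u x is. smooth_on (hball R) u \<Longrightarrow> x \<in> hball R \<Longrightarrow> length is = Suc k \<Longrightarrow>
     \<bar>covd (Suc k) u x is - pdl is u x\<bar> \<le> C1 * (\<Sum>js::'n list | length js < Suc k. \<bar>pdl js u x\<bar>)"
    using covd_rep_bound[OF assms, of "Suc k"] by blast
  define D where "D = 2 / (1 - (tanh (R/2))\<^sup>2)"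
  define n where "n = real (card {is::'n list. length is = Suc k})"
  have n: "n \<ge> 0" by (simp add: n_def)
  have D: "D \<ge> 0" unfolding D_def using tanh_real_lt_1[of "R/2"] assms by (simp add: power_le_one less_imp_le)
  \<comment> \<open>The summands stand for the jet of order k, for the top tensor rescaled by
    \<open>conf\<close>^(k+1) <= D^(k+1), and for the lower-order error C1 times the jet of order k;
    n counts the index lists of top order.\<close>
  show ?case
  proof (intro exI[of _ "C + n * D ^ Suc k + n * C1 * C"] conjI allI impI ballI)
    show "C + n * D ^ Suc k + n * C1 * C \<ge> 0" using C C1 D n by simp
    fix u :: "real^'n \<Rightarrow> real" and x :: "real^'n" assume *: "smooth_on (hball R) u" "x \<in> hball R"
    let ?t = "\<lambda>j. tnorm j x (covd j u x)"
    have xb: "x \<in> ball 0 1" using * hball_subset[of R] by auto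
    have tpos: "?t j \<ge> 0" for j
      using conf_ge[OF xb] by (simp add: tnorm_eq[OF xb] L2_set_nonneg)
    have "\<bar>pdl is u x\<bar> \<le> D ^ Suc k * ?t (Suc k) + C1 * jet k u x" if "length is = Suc k" for "is"
    proof -
      have "\<bar>pdl is u x\<bar> \<le> \<bar>covd (Suc k) u x is\<bar> + C1 * jet k u x"
        using C1(2)[OF * that] by (simp add: jet_def less_Suc_eq_le)
      also have "\<bar>covd (Suc k) u x is\<bar> \<le> L2_set (covd (Suc k) u x) {is. length is = Suc k}"
        using member_le_L2_set[OF finite_lists_eq, of "is" "Suc k" "\<lambda>is. \<bar>covd (Suc k) u x is\<bar>"] that
        by (simp add: L2_set_def)
      also have "\<dots> = conf x ^ Suc k * ?t (Suc k)"
        using conf_ge[OF xb] by (simp add: tnorm_eq[OF xb] power_divide)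
      also have "\<dots> \<le> D ^ Suc k * ?t (Suc k)"
        unfolding D_def using conf_le[OF assms *(2)] conf_ge[OF xb]
        by (intro mult_right_mono power_mono tpos) auto
      finally show ?thesis by simp
    qed
    then have "(\<Sum>is | length is = Suc k. \<bar>pdl is u x\<bar>) \<le> n * (D ^ Suc k * ?t (Suc k) + C1 * jet k u x)"
      unfolding n_def by (intro sum_bounded_above) auto
    also have "\<dots> \<le> n * (D ^ Suc k * (\<Sum>j\<le>Suc k. ?t j) + C1 * (C * (\<Sum>j\<le>Suc k. ?t j)))"
    proof -
      have "?t (Suc k) \<le> (\<Sum>j\<le>Suc k. ?t j)" by (rule member_le_sum) (auto simp: tpos)
      moreover have "jet k u x \<le> C * (\<Sum>j\<le>Suc k. ?t j)"
        using C(2)[OF *] mult_left_mono[OF _ C(1), of "\<Sum>j\<le>k. ?t j" "\<Sum>j\<le>Suc k. ?t j"] tpos by simp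
      ultimately show ?thesis using n D C1(1) by (intro mult_left_mono add_mono) auto
    qed
    finally have "jet (Suc k) u x \<le> C * (\<Sum>j\<le>Suc k. ?t j) + n * (D ^ Suc k * (\<Sum>j\<le>Suc k. ?t j) + C1 * (C * (\<Sum>j\<le>Suc k. ?t j)))"
      using C(2)[OF *] mult_left_mono[OF _ C(1), of "\<Sum>j\<le>k. ?t j" "\<Sum>j\<le>Suc k. ?t j"] tpos
      unfolding jet_Suc by simp
    then show "jet (Suc k) u x \<le> (C + n * D ^ Suc k + n * C1 * C) * (\<Sum>j\<le>Suc k. ?t j)"
      by (simp only: algebra_simps)
  qed
qed

text \<open>The error terms of \<open>covd_rep_bound\<close> belong to the jet, and the factor
  (1/\<open>conf\<close>)^j is at most 1 because \<open>conf\<close> is at least 2 on the unit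
  ball.\<close>

lemma tnorm_le_jet:
  assumes "R > 0"
  shows "\<exists>C\<ge>0. \<forall>u::real^'n \<Rightarrow> real. smooth_on (hball R) u \<longrightarrow> (\<forall>x\<in>hball R.
     tnorm j x (covd j u x) \<le> C * jet j u x)"
proof -
  obtain C1 where C1: "C1 \<ge> 0" "\<And>u x is. smooth_on (hball R) u \<Longrightarrow> x \<in> hball R \<Longrightarrow> length is = j \<Longrightarrow>
     \<bar>covd j u x is - pdl is u x\<bar> \<le> C1 * (\<Sum>js::'n list | length js < j. \<bar>pdl js u x\<bar>)"
    using covd_rep_bound[OF assms, of j] by blast
  define n where "n = real (card {is::'n list. length is = j})"
  show ?thesis
  proof (intro exI[of _ "n * (1 + C1)"] conjI allI impI ballI)
    show "n * (1 + C1) \<ge> 0" using C1 by (simp add: n_def)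
    fix u :: "real^'n \<Rightarrow> real" and x :: "real^'n" assume *: "smooth_on (hball R) u" "x \<in> hball R"
    have xb: "x \<in> ball 0 1" using * hball_subset[of R] by auto
    have "\<bar>covd j u x is\<bar> \<le> (1 + C1) * jet j u x" if "length is = j" for "is"
    proof -
      have "\<bar>pdl is u x\<bar> \<le> jet j u x"
        unfolding jet_def using that
        by (intro member_le_sum[where f="\<lambda>js. \<bar>pdl js u x\<bar>"] finite_lists_le) auto
      moreover have "(\<Sum>js::'n list | length js < j. \<bar>pdl js u x\<bar>) \<le> jet j u x"
        unfolding jet_def by (intro sum_mono2 finite_lists_le) auto
      then have "C1 * (\<Sum>js::'n list | length js < j. \<bar>pdl js u x\<bar>) \<le> C1 * jet j u x"
        by (intro mult_left_mono C1)
      ultimately show ?thesis using C1(2)[OF * that] by (simp add: distrib_right)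
    qed
    then have "(\<Sum>is | length is = j. \<bar>covd j u x is\<bar>) \<le> n * ((1 + C1) * jet j u x)"
      unfolding n_def by (intro sum_bounded_above) auto
    moreover have "L2_set (covd j u x) {is. length is = j} \<le> (\<Sum>is | length is = j. \<bar>covd j u x is\<bar>)"
      by (rule L2_set_le_sum_abs)
    moreover have "tnorm j x (covd j u x) \<le> L2_set (covd j u x) {is. length is = j}"
      unfolding tnorm_eq[OF xb] using conf_ge[OF xb]
      by (intro mult_left_le_one_le L2_set_nonneg) (auto simp: power_le_one)
    ultimately show "tnorm j x (covd j u x) \<le> n * (1 + C1) * jet j u x" by (simp add: mult.assoc)
  qed
qed

section \<open>The Euclidean energy and its comparison with the Sobolev norm\<close>

lemma sum_powr_le:
  fixes a :: "'i \<Rightarrow> real"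
  assumes "finite A" "\<And>i. i \<in> A \<Longrightarrow> a i \<ge> 0" "p > 0"
  shows "(\<Sum>i\<in>A. a i) powr p \<le> real (card A) powr p * (\<Sum>i\<in>A. a i powr p)"
proof (cases "A = {}")
  case False
  \<comment> \<open>The sum is at most its number of terms times the largest term, whose p-th power
    is one of the summands on the right.\<close>
  define m where "m = Max (a ` A)"
  have "m \<in> a ` A" unfolding m_def using False assms(1) by (intro Max_in) auto
  then obtain i where i: "i \<in> A" "m = a i" by auto
  have "(\<Sum>i\<in>A. a i) \<le> real (card A) * m"
    unfolding m_def using assms(1) by (intro sum_bounded_above) auto
  then have "(\<Sum>i\<in>A. a i) powr p \<le> (real (card A) * m) powr p"
    using assms by (intro powr_mono2 sum_nonneg) auto
  also have "\<dots> = real (card A) powr p * m powr p"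
    using assms i by (simp add: powr_mult)
  also have "m powr p \<le> (\<Sum>i\<in>A. a i powr p)"
    unfolding i(2) using assms i by (intro member_le_sum[where f="\<lambda>i. a i powr p"]) auto
  finally show ?thesis by (simp add: mult_left_mono)
qed simp

text \<open>The Euclidean counterpart of \<open>Wnorm_pow\<close>, with all derivatives under a
  single p-th power and flat Borel-Lebesgue measure, to which the polar formula and Tonelli apply
  directly.\<close>

definition energy :: "nat \<Rightarrow> real \<Rightarrow> real \<Rightarrow> (real^'n \<Rightarrow> real) \<Rightarrow> ennreal" where
  "energy k p R u = (\<integral>\<^sup>+ x. indicator (hball R) x * ennreal (jet k u x powr p) \<partial>lborel)"

lemma jet_powr_measurable:
  assumes "R > 0" "p > 0" "smooth_on (hball R) u"
  shows "(\<lambda>x::real^'n. indicator (hball R) x * ennreal (jet k u x powr p)) \<in> borel_measurable borel"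
proof -
  have "(\<lambda>x. indicator (hball R) x *\<^sub>R (jet k u x powr p)) \<in> borel_measurable borel"
    using assms jet_nonneg
    by (intro borel_measurable_continuous_on_indicator continuous_on_powr' jet_continuous_on)
      (auto simp: open_hball)
  then have "(\<lambda>x. ennreal (indicator (hball R) x *\<^sub>R (jet k u x powr p))) \<in> borel_measurable borel"
    by measurable
  then show ?thesis
    by (rule measurable_cong[THEN iffD1, rotated]) (auto simp: indicator_def)
qed

lemma conf_powr_measurable:
  assumes "R > 0" "p > 0" "smooth_on (hball R) u"
  shows "(\<lambda>x::real^'n. indicator (hball R) x * ennreal (tnorm j x (covd j u x) powr p * conf x ^ CARD('n)))
    \<in> borel_measurable borel"
proof -
  have sub: "hball R \<subseteq> ball (0::real^'n) 1" by (rule hball_subset)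
  have c: "continuous_on (hball R) (conf :: real^'n \<Rightarrow> real)"
    by (rule continuous_on_subset[OF continuous_on_conf sub])
  have c0: "conf x \<ge> 2" if "x \<in> hball R" for x :: "real^'n"
    using that sub by (intro conf_ge) auto
  have t0: "tnorm j x (covd j u x) \<ge> 0" if "x \<in> hball R" for x :: "real^'n"
    using that sub c0[OF that] tnorm_eq[of x j] by (auto simp: L2_set_nonneg)
  have "continuous_on (hball R) (\<lambda>x. (1 / conf x)^j * L2_set (covd j u x) {is. length is = j})"
    unfolding L2_set_def using assms c0
    by (intro continuous_intros c covd_continuous_on) force+
  then have ct: "continuous_on (hball R) (\<lambda>x. tnorm j x (covd j u x))"
    by (rule continuous_on_eq) (rule tnorm_eq[symmetric], use sub in auto)
  have "(\<lambda>x. indicator (hball R) x *\<^sub>R (tnorm j x (covd j u x) powr p * conf x ^ CARD('n))) \<in> borel_measurable borel"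
    using assms t0
    by (intro borel_measurable_continuous_on_indicator continuous_on_mult continuous_on_power c continuous_on_powr' ct continuous_on_const)
      (auto simp: open_hball)
  then have "(\<lambda>x. ennreal (indicator (hball R) x *\<^sub>R (tnorm j x (covd j u x) powr p * conf x ^ CARD('n)))) \<in> borel_measurable borel"
    by measurable
  then show ?thesis
    by (rule measurable_cong[THEN iffD1, rotated]) (auto simp: indicator_def)
qed

lemma energy_le_Wnorm_pow:
  assumes "R > 0" "p > 0"
  shows "\<exists>C\<ge>0. \<forall>u::real^'n \<Rightarrow> real. smooth_on (hball R) u \<longrightarrow> energy k p R u \<le> ennreal C * Wnorm_pow k p R u"
proof -
  obtain C where C: "C \<ge> 0" "\<And>u x. smooth_on (hball R) u \<Longrightarrow> x \<in> hball R \<Longrightarrow>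
     jet k u x \<le> C * (\<Sum>j\<le>k. tnorm j x (covd j (u::real^'n \<Rightarrow> real) x))"
    using jet_le_tnorm[OF assms(1), of k] by blast
  define D where "D = C powr p * real (Suc k) powr p"
  show ?thesis
  proof (intro exI[of _ D] conjI allI impI)
    show "D \<ge> 0" by (simp add: D_def)
    fix u :: "real^'n \<Rightarrow> real" assume u: "smooth_on (hball R) u"
    note m = conf_powr_measurable[OF assms u]
    have "indicator (hball R) x * ennreal (jet k u x powr p) \<le>
      ennreal D * (\<Sum>j\<le>k. indicator (hball R) x * ennreal (tnorm j x (covd j u x) powr p * conf x ^ CARD('n)))" for x
    proof (cases "x \<in> hball R")
      case True
      let ?t = "\<lambda>j. tnorm j x (covd j u x)"
      have xb: "x \<in> ball 0 1" using True hball_subset[of R] by auto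
      have t0: "?t j \<ge> 0" for j using conf_ge[OF xb] by (simp add: tnorm_eq[OF xb] L2_set_nonneg)
      have "jet k u x powr p \<le> (C * (\<Sum>j\<le>k. ?t j)) powr p"
        using C(2)[OF u True] assms jet_nonneg by (intro powr_mono2) auto
      also have "\<dots> = C powr p * (\<Sum>j\<le>k. ?t j) powr p"
        using C t0 by (simp add: powr_mult sum_nonneg)
      also have "\<dots> \<le> C powr p * (real (Suc k) powr p * (\<Sum>j\<le>k. ?t j powr p))"
        using sum_powr_le[of "{..k}" ?t p] t0 assms by (intro mult_left_mono) auto
      also have "\<dots> \<le> D * (\<Sum>j\<le>k. ?t j powr p * conf x ^ CARD('n))"
      proof -
        \<comment> \<open>The hyperbolic volume factor is at least 1, so inserting it only enlarges
          the right-hand side.\<close>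
        have "1 \<le> conf x ^ CARD('n)" using conf_ge[OF xb] by (intro one_le_power) auto
        then have "?t j powr p \<le> ?t j powr p * conf x ^ CARD('n)" for j
          using mult_left_mono[of 1 "conf x ^ CARD('n)" "?t j powr p"] by simp
        then show ?thesis
          unfolding D_def mult.assoc by (intro mult_left_mono sum_mono) auto
      qed
      finally show ?thesis
        using True conf_ge[OF xb] by (simp add: ennreal_mult[symmetric] sum_nonneg D_def)
    qed simp
    then have "energy k p R u \<le> (\<integral>\<^sup>+ x. ennreal D * (\<Sum>j\<le>k. indicator (hball R) x * ennreal (tnorm j x (covd j u x) powr p * conf x ^ CARD('n))) \<partial>lborel)"
      unfolding energy_def by (intro nn_integral_mono) auto
    also have "\<dots> = ennreal D * Wnorm_pow k p R u"
    proof -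
      define f where "f = (\<lambda>j (x::real^'n). indicator (hball R) x * ennreal (tnorm j x (covd j u x) powr p * conf x ^ CARD('n)))"
      have f: "f j \<in> borel_measurable lborel" for j using m[of j] by (simp add: f_def)
      show ?thesis
        unfolding Wnorm_pow_def nn_integral_completion f_def[symmetric, THEN fun_cong, THEN fun_cong, simplified]
        using f by (simp add: nn_integral_cmult nn_integral_sum flip: f_def[THEN fun_cong, THEN fun_cong])
    qed
    finally show "energy k p R u \<le> ennreal D * Wnorm_pow k p R u" .
  qed
qed

lemma Wnorm_pow_le_energy:
  assumes "R > 0" "p > 0"
  shows "\<exists>C\<ge>0. \<forall>u::real^'n \<Rightarrow> real. smooth_on (hball R) u \<longrightarrow> Wnorm_pow k p R u \<le> ennreal C * energy k p R u"
proof -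
  have "\<exists>C. \<forall>j. C j \<ge> 0 \<and> (\<forall>u::real^'n \<Rightarrow> real. smooth_on (hball R) u \<longrightarrow> (\<forall>x\<in>hball R.
     tnorm j x (covd j u x) \<le> C j * jet j u x))"
    using tnorm_le_jet[OF assms(1), where 'n='n] by (intro choice) blast
  then obtain C where C: "\<And>j. C j \<ge> 0" "\<And>j u x. smooth_on (hball R) u \<Longrightarrow> x \<in> hball R \<Longrightarrow>
     tnorm j x (covd j (u::real^'n \<Rightarrow> real) x) \<le> C j * jet j u x"
    by blast
  define D where "D = (2 / (1 - (tanh (R/2))\<^sup>2)) ^ CARD('n)"
  have D: "D \<ge> 0" unfolding D_def using tanh_real_lt_1[of "R/2"] assms
    by (intro zero_le_power) (simp add: power_le_one less_imp_le)
  show ?thesis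
  proof (intro exI[of _ "\<Sum>j\<le>k. C j powr p * D"] conjI allI impI)
    show "(\<Sum>j\<le>k. C j powr p * D) \<ge> 0" using D by (intro sum_nonneg) auto
    fix u :: "real^'n \<Rightarrow> real" assume u: "smooth_on (hball R) u"
    have "indicator (hball R) x * ennreal (tnorm j x (covd j u x) powr p * conf x ^ CARD('n)) \<le>
      ennreal (C j powr p * D) * (indicator (hball R) x * ennreal (jet k u x powr p))" if "j \<le> k" for x j
    proof (cases "x \<in> hball R")
      case True
      let ?t = "tnorm j x (covd j u x)"
      have xb: "x \<in> ball 0 1" using True hball_subset[of R] by auto
      have t0: "?t \<ge> 0" using conf_ge[OF xb] by (simp add: tnorm_eq[OF xb] L2_set_nonneg)
      have "?t \<le> C j * jet k u x"
        using C(2)[OF u True, of j] mult_left_mono[OF jet_mono[OF that, of u x] C(1)[of j]] by linarith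
      then have "?t powr p \<le> (C j * jet k u x) powr p"
        using t0 assms by (intro powr_mono2) auto
      also have "\<dots> = C j powr p * jet k u x powr p"
        using C jet_nonneg by (simp add: powr_mult)
      finally have "?t powr p * conf x ^ CARD('n) \<le> (C j powr p * jet k u x powr p) * D"
        unfolding D_def using conf_ge[OF xb] conf_le[OF assms(1) True]
        by (intro mult_mono power_mono) auto
      then show ?thesis
        using True D by (simp add: ennreal_mult[symmetric] mult_ac)
    qed simp
    then have "Wnorm_pow k p R u \<le> (\<Sum>j\<le>k. \<integral>\<^sup>+ x. ennreal (C j powr p * D) * (indicator (hball R) x * ennreal (jet k u x powr p)) \<partial>lborel)"
      unfolding Wnorm_pow_def nn_integral_completion by (intro sum_mono nn_integral_mono) auto
    also have "\<dots> = (\<Sum>j\<le>k. ennreal (C j powr p * D)) * energy k p R u"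
      unfolding energy_def using jet_powr_measurable[OF assms u, of k]
      by (simp add: nn_integral_cmult sum_distrib_right)
    also have "(\<Sum>j\<le>k. ennreal (C j powr p * D)) = ennreal (\<Sum>j\<le>k. C j powr p * D)"
      using D by (intro sum_ennreal) auto
    finally show "Wnorm_pow k p R u \<le> ennreal (\<Sum>j\<le>k. C j powr p * D) * energy k p R u" .
  qed
qed

lemma jet_triangle:
  assumes "open S" "smooth_on S u" "smooth_on S w" "x \<in> S"
  shows "jet k u x \<le> jet k (\<lambda>x. u x - w x) x + jet k w x"
    and "jet k (\<lambda>x. u x - w x) x \<le> jet k u x + jet k w x"
  unfolding jet_def sum.distrib[symmetric]
  by (intro sum_mono; simp add: smooth_pdl_diff[OF assms])+

lemma add_powr_le:
  assumes "a \<ge> 0" "b \<ge> 0" "p > 0"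
  shows "(a + b) powr p \<le> 2 powr p * (a powr p + b powr (p::real))"
  using sum_powr_le[of "{True, False}" "\<lambda>c. if c then a else b" p] assms by auto

lemma energy_triangle:
  fixes u w :: "real^'n \<Rightarrow> real"
  assumes "R > 0" "p > 0" "smooth_on (hball R) u" "smooth_on (hball R) w"
  shows "energy k p R u \<le> ennreal (2 powr p) * (energy k p R (\<lambda>x. u x - w x) + energy k p R w)"
    and "energy k p R (\<lambda>x. u x - w x) \<le> ennreal (2 powr p) * (energy k p R u + energy k p R w)"
proof -
  have *: "energy k p R f \<le> ennreal (2 powr p) * (energy k p R g + energy k p R h)"
    if "smooth_on (hball R) g" "smooth_on (hball R) h" "\<And>x. x \<in> hball R \<Longrightarrow> jet k f x \<le> jet k g x + jet k h x"
    for f g h :: "real^'n \<Rightarrow> real"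
  proof -
    have "indicator (hball R) x * ennreal (jet k f x powr p) \<le> ennreal (2 powr p) *
        (indicator (hball R) x * ennreal (jet k g x powr p) + indicator (hball R) x * ennreal (jet k h x powr p))" for x
    proof (cases "x \<in> hball R")
      case True
      have "jet k f x powr p \<le> (jet k g x + jet k h x) powr p"
        using that(3)[OF True] jet_nonneg assms by (intro powr_mono2) auto
      also have "\<dots> \<le> 2 powr p * (jet k g x powr p + jet k h x powr p)"
        using jet_nonneg assms by (intro add_powr_le) auto
      finally show ?thesis using True by (simp add: ennreal_mult[symmetric] flip: ennreal_plus)
    qed simp
    then have "energy k p R f \<le> (\<integral>\<^sup>+ x. ennreal (2 powr p) *
        (indicator (hball R) x * ennreal (jet k g x powr p) + indicator (hball R) x * ennreal (jet k h x powr p)) \<partial>lborel)"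
      unfolding energy_def by (intro nn_integral_mono) auto
    also have "\<dots> = ennreal (2 powr p) * (energy k p R g + energy k p R h)"
      unfolding energy_def using jet_powr_measurable[OF assms(1,2) that(1), of k] jet_powr_measurable[OF assms(1,2) that(2), of k]
      by (simp add: nn_integral_cmult nn_integral_add)
    finally show ?thesis .
  qed
  have o: "open (hball R :: (real^'n) set)" by (rule open_hball[OF assms(1)])
  show "energy k p R u \<le> ennreal (2 powr p) * (energy k p R (\<lambda>x. u x - w x) + energy k p R w)"
    by (intro * smooth_on_diff jet_triangle[OF o] assms o)
  show "energy k p R (\<lambda>x. u x - w x) \<le> ennreal (2 powr p) * (energy k p R u + energy k p R w)"
    by (intro * jet_triangle[OF o] assms)
qed

section \<open>Polar coordinates\<close>

lemma nn_integral_scale: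
  fixes h :: "real^'n \<Rightarrow> ennreal"
  assumes [measurable]: "h \<in> borel_measurable borel" and "c > 0"
  shows "(\<integral>\<^sup>+x. h (c *\<^sub>R x) \<partial>lborel) = ennreal (1 / c ^ CARD('n)) * (\<integral>\<^sup>+x. h x \<partial>lborel)"
proof -
  have "(\<integral>\<^sup>+x. h x \<partial>lborel) = (\<integral>\<^sup>+x. h x \<partial>density (distr lborel borel (\<lambda>x. 0 + c *\<^sub>R x)) (\<lambda>_. \<bar>c\<bar>^DIM(real^'n)))"
    using assms(2) by (subst lborel_affine[of c 0]) auto
  also have "\<dots> = ennreal (c ^ CARD('n)) * (\<integral>\<^sup>+x. h (c *\<^sub>R x) \<partial>lborel)"
    using assms(2) by (simp add: nn_integral_density nn_integral_distr nn_integral_cmult)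
  finally show ?thesis
    using assms(2) by (simp add: mult.assoc[symmetric] ennreal_mult[symmetric])
qed

definition shell :: "(real^'n) set" where
  "shell = {\<omega>. 1/2 \<le> norm \<omega> \<and> norm \<omega> \<le> 1}"

lemma shell_measurable [measurable]: "(shell :: (real^'n) set) \<in> sets borel"
  unfolding shell_def by measurable

text \<open>x/t lies in the shell exactly for t between |x| and 2|x|, and dt/t over this interval
  gives log 2, the logarithmic thickness of the shell.\<close>

lemma nn_integral_inverse_shell:
  fixes x :: "real^'n"
  assumes "x \<noteq> 0"
  shows "(\<integral>\<^sup>+t. indicator {0<..} t * ennreal (1 / t) * indicator shell ((1/t) *\<^sub>R x) \<partial>lborel) = ennreal (ln 2)"
proof -
  let ?a = "norm x"
  have a: "?a > 0" using assms by simp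
  have eq: "indicator {0<..} t * ennreal (1 / t) * indicator shell ((1/t) *\<^sub>R x) = ennreal (1 / t) * indicator {?a..2 * ?a} t" for t :: real
    using a by (auto simp: indicator_def shell_def field_simps)
  have "((\<lambda>t. 1 / t) has_integral (ln (2 * ?a) - ln ?a)) {?a..2 * ?a}"
    using a by (intro fundamental_theorem_of_calculus)
      (auto simp flip: has_real_derivative_iff_has_vector_derivative
          intro!: derivative_eq_intros dest: less_le_trans[OF a])
  from nn_integral_has_integral_lebesgue'[OF _ this] show ?thesis
    unfolding eq using a by (simp add: ln_mult)
qed

text \<open>Integration in polar coordinates without a surface measure: the directions are parametrised by
  the solid shell, which every ray meets in a set of the same logarithmic length.\<close>

lemma nn_integral_polar:
  fixes f :: "real^'n \<Rightarrow> ennreal"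
  assumes [measurable]: "f \<in> borel_measurable borel"
  shows "ennreal (ln 2) * (\<integral>\<^sup>+x. f x \<partial>lborel) =
    (\<integral>\<^sup>+\<omega>. indicator shell \<omega> * ennreal (1 / norm \<omega> ^ CARD('n)) *
       (\<integral>\<^sup>+s. indicator {0<..} s * ennreal (s ^ (CARD('n) - 1)) * f ((s / norm \<omega>) *\<^sub>R \<omega>) \<partial>lborel) \<partial>lborel)"
proof -
  let ?N = "CARD('n)"
  have N: "?N > 0" by simp
  \<comment> \<open>Substituting s = |\<omega>| t produces |\<omega>|^N, which cancels the factor in
    front; after this the radial variable no longer depends on the direction.\<close>
  have inner: "indicator shell \<omega> * ennreal (1 / norm \<omega> ^ ?N) *
       (\<integral>\<^sup>+s. indicator {0<..} s * ennreal (s ^ (?N - 1)) * f ((s / norm \<omega>) *\<^sub>R \<omega>) \<partial>lborel) =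
     (\<integral>\<^sup>+t. indicator shell \<omega> * (indicator {0<..} t * ennreal (t ^ (?N - 1)) * f (t *\<^sub>R \<omega>)) \<partial>lborel)" for \<omega> :: "real^'n"
  proof (cases "\<omega> \<in> shell")
    case True
    define c where "c = norm \<omega>"
    have "norm \<omega> \<ge> 1/2" using True by (simp add: shell_def)
    then have c: "c > 0" unfolding c_def by linarith
    have "(\<integral>\<^sup>+s. indicator {0<..} s * ennreal (s ^ (?N - 1)) * f ((s / c) *\<^sub>R \<omega>) \<partial>lborel) =
      ennreal c * (\<integral>\<^sup>+t. indicator {0<..} (0 + c * t) * ennreal ((0 + c * t) ^ (?N - 1)) * f (((0 + c * t) / c) *\<^sub>R \<omega>) \<partial>lborel)"
      using c by (subst nn_integral_real_affine[where c=c and t=0]) auto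
    also have "(\<integral>\<^sup>+t. indicator {0<..} (0 + c * t) * ennreal ((0 + c * t) ^ (?N - 1)) * f (((0 + c * t) / c) *\<^sub>R \<omega>) \<partial>lborel)
      = (\<integral>\<^sup>+t. ennreal (c ^ (?N - 1)) * (indicator {0<..} t * ennreal (t ^ (?N - 1)) * f (t *\<^sub>R \<omega>)) \<partial>lborel)"
      using c by (intro nn_integral_cong)
        (auto simp: indicator_def zero_less_mult_iff power_mult_distrib ennreal_mult mult.assoc)
    also have "\<dots> = ennreal (c ^ (?N - 1)) * (\<integral>\<^sup>+t. indicator {0<..} t * ennreal (t ^ (?N - 1)) * f (t *\<^sub>R \<omega>) \<partial>lborel)"
      by (rule nn_integral_cmult) measurable
    finally have *: "(\<integral>\<^sup>+s. indicator {0<..} s * ennreal (s ^ (?N - 1)) * f ((s / c) *\<^sub>R \<omega>) \<partial>lborel) =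
       ennreal c * (ennreal (c ^ (?N - 1)) * (\<integral>\<^sup>+t. indicator {0<..} t * ennreal (t ^ (?N - 1)) * f (t *\<^sub>R \<omega>) \<partial>lborel))" .
    have "ennreal (1 / c ^ ?N) * (\<integral>\<^sup>+s. indicator {0<..} s * ennreal (s ^ (?N - 1)) * f ((s / c) *\<^sub>R \<omega>) \<partial>lborel)
       = ennreal (1 / c ^ ?N * c * c ^ (?N - 1)) * (\<integral>\<^sup>+t. indicator {0<..} t * ennreal (t ^ (?N - 1)) * f (t *\<^sub>R \<omega>) \<partial>lborel)"
    proof -
      have "ennreal (1 / c ^ ?N * c * c ^ (?N - 1)) = ennreal (1 / c ^ ?N) * ennreal c * ennreal (c ^ (?N - 1))"
        using c by (subst ennreal_mult[symmetric] | simp)+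
      then show ?thesis using * by (simp only: mult.assoc)
    qed
    also have "1 / c ^ ?N * c * c ^ (?N - 1) = 1"
      using c by (simp add: power_minus_mult field_simps flip: power_Suc)
    finally show ?thesis using True by (simp add: c_def)
  qed simp
  have "(\<integral>\<^sup>+\<omega>. indicator shell \<omega> * ennreal (1 / norm \<omega> ^ ?N) *
       (\<integral>\<^sup>+s. indicator {0<..} s * ennreal (s ^ (?N - 1)) * f ((s / norm \<omega>) *\<^sub>R \<omega>) \<partial>lborel) \<partial>lborel)
     = (\<integral>\<^sup>+\<omega>. \<integral>\<^sup>+t. indicator shell \<omega> * (indicator {0<..} t * ennreal (t ^ (?N - 1)) * f (t *\<^sub>R \<omega>)) \<partial>lborel \<partial>lborel)"
    unfolding inner ..
  also have "\<dots> = (\<integral>\<^sup>+t. \<integral>\<^sup>+\<omega>. indicator shell \<omega> * (indicator {0<..} t * ennreal (t ^ (?N - 1)) * f (t *\<^sub>R \<omega>)) \<partial>lborel \<partial>lborel)"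
    by (rule lborel_pair.Fubini'[symmetric]) measurable
  \<comment> \<open>At fixed t > 0 the substitution x = t \<omega> turns t^(N-1) into 1/t. A second
    exchange of the integrals then leaves the value log 2 for every x other than 0.\<close>
  also have "\<dots> = (\<integral>\<^sup>+t. \<integral>\<^sup>+x. indicator {0<..} t * ennreal (1 / t) * indicator shell ((1/t) *\<^sub>R x) * f x \<partial>lborel \<partial>lborel)"
  proof (rule nn_integral_cong)
    fix t :: real
    show "(\<integral>\<^sup>+\<omega>. indicator shell \<omega> * (indicator {0<..} t * ennreal (t ^ (?N - 1)) * f (t *\<^sub>R \<omega>)) \<partial>lborel)
      = (\<integral>\<^sup>+x. indicator {0<..} t * ennreal (1 / t) * indicator shell ((1/t) *\<^sub>R x) * f x \<partial>lborel)"
    proof (cases "t > 0")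
      case True
      define h where "h x = indicator shell ((1/t) *\<^sub>R x) * f x" for x :: "real^'n"
      have [measurable]: "h \<in> borel_measurable borel" unfolding h_def by measurable
      have "(\<integral>\<^sup>+\<omega>. indicator shell \<omega> * (indicator {0<..} t * ennreal (t ^ (?N - 1)) * f (t *\<^sub>R \<omega>)) \<partial>lborel)
        = (\<integral>\<^sup>+\<omega>. ennreal (t ^ (?N - 1)) * h (t *\<^sub>R \<omega>) \<partial>lborel)"
        using True by (intro nn_integral_cong) (auto simp: h_def mult_ac)
      also have "\<dots> = ennreal (t ^ (?N - 1)) * (ennreal (1 / t ^ ?N) * (\<integral>\<^sup>+x. h x \<partial>lborel))"
        using True by (simp add: nn_integral_cmult nn_integral_scale)
      also have "\<dots> = ennreal (t ^ (?N - 1) * (1 / t ^ ?N)) * (\<integral>\<^sup>+x. h x \<partial>lborel)"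
        using True by (subst ennreal_mult) (auto simp: mult.assoc)
      also have "t ^ (?N - 1) * (1 / t ^ ?N) = 1 / t"
      proof -
        have "t ^ ?N = t ^ (?N - 1) * t" using power_minus_mult[OF N, of t] by simp
        then show ?thesis using True by simp
      qed
      finally show ?thesis
        using True by (simp add: nn_integral_cmult[symmetric] h_def mult_ac)
    qed simp
  qed
  also have "\<dots> = (\<integral>\<^sup>+x. \<integral>\<^sup>+t. indicator {0<..} t * ennreal (1 / t) * indicator shell ((1/t) *\<^sub>R x) * f x \<partial>lborel \<partial>lborel)"
    by (rule lborel_pair.Fubini') measurable
  also have "\<dots> = (\<integral>\<^sup>+x. ennreal (ln 2) * f x \<partial>lborel)"
  proof (rule nn_integral_cong_AE)
    have "AE x in lborel. x \<noteq> (0::real^'n)" by (rule AE_lborel_singleton)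
    then show "AE x in lborel. (\<integral>\<^sup>+t. indicator {0<..} t * ennreal (1 / t) * indicator shell ((1/t) *\<^sub>R x) * f x \<partial>lborel) = ennreal (ln 2) * f x"
    proof eventually_elim
      case (elim x)
      then show ?case
        by (subst nn_integral_multc) (auto simp: nn_integral_inverse_shell)
    qed
  qed
  also have "\<dots> = ennreal (ln 2) * (\<integral>\<^sup>+x. f x \<partial>lborel)"
    by (rule nn_integral_cmult) simp
  finally show ?thesis ..
qed

section \<open>Hardy inequality in one variable\<close>

text \<open>Young's inequality with conjugate exponents degenerates at p = 1, so the two regimes are
  separated by hand: if p y <= l h the first term on the right dominates, otherwise h < p y / l and
  the second one does.\<close>

lemma Young_crude:
  fixes h y p l :: real
  assumes "h > 0" "y \<ge> 0" "p \<ge> 1" "l > 0"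
  shows "p * h powr (p - 1) * y \<le> l * h powr p + p * (p / l) powr (p - 1) * y powr p"
proof (cases "p * y \<le> l * h")
  case True
  have "p * h powr (p - 1) * y = h powr (p - 1) * (p * y)" by simp
  also have "\<dots> \<le> h powr (p - 1) * (l * h)" using True by (intro mult_left_mono) auto
  also have "\<dots> = l * h powr p" using assms by (simp add: powr_diff field_simps)
  finally show ?thesis using assms by (simp add: add_increasing2)
next
  case False
  then have y: "y > 0" using assms by (cases "y = 0") auto
  have "h powr (p - 1) \<le> (p / l * y) powr (p - 1)"
    using False assms by (intro powr_mono2) (auto simp: field_simps)
  then have "p * h powr (p - 1) * y \<le> p * (p / l * y) powr (p - 1) * y"
    using assms by (intro mult_right_mono mult_left_mono) auto
  also have "\<dots> = p * (p / l) powr (p - 1) * y powr p"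
  proof -
    have "(p / l * y) powr (p - 1) = (p / l) powr (p - 1) * y powr (p - 1)"
      by (rule powr_mult)
    moreover have "y powr (p - 1) * y = y powr p" using y by (simp add: powr_diff)
    ultimately show ?thesis by (simp add: mult.assoc)
  qed
  finally show ?thesis using assms by (simp add: add_increasing)
qed

lemma tendsto_powr_at_right:
  assumes "c \<ge> 0" "p > 0"
  shows "((\<lambda>e. (c + e) powr p) \<longlongrightarrow> c powr p) (at_right (0::real))"
proof -
  have "\<forall>\<^sub>F e in at_right 0. 0 \<le> c + e"
    using assms by (intro eventually_mono[OF eventually_at_right_less]) auto
  moreover have "((\<lambda>e. c + e) \<longlongrightarrow> c) (at_right 0)"
    by (rule tendsto_eq_intros refl)+ simp
  ultimately show ?thesis using assms by (intro tendsto_powr'[OF _ tendsto_const]) auto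
qed

text \<open>A smooth substitute for the absolute value: its p-th power is differentiable also for p = 1.\<close>

definition reg :: "real \<Rightarrow> real \<Rightarrow> real" where
  "reg e x = sqrt (x\<^sup>2 + e\<^sup>2)"

lemma reg_pos: "e > 0 \<Longrightarrow> reg e x > 0"
  by (simp add: reg_def add_nonneg_pos)

lemma reg_ge: "\<bar>x\<bar> \<le> reg e x"
  by (simp add: reg_def real_le_rsqrt)

lemma reg_le: "e > 0 \<Longrightarrow> reg e x \<le> \<bar>x\<bar> + e"
  unfolding reg_def by (rule real_le_lsqrt) (auto simp: power2_sum)

text \<open>Applied with w = x^b for the Hardy inequality and with w = x - s for the bound at the
  right endpoint.\<close>

lemma weighted_ftc:
  fixes f f' w w' :: "real \<Rightarrow> real"
  assumes e: "e > 0" and st: "s \<le> t" 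
    and f: "\<And>x. x \<in> {s..t} \<Longrightarrow> (f has_real_derivative f' x) (at x)"
    and w: "\<And>x. x \<in> {s..t} \<Longrightarrow> (w has_real_derivative w' x) (at x)"
  shows "((\<lambda>x. w' x * reg e (f x) powr p + w x * (p * reg e (f x) powr (p - 1) * (f x * f' x / reg e (f x))))
     has_integral (w t * reg e (f t) powr p - w s * reg e (f s) powr p)) {s..t}"
proof (rule fundamental_theorem_of_calculus[OF st])
  fix x assume x: "x \<in> {s..t}"
  have pos: "(f x)\<^sup>2 + e\<^sup>2 > 0" using e by (simp add: add_nonneg_pos)
  have "((\<lambda>x. reg e (f x)) has_real_derivative (f x * f' x / reg e (f x))) (at x)"
    unfolding reg_def using pos
    by (auto intro!: derivative_eq_intros f[OF x] simp: divide_simps)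
  from DERIV_mult[OF w[OF x] has_real_derivative_powr[THEN DERIV_chain2, OF _ this], of p]
  have "((\<lambda>x. w x * reg e (f x) powr p) has_real_derivative
     w' x * reg e (f x) powr p + w x * (p * reg e (f x) powr (p - 1) * (f x * f' x / reg e (f x)))) (at x)"
    using reg_pos[OF e, of "f x"] by (simp add: mult_ac)
  then show "((\<lambda>x. w x * reg e (f x) powr p) has_vector_derivative
     w' x * reg e (f x) powr p + w x * (p * reg e (f x) powr (p - 1) * (f x * f' x / reg e (f x)))) (at x within {s..t})"
    by (simp add: has_real_derivative_iff_has_vector_derivative has_vector_derivative_at_within)
qed

lemma reg_deriv_bound:
  assumes "e > 0" "p \<ge> 1" "l > 0" "y \<ge> 0"
  shows "\<bar>p * reg e a powr (p - 1) * (a * d / reg e a)\<bar> * y \<le>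
     l * reg e a powr p + p * (p / l) powr (p - 1) * (y * \<bar>d\<bar>) powr p"
proof -
  have "\<bar>a * d / reg e a\<bar> \<le> \<bar>d\<bar>"
    using mult_right_mono[OF reg_ge[of a e] abs_ge_zero[of d]] reg_pos[OF assms(1), of a]
    by (simp add: abs_mult field_simps)
  then have "\<bar>p * reg e a powr (p - 1) * (a * d / reg e a)\<bar> * y \<le> p * reg e a powr (p - 1) * \<bar>d\<bar> * y"
    using assms by (subst abs_mult) (intro mult_right_mono mult_mono; simp add: abs_mult)
  also have "\<dots> \<le> l * reg e a powr p + p * (p / l) powr (p - 1) * (y * \<bar>d\<bar>) powr p"
    using Young_crude[of "reg e a" "y * \<bar>d\<bar>" p l] assms reg_pos[OF assms(1), of a] by (simp add: mult_ac)
  finally show ?thesis .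
qed

text \<open>Integrate the derivative of x^b |f|^p. Young with l = b/2 absorbs half of the term b
  x^(b-1) |f|^p and leaves p (2p/b)^(p-1) times the derivative term. The boundary term at s is kept
  on the left, so one inequality yields both a pointwise and an integral bound.\<close>

lemma Hardy_compact:
  fixes f f' :: "real \<Rightarrow> real"
  assumes "0 < s" "s \<le> t" "p \<ge> 1" "b > 0"
    and f: "\<And>x. x \<in> {s..t} \<Longrightarrow> (f has_real_derivative f' x) (at x)"
    and f': "continuous_on {s..t} f'"
  shows "s powr b * \<bar>f s\<bar> powr p + b / 2 * integral {s..t} (\<lambda>x. x powr (b - 1) * \<bar>f x\<bar> powr p)
    \<le> t powr b * \<bar>f t\<bar> powr p + p * (2 * p / b) powr (p - 1) * integral {s..t} (\<lambda>x. x powr (b + p - 1) * \<bar>f' x\<bar> powr p)"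
proof -
  define C where "C = p * (2 * p / b) powr (p - 1)"
  have cf: "continuous_on {s..t} f"
    by (intro continuous_at_imp_continuous_on ballI DERIV_isCont) (use f in auto)
  \<comment> \<open>L lies below the derivative of x^b \<open>reg e (f x)\<close>^p for every e > 0
    and does not itself depend on e, so the regularisation remains only in the boundary term at t
    and can be sent to 0 there.\<close>
  define L where "L = (\<lambda>x. b / 2 * (x powr (b - 1) * \<bar>f x\<bar> powr p) - C * (x powr (b + p - 1) * \<bar>f' x\<bar> powr p))"
  have i1: "(\<lambda>x. x powr (b - 1) * \<bar>f x\<bar> powr p) integrable_on {s..t}"
    using assms by (intro integrable_continuous_real continuous_on_mult continuous_on_powr' cf continuous_on_rabs continuous_on_id continuous_on_const) auto
  have i2: "(\<lambda>x. x powr (b + p - 1) * \<bar>f' x\<bar> powr p) integrable_on {s..t}"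
    using assms by (intro integrable_continuous_real continuous_on_mult continuous_on_powr' f' continuous_on_rabs continuous_on_id continuous_on_const) auto
  have L: "(L has_integral (b / 2 * integral {s..t} (\<lambda>x. x powr (b - 1) * \<bar>f x\<bar> powr p)
     - C * integral {s..t} (\<lambda>x. x powr (b + p - 1) * \<bar>f' x\<bar> powr p))) {s..t}"
    unfolding L_def using i1 i2 by (intro has_integral_diff has_integral_mult_right) auto
  have main: "s powr b * \<bar>f s\<bar> powr p + (b / 2 * integral {s..t} (\<lambda>x. x powr (b - 1) * \<bar>f x\<bar> powr p)
     - C * integral {s..t} (\<lambda>x. x powr (b + p - 1) * \<bar>f' x\<bar> powr p)) \<le> t powr b * (\<bar>f t\<bar> + e) powr p" if e: "e > 0" for e
  proof -
    have w: "((\<lambda>x. x powr b) has_real_derivative b * x powr (b - 1)) (at x)" if "x \<in> {s..t}" for x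
      using that assms by (intro has_real_derivative_powr) auto
    note I = weighted_ftc[OF e assms(2) f w, of p]
    have "L x \<le> b * x powr (b - 1) * reg e (f x) powr p + x powr b * (p * reg e (f x) powr (p - 1) * (f x * f' x / reg e (f x)))"
      if "x \<in> {s..t}" for x
    proof -
      have x: "x > 0" using that assms by auto
      define Z where "Z = p * reg e (f x) powr (p - 1) * (f x * f' x / reg e (f x))"
      have "\<bar>Z\<bar> * x \<le> b / 2 * reg e (f x) powr p + C * (x * \<bar>f' x\<bar>) powr p"
        unfolding Z_def C_def using reg_deriv_bound[OF e assms(3), of "b/2" x "f x" "f' x"] assms x by (simp add: mult.commute)
      then have "x powr (b - 1) * (\<bar>Z\<bar> * x) \<le> x powr (b - 1) * (b / 2 * reg e (f x) powr p + C * (x * \<bar>f' x\<bar>) powr p)"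
        by (intro mult_left_mono) auto
      moreover have "x powr (b - 1) * (\<bar>Z\<bar> * x) = x powr b * \<bar>Z\<bar>"
        using x by (simp add: powr_diff)
      moreover have "x powr (b - 1) * (x * \<bar>f' x\<bar>) powr p = x powr (b + p - 1) * \<bar>f' x\<bar> powr p"
        using x by (simp add: powr_mult powr_diff powr_add)
      moreover have "- (x powr b * \<bar>Z\<bar>) \<le> x powr b * Z"
        using mult_left_mono[of "- \<bar>Z\<bar>" Z "x powr b"] by auto
      moreover have "b / 2 * (x powr (b - 1) * \<bar>f x\<bar> powr p) \<le> b / 2 * (x powr (b - 1) * reg e (f x) powr p)"
        using assms reg_ge by (intro mult_left_mono powr_mono2) auto
      ultimately have "x powr b * \<bar>Z\<bar> \<le> b / 2 * (x powr (b - 1) * reg e (f x) powr p) + C * (x powr (b + p - 1) * \<bar>f' x\<bar> powr p)"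
          "- (x powr b * \<bar>Z\<bar>) \<le> x powr b * Z"
          "b / 2 * (x powr (b - 1) * \<bar>f x\<bar> powr p) \<le> b / 2 * (x powr (b - 1) * reg e (f x) powr p)"
        by (simp_all only: distrib_left mult.left_commute)
      then show ?thesis
        unfolding L_def Z_def[symmetric] by simp
    qed
    then have "b / 2 * integral {s..t} (\<lambda>x. x powr (b - 1) * \<bar>f x\<bar> powr p)
     - C * integral {s..t} (\<lambda>x. x powr (b + p - 1) * \<bar>f' x\<bar> powr p) \<le> t powr b * reg e (f t) powr p - s powr b * reg e (f s) powr p"
      by (intro has_integral_le[OF L I]) auto
    moreover have "s powr b * \<bar>f s\<bar> powr p \<le> s powr b * reg e (f s) powr p"
      using assms reg_ge by (intro mult_left_mono powr_mono2) auto
    moreover have "t powr b * reg e (f t) powr p \<le> t powr b * (\<bar>f t\<bar> + e) powr p"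
      using assms reg_le[OF e] less_imp_le[OF reg_pos[OF e]] by (intro mult_left_mono powr_mono2) auto
    ultimately show ?thesis by linarith
  qed
  have "((\<lambda>e. t powr b * (\<bar>f t\<bar> + e) powr p) \<longlongrightarrow> t powr b * (\<bar>f t\<bar> + 0) powr p) (at_right 0)"
    using assms tendsto_powr_at_right[of "\<bar>f t\<bar>" p] by (intro tendsto_mult tendsto_const) auto
  then have "s powr b * \<bar>f s\<bar> powr p + (b / 2 * integral {s..t} (\<lambda>x. x powr (b - 1) * \<bar>f x\<bar> powr p)
     - C * integral {s..t} (\<lambda>x. x powr (b + p - 1) * \<bar>f' x\<bar> powr p)) \<le> t powr b * (\<bar>f t\<bar> + 0) powr p"
    by (rule tendsto_lowerbound) (rule eventually_at_rightI[of 0 1], rule main, auto)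
  then show ?thesis by (simp add: C_def)
qed

text \<open>The weight x - s vanishes at s, so the value at t is the only boundary term; Young with
  l = 1 accounts for p^p.\<close>

lemma sup_compact:
  fixes f f' :: "real \<Rightarrow> real"
  assumes "s \<le> t" "p \<ge> 1"
    and f: "\<And>x. x \<in> {s..t} \<Longrightarrow> (f has_real_derivative f' x) (at x)"
    and f': "continuous_on {s..t} f'"
  shows "(t - s) * \<bar>f t\<bar> powr p \<le> (1 + (t - s)) * 2 powr p * integral {s..t} (\<lambda>x. \<bar>f x\<bar> powr p)
    + (t - s) * p powr p * integral {s..t} (\<lambda>x. \<bar>f' x\<bar> powr p)"
proof -
  have cf: "continuous_on {s..t} f"
    by (intro continuous_at_imp_continuous_on ballI DERIV_isCont) (use f in auto)
  have i1: "(\<lambda>x. \<bar>f x\<bar> powr p) integrable_on {s..t}"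
    using assms by (intro integrable_continuous_real continuous_on_powr' cf continuous_on_rabs continuous_on_const) auto
  have i2: "(\<lambda>x. \<bar>f' x\<bar> powr p) integrable_on {s..t}"
    using assms by (intro integrable_continuous_real continuous_on_powr' f' continuous_on_rabs continuous_on_const) auto
  define A where "A = (1 + (t - s)) * 2 powr p"
  define B where "B = (t - s) * p powr p"
  have A: "A \<ge> 0" using assms by (simp add: A_def)
  have main: "(t - s) * \<bar>f t\<bar> powr p \<le> A * integral {s..t} (\<lambda>x. \<bar>f x\<bar> powr p) + B * integral {s..t} (\<lambda>x. \<bar>f' x\<bar> powr p)
     + A * e powr p * (t - s)" if e: "e > 0" for e
  proof -
    have w: "((\<lambda>x. x - s) has_real_derivative 1) (at x)" if "x \<in> {s..t}" for x
      by (auto intro!: derivative_eq_intros)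
    note I = weighted_ftc[OF e assms(1) f w, of p]
    have L: "((\<lambda>x. A * (\<bar>f x\<bar> powr p) + B * (\<bar>f' x\<bar> powr p) + A * e powr p) has_integral
       (A * integral {s..t} (\<lambda>x. \<bar>f x\<bar> powr p) + B * integral {s..t} (\<lambda>x. \<bar>f' x\<bar> powr p) + (t - s) * (A * e powr p))) {s..t}"
      using i1 i2 assms has_integral_const_real[of "A * e powr p" s t]
      by (intro has_integral_add has_integral_mult_right) auto
    have "1 * reg e (f x) powr p + (x - s) * (p * reg e (f x) powr (p - 1) * (f x * f' x / reg e (f x)))
       \<le> A * (\<bar>f x\<bar> powr p) + B * (\<bar>f' x\<bar> powr p) + A * e powr p"
      if x: "x \<in> {s..t}" for x
    proof -
      define Z where "Z = p * reg e (f x) powr (p - 1) * (f x * f' x / reg e (f x))"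
      have Z: "\<bar>Z\<bar> \<le> reg e (f x) powr p + p powr p * \<bar>f' x\<bar> powr p"
        unfolding Z_def using reg_deriv_bound[OF e assms(2), of 1 1 "f x" "f' x"] assms
        by (simp add: powr_diff)
      have "(x - s) * Z \<le> (x - s) * \<bar>Z\<bar>" using x by (intro mult_left_mono) auto
      also have "\<dots> \<le> (t - s) * \<bar>Z\<bar>" using x by (intro mult_right_mono) auto
      also have "\<dots> \<le> (t - s) * (reg e (f x) powr p + p powr p * \<bar>f' x\<bar> powr p)"
        using Z assms by (intro mult_left_mono) auto
      finally have *: "reg e (f x) powr p + (x - s) * Z \<le> (1 + (t - s)) * reg e (f x) powr p + B * \<bar>f' x\<bar> powr p"
        by (simp add: B_def algebra_simps)
      have "reg e (f x) powr p \<le> (\<bar>f x\<bar> + e) powr p"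
        using assms reg_le[OF e] less_imp_le[OF reg_pos[OF e]] by (intro powr_mono2) auto
      also have "(\<bar>f x\<bar> + e) powr p \<le> (2 * max \<bar>f x\<bar> e) powr p"
        using assms e by (intro powr_mono2) auto
      also have "\<dots> \<le> 2 powr p * (\<bar>f x\<bar> powr p + e powr p)"
        using e by (auto simp: powr_mult max_def)
      finally have "(1 + (t - s)) * reg e (f x) powr p \<le> (1 + (t - s)) * (2 powr p * (\<bar>f x\<bar> powr p + e powr p))"
        using assms(1) by (intro mult_left_mono) auto
      with * show ?thesis
        by (simp add: Z_def A_def distrib_left mult.assoc)
    qed
    then have "(t - s) * reg e (f t) powr p - (s - s) * reg e (f s) powr p \<le>
       A * integral {s..t} (\<lambda>x. \<bar>f x\<bar> powr p) + B * integral {s..t} (\<lambda>x. \<bar>f' x\<bar> powr p) + (t - s) * (A * e powr p)"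
      by (intro has_integral_le[OF I L]) auto
    moreover have "(t - s) * \<bar>f t\<bar> powr p \<le> (t - s) * reg e (f t) powr p"
      using assms reg_ge by (intro mult_left_mono powr_mono2) auto
    ultimately show ?thesis by (simp add: mult_ac)
  qed
  have "((\<lambda>e. A * integral {s..t} (\<lambda>x. \<bar>f x\<bar> powr p) + B * integral {s..t} (\<lambda>x. \<bar>f' x\<bar> powr p) + A * e powr p * (t - s))
     \<longlongrightarrow> A * integral {s..t} (\<lambda>x. \<bar>f x\<bar> powr p) + B * integral {s..t} (\<lambda>x. \<bar>f' x\<bar> powr p) + A * 0 powr p * (t - s)) (at_right 0)"
    using assms tendsto_powr_at_right[of 0 p] by (intro tendsto_add tendsto_mult tendsto_const) auto
  then have "(t - s) * \<bar>f t\<bar> powr p \<le> A * integral {s..t} (\<lambda>x. \<bar>f x\<bar> powr p) + B * integral {s..t} (\<lambda>x. \<bar>f' x\<bar> powr p) + A * 0 powr p * (t - s)"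
    by (rule tendsto_lowerbound) (rule eventually_at_rightI[of 0 1], rule main, auto)
  then show ?thesis using assms by (simp add: A_def B_def)
qed

section \<open>From compact intervals to the open interval\<close>

lemma nn_integral_Icc:
  fixes g :: "real \<Rightarrow> real"
  assumes "continuous_on {s..t} g" "\<And>x. x \<in> {s..t} \<Longrightarrow> 0 \<le> g x"
  shows "(\<integral>\<^sup>+x. indicator {s..t} x * ennreal (g x) \<partial>lborel) = ennreal (integral {s..t} g)"
  using nn_integral_has_integral_lebesgue'[OF assms(2) integrable_integral[OF integrable_continuous_real[OF assms(1)]]]
  by (simp add: mult.commute)

lemma measurable_indicator_continuous:
  fixes g :: "'a::topological_space \<Rightarrow> real"
  assumes "continuous_on A g" "A \<in> sets borel"
  shows "(\<lambda>x. indicator A x * ennreal (g x)) \<in> borel_measurable borel"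
proof -
  have "(\<lambda>x. ennreal (indicator A x *\<^sub>R g x)) \<in> borel_measurable borel"
    using borel_measurable_continuous_on_indicator[OF assms(2,1)] by measurable
  then show ?thesis
    by (rule measurable_cong[THEN iffD1, rotated]) (auto simp: indicator_def)
qed

text \<open>Fatou along compact intervals exhausting the open one: pointwise the truncated
  integrands are eventually constant in n.\<close>

lemma nn_integral_exhaust:
  fixes g :: "real \<Rightarrow> ennreal"
  assumes K: "\<And>s t. 0 < s \<Longrightarrow> s < t \<Longrightarrow> t < r \<Longrightarrow> (\<integral>\<^sup>+x. indicator {s..t} x * g x \<partial>lborel) \<le> K"
    and m: "(\<lambda>x. indicator {0<..<r} x * g x) \<in> borel_measurable borel" and r: "r > 0"
  shows "(\<integral>\<^sup>+x. indicator {0<..<r} x * g x \<partial>lborel) \<le> K"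
proof -
  \<comment> \<open>The offset 3 makes r/(n+3) smaller than r/2, so that every interval is
    nondegenerate.\<close>
  define A where "A n = {r / real (n + 3) .. r - r / real (n + 3)}" for n
  have An: "0 < r / real (n + 3)" "r / real (n + 3) < r - r / real (n + 3)" "r - r / real (n + 3) < r" for n
  proof -
    have "r / real (n + 3) < r / 2" using r by (intro divide_strict_left_mono) auto
    then show "0 < r / real (n + 3)" "r / real (n + 3) < r - r / real (n + 3)" "r - r / real (n + 3) < r"
      using r by (simp, linarith, simp)
  qed
  have eq: "indicator (A n) x * g x = indicator (A n) x * (indicator {0<..<r} x * g x)" for n x
    using An[of n] by (auto simp: A_def indicator_def)
  have lim: "(\<lambda>n. r / real (n + 3)) \<longlonglongrightarrow> 0"
    by (intro tendsto_divide_0[OF tendsto_const] filterlim_at_top_imp_at_infinity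
        filterlim_compose[OF filterlim_real_sequentially] filterlim_add_const_nat_at_top)
  have ev: "eventually (\<lambda>n. indicator (A n) x * g x = indicator {0<..<r} x * g x) sequentially" for x
  proof (cases "x \<in> {0<..<r}")
    case True
    then have "eventually (\<lambda>n. r / real (n + 3) < min x (r - x)) sequentially"
      using order_tendstoD(2)[OF lim, of "min x (r - x)"] by auto
    then show ?thesis
      by eventually_elim (use True in \<open>auto simp: A_def indicator_def\<close>)
  next
    case False
    then have "x \<notin> A n" for n using An[of n] by (auto simp: A_def)
    then show ?thesis using False by auto
  qed
  have "(\<integral>\<^sup>+x. indicator {0<..<r} x * g x \<partial>lborel) = (\<integral>\<^sup>+x. liminf (\<lambda>n. indicator (A n) x * g x) \<partial>lborel)"
    by (intro nn_integral_cong lim_imp_Liminf[symmetric] tendsto_eventually ev) simp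
  also have "\<dots> \<le> liminf (\<lambda>n. \<integral>\<^sup>+x. indicator (A n) x * g x \<partial>lborel)"
    unfolding eq by (intro nn_integral_liminf borel_measurable_times) (use m in \<open>auto simp: A_def\<close>)
  also have "\<dots> \<le> liminf (\<lambda>n. K)"
    unfolding A_def by (intro Liminf_mono always_eventually allI K An)
  finally show ?thesis by (simp add: Liminf_const)
qed

lemma integral_le_enn2real:
  fixes g :: "real \<Rightarrow> real"
  assumes "continuous_on {s..t} g" "\<And>x. x \<in> {s..t} \<Longrightarrow> 0 \<le> g x" "{s..t} \<subseteq> A"
    and "(\<integral>\<^sup>+x. indicator A x * ennreal (g x) \<partial>lborel) \<le> ennreal X" "X \<ge> 0"
  shows "integral {s..t} g \<le> X"
proof -
  have eq: "(\<integral>\<^sup>+x. indicator {s..t} x * ennreal (g x) \<partial>lborel) = ennreal (integral {s..t} g)"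
    by (rule nn_integral_Icc) (use assms in auto)
  have "ennreal (integral {s..t} g) \<le> (\<integral>\<^sup>+x. indicator A x * ennreal (g x) \<partial>lborel)"
    unfolding eq[symmetric] using assms(3) by (intro nn_integral_mono) (auto simp: indicator_def)
  also note assms(4)
  finally show ?thesis using assms(5) by simp
qed

abbreviation nn_on :: "real set \<Rightarrow> (real \<Rightarrow> real) \<Rightarrow> ennreal" where
  "nn_on A g \<equiv> (\<integral>\<^sup>+x. indicator A x * ennreal (g x) \<partial>lborel)"

definition C1_on :: "real \<Rightarrow> (real \<Rightarrow> real) \<Rightarrow> (real \<Rightarrow> real) \<Rightarrow> bool" where
  "C1_on r f f' \<longleftrightarrow> (\<forall>x\<in>{0<..<r}. (f has_real_derivative f' x) (at x)) \<and> continuous_on {0<..<r} f'"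

lemma C1_on_continuous: "C1_on r f f' \<Longrightarrow> continuous_on {0<..<r} f"
  unfolding C1_on_def by (intro continuous_at_imp_continuous_on ballI DERIV_isCont) auto

lemma C1_on_ftc:
  assumes "C1_on r f f'" "0 < s" "s \<le> t" "t < r"
  shows "(f' has_integral (f t - f s)) {s..t}"
proof (rule fundamental_theorem_of_calculus[OF assms(3)])
  fix x assume "x \<in> {s..t}"
  then have "(f has_real_derivative f' x) (at x)" using assms by (auto simp: C1_on_def)
  then show "(f has_vector_derivative f' x) (at x within {s..t})"
    by (simp add: has_real_derivative_iff_has_vector_derivative has_vector_derivative_at_within)
qed

lemma C1_abs_diff_le:
  assumes f: "C1_on r f f'" and st: "0 < s" "s \<le> t" "t < r"
  shows "ennreal \<bar>f t - f s\<bar> \<le> nn_on {s..t} (\<lambda>x. \<bar>f' x\<bar>)"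
proof -
  have c: "continuous_on {s..t} (\<lambda>x. \<bar>f' x\<bar>)"
  proof (rule continuous_on_rabs)
    have "continuous_on {0<..<r} f'" using f by (simp add: C1_on_def)
    then show "continuous_on {s..t} f'" by (rule continuous_on_subset) (use st in auto)
  qed
  note i = C1_on_ftc[OF f st]
  have "norm (integral {s..t} f') \<le> integral {s..t} (\<lambda>x. \<bar>f' x\<bar>)"
    by (rule integral_norm_bound_integral[OF has_integral_integrable[OF i] integrable_continuous_real[OF c]]) simp
  then have "\<bar>f t - f s\<bar> \<le> integral {s..t} (\<lambda>x. \<bar>f' x\<bar>)" by (simp only: integral_unique[OF i] real_norm_def)
  then have "ennreal \<bar>f t - f s\<bar> \<le> ennreal (integral {s..t} (\<lambda>x. \<bar>f' x\<bar>))" by (rule ennreal_leI)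
  also have "\<dots> = nn_on {s..t} (\<lambda>x. \<bar>f' x\<bar>)"
    by (rule nn_integral_Icc[OF c, symmetric]) auto
  finally show ?thesis .
qed

text \<open>\<open>sup_compact\<close> on the interval from r/2 to t. For t >= 3r/4 its length is at
  least r/4, whence the factor 4/r; the bound is uniform up to r although f need not extend to
  r.\<close>

lemma sup_near_endpoint:
  assumes "r > 0" "p \<ge> 1"
  shows "\<exists>C>0. \<forall>f f'. C1_on r f f' \<longrightarrow> (\<forall>t\<in>{3*r/4..<r}.
    ennreal (\<bar>f t\<bar> powr p) \<le> ennreal C * (nn_on {r/2..<r} (\<lambda>x. \<bar>f x\<bar> powr p)
      + nn_on {r/2..<r} (\<lambda>x. \<bar>f' x\<bar> powr p)))"
proof -
  define C where "C = 4 / r * ((1 + r) * 2 powr p + r * p powr p)"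
  have C: "C > 0" unfolding C_def using assms by (intro mult_pos_pos add_pos_nonneg) auto
  show ?thesis
  proof (intro exI[of _ C] conjI allI impI ballI C)
    fix f f' t assume f: "C1_on r f f'" and t: "t \<in> {3*r/4..<r}"
    let ?Y = "nn_on {r/2..<r} (\<lambda>x. \<bar>f x\<bar> powr p)"
    let ?X = "nn_on {r/2..<r} (\<lambda>x. \<bar>f' x\<bar> powr p)"
    show "ennreal (\<bar>f t\<bar> powr p) \<le> ennreal C * (?Y + ?X)"
    proof (cases "?Y + ?X = \<infinity>")
      case True
      then show ?thesis unfolding True using C by (simp add: ennreal_mult_top)
    next
      case False
      then obtain x y where xy: "?X = ennreal x" "x \<ge> 0" "?Y = ennreal y" "y \<ge> 0"
        by (cases ?X; cases ?Y) auto
      have sub: "{r/2..t} \<subseteq> {0<..<r}" "{r/2..t} \<subseteq> {r/2..<r}" using assms t by auto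
      have cf: "continuous_on {r/2..t} f" "continuous_on {r/2..t} f'"
        using f C1_on_continuous[OF f] continuous_on_subset[OF _ sub(1)] by (auto simp: C1_on_def)
      have c: "continuous_on {r/2..t} (\<lambda>x. \<bar>f x\<bar> powr p)" "continuous_on {r/2..t} (\<lambda>x. \<bar>f' x\<bar> powr p)"
        using assms by (intro continuous_on_powr' continuous_on_rabs cf continuous_on_const; auto)+
      have "integral {r/2..t} (\<lambda>x. \<bar>f x\<bar> powr p) \<le> y"
        by (rule integral_le_enn2real[OF c(1) _ sub(2)]) (use xy in auto)
      moreover have "integral {r/2..t} (\<lambda>x. \<bar>f' x\<bar> powr p) \<le> x"
        by (rule integral_le_enn2real[OF c(2) _ sub(2)]) (use xy in auto)
      moreover have "(t - r/2) * \<bar>f t\<bar> powr p \<le> (1 + (t - r/2)) * 2 powr p * integral {r/2..t} (\<lambda>x. \<bar>f x\<bar> powr p)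
        + (t - r/2) * p powr p * integral {r/2..t} (\<lambda>x. \<bar>f' x\<bar> powr p)"
        using f sub t assms by (intro sup_compact cf) (auto simp: C1_on_def)
      moreover have "(1 + (t - r/2)) * 2 powr p * integral {r/2..t} (\<lambda>x. \<bar>f x\<bar> powr p) \<le> (1 + r) * 2 powr p * y"
        using assms t calculation(1) by (intro mult_mono) (auto intro!: integral_nonneg integrable_continuous_real c)
      moreover have "(t - r/2) * p powr p * integral {r/2..t} (\<lambda>x. \<bar>f' x\<bar> powr p) \<le> r * p powr p * x"
        using assms t calculation(2) by (intro mult_mono) (auto intro!: integral_nonneg integrable_continuous_real c)
      moreover have "r/4 * \<bar>f t\<bar> powr p \<le> (t - r/2) * \<bar>f t\<bar> powr p"
        using t by (intro mult_right_mono) auto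
      ultimately have "r/4 * \<bar>f t\<bar> powr p \<le> (1 + r) * 2 powr p * y + r * p powr p * x" by linarith
      also have "\<dots> \<le> ((1 + r) * 2 powr p + r * p powr p) * y + ((1 + r) * 2 powr p + r * p powr p) * x"
        using assms xy by (intro add_mono mult_right_mono) auto
      finally have "\<bar>f t\<bar> powr p \<le> C * (y + x)"
        unfolding C_def using assms by (simp add: field_simps)
      then show ?thesis using C xy by (simp add: ennreal_mult[symmetric] flip: ennreal_plus)
    qed
  qed
qed

lemma nn_integral_le_weight:
  fixes g h :: "real \<Rightarrow> real"
  assumes "\<And>x. x \<in> A \<Longrightarrow> x \<in> B \<and> 0 \<le> g x \<and> g x \<le> c * h x" "c \<ge> 0" "\<And>x. x \<in> B \<Longrightarrow> 0 \<le> h x"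
    "(\<lambda>x. indicator B x * ennreal (h x)) \<in> borel_measurable borel"
  shows "nn_on A (\<lambda>x. g x) \<le> ennreal c * nn_on B (\<lambda>x. h x)"
proof -
  have "nn_on A (\<lambda>x. g x) \<le> (\<integral>\<^sup>+x. ennreal c * (indicator B x * ennreal (h x)) \<partial>lborel)"
    by (intro nn_integral_mono)
      (use assms in \<open>auto simp: indicator_def ennreal_mult[symmetric] intro!: ennreal_leI\<close>)
  also have "\<dots> = ennreal c * nn_on B (\<lambda>x. h x)"
    using assms(4) by (intro nn_integral_cmult) auto
  finally show ?thesis .
qed

text \<open>In \<open>Hardy_compact\<close> the boundary term at the outer end t stands on the wrong
  side. Choosing t in the outer quarter makes it accessible to \<open>sup_near_endpoint\<close>,
  which replaces it by integrals over the outer half.\<close>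

lemma Hardy_open:
  assumes "r > 0" "p \<ge> 1" "b > 0"
  shows "\<exists>C>0. \<forall>f f'. C1_on r f f' \<longrightarrow>
    (\<forall>s\<in>{0<..<r}. ennreal (s powr b * \<bar>f s\<bar> powr p) \<le> ennreal C *
       (nn_on {0<..<r} (\<lambda>x. x powr (b + p - 1) * \<bar>f' x\<bar> powr p)
        + nn_on {r/2..<r} (\<lambda>x. \<bar>f x\<bar> powr p))) \<and>
    nn_on {0<..<r} (\<lambda>x. x powr (b - 1) * \<bar>f x\<bar> powr p) \<le> ennreal C *
       (nn_on {0<..<r} (\<lambda>x. x powr (b + p - 1) * \<bar>f' x\<bar> powr p)
        + nn_on {r/2..<r} (\<lambda>x. \<bar>f x\<bar> powr p))"
proof -
  obtain C1 where C1: "C1 > 0" "\<And>f f' t. C1_on r f f' \<Longrightarrow> t \<in> {3*r/4..<r} \<Longrightarrow>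
    ennreal (\<bar>f t\<bar> powr p) \<le> ennreal C1 * (nn_on {r/2..<r} (\<lambda>x. \<bar>f x\<bar> powr p)
      + nn_on {r/2..<r} (\<lambda>x. \<bar>f' x\<bar> powr p))"
    using sup_near_endpoint[OF assms(1,2)] by blast
  define C0 where "C0 = p * (2 * p / b) powr (p - 1)"
  \<comment> \<open>On the outer half the weight x^(b+p-1) is at least (r/2)^(b+p-1), so c converts
    the unweighted integral of |f'|^p there into the weighted one.\<close>
  define c where "c = 1 / (r/2) powr (b + p - 1)"
  define M where "M = r powr b * (C1 * (1 + c)) + C0"
  have c0: "c \<ge> 0" "C0 \<ge> 0" "M \<ge> 0" using assms C1 by (auto simp: c_def C0_def M_def)
  define C where "C = 1 + M + 2 / b * M"
  have C: "C > 0" "M \<le> C" "2 / b * M \<le> C" unfolding C_def using c0 assms by (auto simp: add_pos_nonneg)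
  show ?thesis
  proof (intro exI[of _ C] conjI allI impI ballI C)
    fix f f' assume f: "C1_on r f f'"
    define g where "g = (\<lambda>x. x powr (b + p - 1) * \<bar>f' x\<bar> powr p)"
    define h where "h = (\<lambda>x. x powr (b - 1) * \<bar>f x\<bar> powr p)"
    define X where "X = nn_on {0<..<r} (\<lambda>x. g x)"
    define Y where "Y = nn_on {r/2..<r} (\<lambda>x. \<bar>f x\<bar> powr p)"
    have cf: "continuous_on {0<..<r} f" "continuous_on {0<..<r} f'"
      using f C1_on_continuous[OF f] by (auto simp: C1_on_def)
    have cg: "continuous_on {0<..<r} g" "continuous_on {0<..<r} h"
      unfolding g_def h_def using assms
      by (intro continuous_on_mult continuous_on_powr' continuous_on_rabs cf continuous_on_const continuous_on_id; auto)+
    have gh: "g x \<ge> 0" "h x \<ge> 0" for x by (auto simp: g_def h_def)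
    have "(\<forall>s\<in>{0<..<r}. ennreal (s powr b * \<bar>f s\<bar> powr p) \<le> ennreal C * (X + Y)) \<and>
      (\<forall>s t. 0 < s \<longrightarrow> s < t \<longrightarrow> t < r \<longrightarrow> nn_on {s..t} (\<lambda>x. h x) \<le> ennreal C * (X + Y))"
    proof (cases "X + Y = \<infinity>")
      case True
      then show ?thesis unfolding True using C by (simp add: ennreal_mult_top)
    next
      case False
      then obtain x y where xy: "X = ennreal x" "x \<ge> 0" "Y = ennreal y" "y \<ge> 0"
        by (cases X; cases Y) auto
      have end_bd: "\<bar>f t\<bar> powr p \<le> C1 * (1 + c) * (x + y)" if t: "t \<in> {3*r/4..<r}" for t
      proof -
        have "nn_on {r/2..<r} (\<lambda>x. \<bar>f' x\<bar> powr p) \<le> ennreal c * X"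
          unfolding X_def
        proof (intro nn_integral_le_weight measurable_indicator_continuous cg)
          fix x assume x: "x \<in> {r/2..<r}"
          have "(r/2) powr (b + p - 1) \<le> x powr (b + p - 1)"
            using x assms by (intro powr_mono2) auto
          then have "1 \<le> c * x powr (b + p - 1)" unfolding c_def using assms by (simp add: field_simps)
          from mult_right_mono[OF this, of "\<bar>f' x\<bar> powr p"]
          show "x \<in> {0<..<r} \<and> 0 \<le> \<bar>f' x\<bar> powr p \<and> \<bar>f' x\<bar> powr p \<le> c * g x"
            using x assms by (auto simp: g_def mult.assoc)
        qed (use c0 gh in auto)
        then have "ennreal (\<bar>f t\<bar> powr p) \<le> ennreal C1 * (Y + ennreal c * X)"
          using C1(2)[OF f t] unfolding Y_def[symmetric]
          by (elim order_trans) (intro mult_left_mono add_left_mono; simp)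
        then have "\<bar>f t\<bar> powr p \<le> C1 * (y + c * x)"
          using xy C1 c0 by (simp add: ennreal_mult[symmetric] flip: ennreal_plus)
        also have "y + c * x \<le> (1 + c) * (x + y)"
          using xy c0 by (simp add: algebra_simps)
        finally show ?thesis using C1 by (simp add: mult.assoc)
      qed
      have main: "s powr b * \<bar>f s\<bar> powr p + b / 2 * integral {s..t} h \<le> M * (x + y)"
        if st: "0 < s" "s \<le> t" "t \<in> {3*r/4..<r}" for s t
      proof -
        have sub: "{s..t} \<subseteq> {0<..<r}" using st by auto
        have "s powr b * \<bar>f s\<bar> powr p + b / 2 * integral {s..t} h \<le> t powr b * \<bar>f t\<bar> powr p + C0 * integral {s..t} g"
          unfolding h_def g_def C0_def using f st sub assms
          by (intro Hardy_compact continuous_on_subset[OF cf(2)]) (auto simp: C1_on_def)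
        moreover have "integral {s..t} g \<le> x"
          using xy by (intro integral_le_enn2real[OF continuous_on_subset[OF cg(1) sub] _ sub]) (auto simp: gh X_def)
        then have "C0 * integral {s..t} g \<le> C0 * (x + y)" using c0 xy by (intro mult_left_mono) auto
        moreover have "t powr b * \<bar>f t\<bar> powr p \<le> r powr b * (C1 * (1 + c) * (x + y))"
          using end_bd[OF st(3)] st assms by (intro mult_mono powr_mono2) auto
        ultimately show ?thesis by (simp add: M_def algebra_simps)
      qed
      have int_nn: "integral {s..t} h \<ge> 0" if "0 < s" "t < r" for s t
        using that by (intro integral_nonneg integrable_continuous_real continuous_on_subset[OF cg(2)]) (auto simp: gh)
      show ?thesis
      proof (intro conjI ballI allI impI)
        fix s assume s: "s \<in> {0<..<r}"
        have t: "0 < s" "s \<le> max s (3*r/4)" "max s (3*r/4) \<in> {3*r/4..<r}" using s assms by auto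
        have "s powr b * \<bar>f s\<bar> powr p \<le> M * (x + y)"
          using main[OF t] int_nn[of s "max s (3*r/4)"] t s assms by (smt (verit) atLeastLessThan_iff divide_nonneg_nonneg mult_nonneg_nonneg)
        also have "\<dots> \<le> C * (x + y)" using C xy by (intro mult_right_mono) auto
        finally show "ennreal (s powr b * \<bar>f s\<bar> powr p) \<le> ennreal C * (X + Y)"
          using xy C by (simp add: ennreal_mult[symmetric] flip: ennreal_plus)
      next
        fix s t assume st: "0 < s" "s < t" "t < r"
        \<comment> \<open>The interval is enlarged until its right end reaches the outer quarter,
          where the boundary term is controlled.\<close>
        let ?t = "max t (3*r/4)"
        have t: "s \<le> ?t" "?t \<in> {3*r/4..<r}" using st assms by auto
        have "integral {s..t} h \<le> integral {s..?t} h"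
          using st t by (intro integral_subset_le integrable_continuous_real continuous_on_subset[OF cg(2)]) (auto simp: gh)
        moreover have "b / 2 * integral {s..?t} h \<le> M * (x + y)"
          using main[OF st(1) t] by (smt (verit) mult_nonneg_nonneg powr_ge_zero)
        ultimately have "integral {s..t} h \<le> 2 / b * M * (x + y)"
          using assms(3) by (simp add: field_simps) (smt (verit) mult_left_mono)
        also have "\<dots> \<le> C * (x + y)" using C xy by (intro mult_right_mono) auto
        finally have "ennreal (integral {s..t} h) \<le> ennreal C * (X + Y)"
          using xy C by (simp add: ennreal_mult[symmetric] flip: ennreal_plus)
        moreover have "nn_on {s..t} (\<lambda>x. h x) = ennreal (integral {s..t} h)"
          using st by (intro nn_integral_Icc continuous_on_subset[OF cg(2)]) (auto simp: gh)
        ultimately show "nn_on {s..t} (\<lambda>x. h x) \<le> ennreal C * (X + Y)" by simp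
      qed
    qed
    note * = this
    show "ennreal (s powr b * \<bar>f s\<bar> powr p) \<le> ennreal C *
       (nn_on {0<..<r} (\<lambda>x. x powr (b + p - 1) * \<bar>f' x\<bar> powr p)
        + nn_on {r/2..<r} (\<lambda>x. \<bar>f x\<bar> powr p))" if "s \<in> {0<..<r}" for s
      using * that by (simp add: X_def Y_def g_def)
    have "nn_on {0<..<r} (\<lambda>x. h x) \<le> ennreal C * (X + Y)"
      using * assms by (intro nn_integral_exhaust measurable_indicator_continuous cg) auto
    then show "nn_on {0<..<r} (\<lambda>x. x powr (b - 1) * \<bar>f x\<bar> powr p) \<le> ennreal C *
       (nn_on {0<..<r} (\<lambda>x. x powr (b + p - 1) * \<bar>f' x\<bar> powr p)
        + nn_on {r/2..<r} (\<lambda>x. \<bar>f x\<bar> powr p))"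
      by (simp add: X_def Y_def g_def h_def)
  qed
qed

section \<open>Iteration along a chain of derivatives\<close>

definition chain :: "nat \<Rightarrow> real \<Rightarrow> (nat \<Rightarrow> real \<Rightarrow> real) \<Rightarrow> bool" where
  "chain k r G \<longleftrightarrow> (\<forall>j<k. C1_on r (G j) (G (Suc j)))"

lemma chain_continuous: "chain k r G \<Longrightarrow> k \<ge> 1 \<Longrightarrow> j \<le> k \<Longrightarrow> continuous_on {0<..<r} (G j)"
proof (cases "j < k")
  case False
  assume "chain k r G" "k \<ge> 1" "j \<le> k"
  with False have "j = Suc (k - 1)" "k - 1 < k" by auto
  then have "C1_on r (G (k - 1)) (G j)" using \<open>chain k r G\<close> unfolding chain_def by metis
  then show ?thesis by (simp add: C1_on_def)
qed (auto simp: chain_def intro: C1_on_continuous)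

text \<open>The energy seen on a single ray, with the polar weight. N is a real number here so that
  exponents such as N - jp can be formed.\<close>

definition chain_energy :: "nat \<Rightarrow> real \<Rightarrow> real \<Rightarrow> real \<Rightarrow> (nat \<Rightarrow> real \<Rightarrow> real) \<Rightarrow> ennreal" where
  "chain_energy k p N r G = nn_on {0<..<r} (\<lambda>s. s powr (N - 1) * (\<Sum>j\<le>k. \<bar>G j s\<bar>) powr p)"

lemma chain_energy_measurable:
  assumes "chain k r G" "k \<ge> 1" "p \<ge> 1"
  shows "(\<lambda>s. indicator {0<..<r} s * ennreal (s powr (N - 1) * (\<Sum>j\<le>k. \<bar>G j s\<bar>) powr p)) \<in> borel_measurable borel"
  using assms
  by (intro measurable_indicator_continuous continuous_on_mult continuous_on_powr' continuous_on_sum continuous_on_rabs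
      chain_continuous continuous_on_id continuous_on_const) (auto simp: sum_nonneg)

lemma chain_member_le:
  fixes k :: nat
  assumes "j \<le> k" "p \<ge> 1"
  shows "\<bar>G j s\<bar> powr p \<le> (\<Sum>j\<le>k. \<bar>G j s\<bar>) powr (p::real)"
  using assms by (intro powr_mono2 member_le_sum[where f="\<lambda>j. \<bar>G j s\<bar>"]) auto

lemma chain_end_energy:
  assumes "r > 0" "p \<ge> 1" "N \<ge> 1" "k \<ge> 1"
  shows "\<exists>C\<ge>0. \<forall>G. chain k r G \<longrightarrow> (\<forall>j\<le>k.
    nn_on {r/2..<r} (\<lambda>x. \<bar>G j x\<bar> powr p) \<le> ennreal C * chain_energy k p N r G)"
proof (intro exI conjI allI impI)
  fix G j assume G: "chain k r G" and j: "j \<le> k"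
  show "nn_on {r/2..<r} (\<lambda>x. \<bar>G j x\<bar> powr p) \<le> ennreal (1 / (r/2) powr (N - 1)) * chain_energy k p N r G"
    unfolding chain_energy_def
  proof (rule nn_integral_le_weight[OF _ _ _ chain_energy_measurable[OF G assms(4,2)]])
    fix x assume x: "x \<in> {r/2..<r}"
    have "(r/2) powr (N - 1) \<le> x powr (N - 1)" using x assms by (intro powr_mono2) auto
    then have "1 \<le> 1 / (r/2) powr (N - 1) * x powr (N - 1)" using assms by (simp add: field_simps)
    then have "1 * \<bar>G j x\<bar> powr p \<le> (1 / (r/2) powr (N - 1) * x powr (N - 1)) * (\<Sum>j\<le>k. \<bar>G j x\<bar>) powr p"
      by (rule mult_mono[OF _ chain_member_le[OF j assms(2)]]) simp_all
    then show "x \<in> {0<..<r} \<and> 0 \<le> \<bar>G j x\<bar> powr p \<and> \<bar>G j x\<bar> powr p \<le> 1 / (r/2) powr (N - 1) * (x powr (N - 1) * (\<Sum>j\<le>k. \<bar>G j x\<bar>) powr p)"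
      using x assms by (auto simp: mult.assoc)
  qed auto
qed auto

text \<open>Each use of Hardy trades one derivative for p powers of s in the weight. The hypothesis
  N > jp keeps the exponent b = N - jp positive up to the last use, and the outer remainder is
  always paid by \<open>chain_end_energy\<close>.\<close>

lemma chain_Hardy_iterate:
  assumes "r > 0" "p \<ge> 1" "N \<ge> 1" "k \<ge> 1" "j \<le> k" "N > real j * p"
  shows "\<exists>C\<ge>0. \<forall>G. chain k r G \<longrightarrow>
    nn_on {0<..<r} (\<lambda>x. x powr (N - real j * p - 1) * \<bar>G (k - j) x\<bar> powr p)
      \<le> ennreal C * chain_energy k p N r G"
  using assms(5,6)
proof (induction j)
  case 0
  show ?case
  proof (intro exI[of _ 1] conjI allI impI)
    fix G assume G: "chain k r G"
    show "nn_on {0<..<r} (\<lambda>x. x powr (N - real 0 * p - 1) * \<bar>G (k - 0) x\<bar> powr p)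
      \<le> ennreal 1 * chain_energy k p N r G"
      unfolding chain_energy_def
    proof (rule nn_integral_le_weight[OF _ _ _ chain_energy_measurable[OF G assms(4,2)]])
      fix x assume "x \<in> {0<..<r}"
      moreover have "x powr (N - 1) * \<bar>G k x\<bar> powr p \<le> x powr (N - 1) * (\<Sum>j\<le>k. \<bar>G j x\<bar>) powr p"
        by (rule mult_left_mono[OF chain_member_le[OF order_refl assms(2)]]) simp
      ultimately show "x \<in> {0<..<r} \<and> 0 \<le> x powr (N - real 0 * p - 1) * \<bar>G (k - 0) x\<bar> powr p \<and>
          x powr (N - real 0 * p - 1) * \<bar>G (k - 0) x\<bar> powr p \<le> 1 * (x powr (N - 1) * (\<Sum>j\<le>k. \<bar>G j x\<bar>) powr p)"
        by simp
    qed simp_all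
  qed auto
next
  case (Suc j)
  have "N > real j * p" using Suc.prems assms(2) by (simp add: algebra_simps)
  then obtain C where C: "C \<ge> 0" "\<And>G. chain k r G \<Longrightarrow>
    nn_on {0<..<r} (\<lambda>x. x powr (N - real j * p - 1) * \<bar>G (k - j) x\<bar> powr p)
      \<le> ennreal C * chain_energy k p N r G"
    using Suc by auto
  obtain D where D: "D \<ge> 0" "\<And>G j. chain k r G \<Longrightarrow> j \<le> k \<Longrightarrow>
    nn_on {r/2..<r} (\<lambda>x. \<bar>G j x\<bar> powr p) \<le> ennreal D * chain_energy k p N r G"
    using chain_end_energy[OF assms(1-4)] by blast
  define b where "b = N - real (Suc j) * p"
  have b: "b > 0" using Suc.prems by (simp add: b_def)
  obtain A where A: "A > 0" "\<And>f f'. C1_on r f f' \<Longrightarrow>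
      nn_on {0<..<r} (\<lambda>x. x powr (b - 1) * \<bar>f x\<bar> powr p) \<le> ennreal A *
       (nn_on {0<..<r} (\<lambda>x. x powr (b + p - 1) * \<bar>f' x\<bar> powr p)
        + nn_on {r/2..<r} (\<lambda>x. \<bar>f x\<bar> powr p))"
    using Hardy_open[OF assms(1,2) b] by blast
  show ?case
  proof (intro exI[of _ "A * (C + D)"] conjI allI impI)
    show "A * (C + D) \<ge> 0" using A C D by simp
    fix G assume G: "chain k r G"
    have c1: "C1_on r (G (k - Suc j)) (G (k - j))"
    proof -
      have "k - Suc j < k" "Suc (k - Suc j) = k - j" using Suc.prems by auto
      then show ?thesis using G unfolding chain_def by metis
    qed
    have bp: "b + p - 1 = N - real j * p - 1" by (simp add: b_def algebra_simps)
    have "nn_on {0<..<r} (\<lambda>x. x powr (b - 1) * \<bar>G (k - Suc j) x\<bar> powr p)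
      \<le> ennreal A * (ennreal C * chain_energy k p N r G + ennreal D * chain_energy k p N r G)"
      using C(2)[OF G] D(2)[OF G, of "k - Suc j"]
      by (intro order_trans[OF A(2)[OF c1]] mult_left_mono add_mono) (auto simp: bp)
    also have "\<dots> = ennreal (A * (C + D)) * chain_energy k p N r G"
      using A C D by (simp add: ennreal_mult distrib_left distrib_right mult.assoc)
    finally show "nn_on {0<..<r} (\<lambda>x. x powr (N - real (Suc j) * p - 1) * \<bar>G (k - Suc j) x\<bar> powr p)
      \<le> ennreal (A * (C + D)) * chain_energy k p N r G" by (simp add: b_def)
  qed
qed

text \<open>k - 1 iterated steps reach the first derivative; the last step is taken separately, with
  any positive b >= N - kp. The choice b = N - kp is sharp when this is positive, and for N = kp an
  arbitrarily small b is still allowed.\<close>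

lemma chain_pointwise:
  assumes "r > 0" "p \<ge> 1" "N \<ge> 1" "k \<ge> 1" "N > real (k - 1) * p" "b > 0" "b \<ge> N - real k * p"
  shows "\<exists>C>0. \<forall>G. chain k r G \<longrightarrow>
    (\<forall>s\<in>{0<..<r}. ennreal (s powr b * \<bar>G 0 s\<bar> powr p) \<le> ennreal C * chain_energy k p N r G) \<and>
    nn_on {0<..<r} (\<lambda>x. x powr (b - 1) * \<bar>G 0 x\<bar> powr p) \<le> ennreal C * chain_energy k p N r G"
proof -
  obtain C where C: "C \<ge> 0" "\<And>G. chain k r G \<Longrightarrow>
    nn_on {0<..<r} (\<lambda>x. x powr (N - real (k - 1) * p - 1) * \<bar>G (k - (k - 1)) x\<bar> powr p)
      \<le> ennreal C * chain_energy k p N r G"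
    using chain_Hardy_iterate[OF assms(1-4) _ assms(5)] assms(4) by auto
  obtain D where D: "D \<ge> 0" "\<And>G j. chain k r G \<Longrightarrow> j \<le> k \<Longrightarrow>
    nn_on {r/2..<r} (\<lambda>x. \<bar>G j x\<bar> powr p) \<le> ennreal D * chain_energy k p N r G"
    using chain_end_energy[OF assms(1-4)] by blast
  obtain A where A: "A > 0" "\<And>f f'. C1_on r f f' \<Longrightarrow>
      (\<forall>s\<in>{0<..<r}. ennreal (s powr b * \<bar>f s\<bar> powr p) \<le> ennreal A *
       (nn_on {0<..<r} (\<lambda>x. x powr (b + p - 1) * \<bar>f' x\<bar> powr p)
        + nn_on {r/2..<r} (\<lambda>x. \<bar>f x\<bar> powr p))) \<and>
      nn_on {0<..<r} (\<lambda>x. x powr (b - 1) * \<bar>f x\<bar> powr p) \<le> ennreal A *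
       (nn_on {0<..<r} (\<lambda>x. x powr (b + p - 1) * \<bar>f' x\<bar> powr p)
        + nn_on {r/2..<r} (\<lambda>x. \<bar>f x\<bar> powr p))"
    using Hardy_open[OF assms(1,2,6)] by blast
  \<comment> \<open>The excess of b over N - kp; since d >= 0, the factor x^d that it adds to the
    weight is at most r^d.\<close>
  define d where "d = b - (N - real k * p)"
  define E where "E = A * (r powr d * C + D) + 1"
  have E: "E > 0" "A * (r powr d * C + D) \<le> E" using A C D by (auto simp: E_def add_nonneg_pos)
  show ?thesis
  proof (intro exI[of _ E] conjI allI impI E)
    fix G assume G: "chain k r G"
    have c1: "C1_on r (G 0) (G 1)" using G assms(4) by (auto simp: chain_def)
    have cG: "continuous_on {0<..<r} (G 1)" by (rule chain_continuous[OF G assms(4,4)])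
    have kk: "k - (k - 1) = 1" using assms(4) by simp
    have "nn_on {0<..<r} (\<lambda>x. x powr (b + p - 1) * \<bar>G 1 x\<bar> powr p) \<le>
       ennreal (r powr d) * nn_on {0<..<r} (\<lambda>x. x powr (N - real (k - 1) * p - 1) * \<bar>G 1 x\<bar> powr p)"
    proof (rule nn_integral_le_weight)
      show "(\<lambda>x. indicator {0<..<r} x * ennreal (x powr (N - real (k - 1) * p - 1) * \<bar>G 1 x\<bar> powr p)) \<in> borel_measurable borel"
        using assms cG by (intro measurable_indicator_continuous continuous_on_mult continuous_on_powr' continuous_on_rabs
           continuous_on_id continuous_on_const) auto
      fix x assume x: "x \<in> {0<..<r}"
      have "b + p - 1 = d + (N - real (k - 1) * p - 1)"
        using assms(4) by (simp add: d_def of_nat_diff algebra_simps)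
      then have "x powr (b + p - 1) = x powr d * x powr (N - real (k - 1) * p - 1)"
        by (simp only: powr_add)
      also have "\<dots> \<le> r powr d * x powr (N - real (k - 1) * p - 1)"
        using x assms by (intro mult_right_mono powr_mono2) (auto simp: d_def)
      finally show "x \<in> {0<..<r} \<and> 0 \<le> x powr (b + p - 1) * \<bar>G 1 x\<bar> powr p \<and> x powr (b + p - 1) * \<bar>G 1 x\<bar> powr p \<le>
         r powr d * (x powr (N - real (k - 1) * p - 1) * \<bar>G 1 x\<bar> powr p)"
        using x by (auto simp: mult.assoc[symmetric] intro!: mult_right_mono)
    qed auto
    also have "\<dots> \<le> ennreal (r powr d) * (ennreal C * chain_energy k p N r G)"
      using C(2)[OF G] unfolding kk by (intro mult_left_mono) auto
    finally have X: "ennreal A * (nn_on {0<..<r} (\<lambda>x. x powr (b + p - 1) * \<bar>G 1 x\<bar> powr p)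
        + nn_on {r/2..<r} (\<lambda>x. \<bar>G 0 x\<bar> powr p))
        \<le> ennreal A * (ennreal (r powr d) * (ennreal C * chain_energy k p N r G) + ennreal D * chain_energy k p N r G)"
      using D(2)[OF G, of 0] by (intro mult_left_mono add_mono) auto
    also have "\<dots> = ennreal (A * (r powr d * C + D)) * chain_energy k p N r G"
      using A C D by (simp add: ennreal_mult distrib_left distrib_right mult.assoc)
    also have "\<dots> \<le> ennreal E * chain_energy k p N r G"
      using E by (intro mult_right_mono) (auto intro: ennreal_leI)
    finally have X: "ennreal A * (nn_on {0<..<r} (\<lambda>x. x powr (b + p - 1) * \<bar>G 1 x\<bar> powr p)
        + nn_on {r/2..<r} (\<lambda>x. \<bar>G 0 x\<bar> powr p)) \<le> ennreal E * chain_energy k p N r G" .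
    show "\<forall>s\<in>{0<..<r}. ennreal (s powr b * \<bar>G 0 s\<bar> powr p) \<le> ennreal E * chain_energy k p N r G"
      using A(2)[OF c1] X order_trans by blast
    show "nn_on {0<..<r} (\<lambda>x. x powr (b - 1) * \<bar>G 0 x\<bar> powr p) \<le> ennreal E * chain_energy k p N r G"
      using A(2)[OF c1] X order_trans by blast
  qed
qed

lemma ennreal_combine:
  assumes "a \<ge> 0" "b \<ge> 0" "c \<ge> 0" "d \<ge> 0"
  shows "ennreal a * (ennreal b * X + ennreal c * X) + ennreal d * X = ennreal (a * (b + c) + d) * X"
  using assms by (simp add: ennreal_mult distrib_left distrib_right mult.assoc)

text \<open>For N = k and p = 1 the weight exponent after k - 1 Hardy steps is 0, so the first
  derivative is integrable up to the origin. The fundamental theorem then compares G 0 at s with its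
  value in the outer quarter.\<close>

lemma chain_sup_bound:
  assumes "r > 0" "k \<ge> 1"
  shows "\<exists>C>0. \<forall>G. chain k r G \<longrightarrow> (\<forall>s\<in>{0<..<r}. ennreal \<bar>G 0 s\<bar> \<le> ennreal C * chain_energy k 1 (real k) r G)"
proof -
  have N: "real k \<ge> 1" "real (k - 1) * 1 < real k" using assms(2) by auto
  obtain C where C: "C \<ge> 0" "\<And>G. chain k r G \<Longrightarrow>
    nn_on {0<..<r} (\<lambda>x. x powr (real k - real (k - 1) * 1 - 1) * \<bar>G (k - (k - 1)) x\<bar> powr 1)
      \<le> ennreal C * chain_energy k 1 (real k) r G"
    using chain_Hardy_iterate[OF assms(1) order_refl N(1) assms(2) _ N(2)] assms(2) by auto
  obtain D where D: "D \<ge> 0" "\<And>G j. chain k r G \<Longrightarrow> j \<le> k \<Longrightarrow>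
    nn_on {r/2..<r} (\<lambda>x. \<bar>G j x\<bar> powr 1) \<le> ennreal D * chain_energy k 1 (real k) r G"
    using chain_end_energy[OF assms(1) order_refl N(1) assms(2)] by blast
  obtain A where A: "A > 0" "\<And>f f' t. C1_on r f f' \<Longrightarrow> t \<in> {3*r/4..<r} \<Longrightarrow>
    ennreal (\<bar>f t\<bar> powr 1) \<le> ennreal A * (nn_on {r/2..<r} (\<lambda>x. \<bar>f x\<bar> powr 1)
      + nn_on {r/2..<r} (\<lambda>x. \<bar>f' x\<bar> powr 1))"
    using sup_near_endpoint[OF assms(1) order_refl] by blast
  define E where "E = A * (D + D) + C + 1"
  show ?thesis
  proof (intro exI[of _ E] conjI allI impI ballI)
    show "E > 0" using A C D by (simp add: E_def add_nonneg_pos)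
    fix G s assume G: "chain k r G" and s: "s \<in> {0<..<r}"
    let ?En = "chain_energy k 1 (real k) r G"
    define t where "t = max s (3*r/4)"
    have t: "s \<le> t" "t \<in> {3*r/4..<r}" using s assms by (auto simp: t_def)
    have c1: "C1_on r (G 0) (G 1)" using G assms(2) by (auto simp: chain_def)
    have kk: "k - (k - 1) = 1" "real k - real (k - 1) * 1 - 1 = 0" using assms(2) by (auto simp: of_nat_diff)
    have sub: "{s..t} \<subseteq> {0<..<r}" using s t by auto
    have "\<bar>G 0 s\<bar> \<le> \<bar>G 0 t\<bar> + \<bar>G 0 t - G 0 s\<bar>" by linarith
    then have "ennreal \<bar>G 0 s\<bar> \<le> ennreal (\<bar>G 0 t\<bar> + \<bar>G 0 t - G 0 s\<bar>)" by (rule ennreal_leI)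
    also have "\<dots> = ennreal \<bar>G 0 t\<bar> + ennreal \<bar>G 0 t - G 0 s\<bar>" by (rule ennreal_plus) simp_all
    also have "ennreal \<bar>G 0 t - G 0 s\<bar> \<le> nn_on {s..t} (\<lambda>x. \<bar>G 1 x\<bar>)"
      by (rule C1_abs_diff_le[OF c1]) (use s t in auto)
    also have "\<dots> \<le> nn_on {0<..<r} (\<lambda>x. x powr (real k - real (k - 1) * 1 - 1) * \<bar>G (k - (k - 1)) x\<bar> powr 1)"
      unfolding kk using sub by (intro nn_integral_mono) (auto simp: indicator_def)
    also have "\<dots> \<le> ennreal C * ?En" by (rule C(2)[OF G])
    also have "ennreal \<bar>G 0 t\<bar> \<le> ennreal A * (ennreal D * ?En + ennreal D * ?En)"
    proof -
      have "ennreal \<bar>G 0 t\<bar> = ennreal (\<bar>G 0 t\<bar> powr 1)" by simp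
      also note A(2)[OF c1 t(2)]
      also have "ennreal A * (nn_on {r/2..<r} (\<lambda>x. \<bar>G 0 x\<bar> powr 1)
        + nn_on {r/2..<r} (\<lambda>x. \<bar>G 1 x\<bar> powr 1)) \<le> ennreal A * (ennreal D * ?En + ennreal D * ?En)"
        by (rule mult_left_mono[OF add_mono[OF D(2)[OF G le0] D(2)[OF G assms(2)]]]) simp
      finally show ?thesis .
    qed
    also have "ennreal A * (ennreal D * ?En + ennreal D * ?En) + ennreal C * ?En = ennreal (A * (D + D) + C) * ?En"
      by (rule ennreal_combine) (use A(1) C(1) D(1) in simp_all)
    also have "\<dots> \<le> ennreal E * ?En"
      by (intro mult_right_mono ennreal_leI) (auto simp: E_def)
    finally show "ennreal \<bar>G 0 s\<bar> \<le> ennreal E * ?En" by (simp add: add_right_mono)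
  qed
qed

section \<open>Limits of fast Cauchy sequences\<close>

lemma indefinite_integral_right_derivative:
  fixes h :: "real \<Rightarrow> real"
  assumes "\<And>a b. h integrable_on {a..b}"
  obtains Z where "negligible Z" "\<And>x e. x \<notin> Z \<Longrightarrow> 0 < e \<Longrightarrow>
     \<exists>d>0. \<forall>y. 0 < y \<and> y < d \<longrightarrow> \<bar>integral {x..x + y} h / y - h x\<bar> < e"
proof -
  from integrable_ccontinuous_explicit[of h] assms obtain Z where Z: "negligible Z" "\<And>x e. \<lbrakk>x \<notin> Z; 0 < e\<rbrakk> \<Longrightarrow>
               \<exists>d>0. \<forall>y. 0 < y \<and> y < d \<longrightarrow>
                         norm(integral (cbox x (x + y *\<^sub>R One)) h /\<^sub>R y ^ DIM(real) - h x) < e"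
    by auto
  show ?thesis
  proof (rule that[OF Z(1)])
    fix x e :: real assume "x \<notin> Z" "0 < e"
    from Z(2)[OF this] show "\<exists>d>0. \<forall>y. 0 < y \<and> y < d \<longrightarrow> \<bar>integral {x..x + y} h / y - h x\<bar> < e"
      by (simp add: divide_inverse mult.commute)
  qed
qed

text \<open>The differentiation theorem supplies right difference quotients only. Left ones are
  right ones of the reflected function, at the cost of a second null set that is reflected
  back.\<close>

lemma indefinite_integral_AE_derivative:
  fixes F h :: "real \<Rightarrow> real"
  assumes h: "h integrable_on {a..b}" and F: "\<And>s t. a \<le> s \<Longrightarrow> s \<le> t \<Longrightarrow> t < b \<Longrightarrow> F t - F s = integral {s..t} h"
  shows "\<exists>Z. negligible Z \<and> (\<forall>x\<in>{a<..<b} - Z. F differentiable (at x))"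
proof -
  \<comment> \<open>Extension by 0 makes the integrand integrable on every interval, as the
    differentiation theorem and the reflection require.\<close>
  define g where "g x = (if x \<in> {a..b} then h x else 0)" for x
  have gU: "g integrable_on UNIV" unfolding g_def using h by (simp only: integrable_restrict_UNIV)
  then have g: "g integrable_on {c..d}" for c d by (rule integrable_on_subinterval) auto
  have g': "(\<lambda>x. g (- x)) integrable_on {c..d}" for c d
    using Henstock_Kurzweil_Integration.integrable_reflect_real[where f=g and a="-d" and b="-c"] g[of "-d" "-c"] by simp
  obtain Z where Z: "negligible Z" "\<And>x e. x \<notin> Z \<Longrightarrow> 0 < e \<Longrightarrow>
     \<exists>d>0. \<forall>y. 0 < y \<and> y < d \<longrightarrow> \<bar>integral {x..x + y} g / y - g x\<bar> < e"
    using indefinite_integral_right_derivative[of g] g by metis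
  obtain Z' where Z': "negligible Z'" "\<And>x e. x \<notin> Z' \<Longrightarrow> 0 < e \<Longrightarrow>
     \<exists>d>0. \<forall>y. 0 < y \<and> y < d \<longrightarrow> \<bar>integral {x..x + y} (\<lambda>x. g (- x)) / y - g (- x)\<bar> < e"
    using indefinite_integral_right_derivative[of "\<lambda>x. g (- x)"] g' by metis
  have Fg: "F t - F s = integral {s..t} g" if "a < s" "s \<le> t" "t < b" for s t
    using F[of s t] that integral_cong[of "{s..t}" h g] by (auto simp: g_def)
  show ?thesis
  proof (intro exI[of _ "Z \<union> uminus ` Z'"] conjI ballI)
    show "negligible (Z \<union> uminus ` Z')"
      using Z(1) negligible_differentiable_image_negligible[OF _ Z'(1), of uminus]
      by (simp add: negligible_Un differentiable_on_def)
    fix x assume x: "x \<in> {a<..<b} - (Z \<union> uminus ` Z')"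
    then have x1: "x \<notin> Z" and x2: "- x \<notin> Z'" and ab: "a < x" "x < b" by (auto simp: image_iff)
    have "(F has_real_derivative g x) (at x)"
      unfolding DERIV_def LIM_def
    proof (intro allI impI)
      fix e :: real assume e: "e > 0"
      obtain d1 where d1: "d1 > 0" "\<And>y. 0 < y \<Longrightarrow> y < d1 \<Longrightarrow> \<bar>integral {x..x + y} g / y - g x\<bar> < e"
        using Z(2)[OF x1 e] by blast
      obtain d2 where d2: "d2 > 0" "\<And>y. 0 < y \<Longrightarrow> y < d2 \<Longrightarrow> \<bar>integral {-x..-x + y} (\<lambda>x. g (- x)) / y - g x\<bar> < e"
        using Z'(2)[OF x2 e] by auto
      show "\<exists>s>0. \<forall>y. y \<noteq> 0 \<and> dist y 0 < s \<longrightarrow> dist ((F (x + y) - F x) / y) (g x) < e"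
      proof (intro exI[of _ "min (min d1 d2) (min (x - a) (b - x))"] conjI allI impI)
        fix y :: real assume y: "y \<noteq> 0 \<and> dist y 0 < min (min d1 d2) (min (x - a) (b - x))"
        show "dist ((F (x + y) - F x) / y) (g x) < e"
        proof (cases "y > 0")
          case True
          then have "F (x + y) - F x = integral {x..x + y} g" using y ab by (intro Fg) (auto simp: dist_real_def)
          then show ?thesis using d1(2)[of y] True y by (simp add: dist_real_def)
        next
          case False
          then have n: "y < 0" using y by auto
          then have "F x - F (x + y) = integral {x + y..x} g" using y ab by (intro Fg) (auto simp: dist_real_def)
          also have "\<dots> = integral {-x..-x + (-y)} (\<lambda>x. g (- x))"
            using Henstock_Kurzweil_Integration.integral_reflect_real[where f=g and a="x + y" and b=x] by (simp add: algebra_simps)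
          finally have "(F (x + y) - F x) / y = integral {-x..-x + (-y)} (\<lambda>x. g (- x)) / (- y)"
            using n by (simp add: field_simps)
          then show ?thesis using d2(2)[of "-y"] n y by (simp add: dist_real_def)
        qed
      qed (use d1 d2 ab in auto)
    qed
    then show "F differentiable (at x)" by (auto simp: real_differentiable_def)
  qed
qed

text \<open>|f 0| plus the series of the |f (n+1) - f n| has finite integral; it is therefore finite
  almost everywhere, forces pointwise convergence there and dominates every f n. \<open>lim\<close>
  takes an unspecified value on the exceptional null set, which the integrals do not see.\<close>

lemma L1_limit:
  fixes f :: "nat \<Rightarrow> real \<Rightarrow> real"
  assumes ab: "a < b" and m: "\<And>n. continuous_on {a..<b} (f n)"
    and f0: "nn_on {a..<b} (\<lambda>x. \<bar>f 0 x\<bar>) < \<infinity>"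
    and c: "\<And>n. nn_on {a..<b} (\<lambda>x. \<bar>f (Suc n) x - f n x\<bar>) \<le> ennreal (c n)"
    and cs: "summable c" "\<And>n. c n \<ge> 0"
  shows "AE x in lborel. x \<in> {a..<b} \<longrightarrow> convergent (\<lambda>n. f n x)"
    and "(\<lambda>x. lim (\<lambda>n. f n x)) integrable_on {a..b}"
    and "\<And>s t. a \<le> s \<Longrightarrow> s \<le> t \<Longrightarrow> t < b \<Longrightarrow> (\<lambda>n. integral {s..t} (f n)) \<longlonglongrightarrow> integral {s..t} (\<lambda>x. lim (\<lambda>n. f n x))"
proof -
  let ?I = "\<lambda>x. indicator {a..<b} x :: real"
  have meas [measurable]: "(\<lambda>x. ?I x * f n x) \<in> borel_measurable borel" for n
    using borel_measurable_continuous_on_indicator[OF _ m[of n]] by simp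
  define D where "D n x = ?I x * (f (Suc n) x - f n x)" for n x
  have Dm [measurable]: "D n \<in> borel_measurable borel" for n
    unfolding D_def right_diff_distrib by (intro borel_measurable_diff meas)
  have normI: "ennreal (norm (?I x * y)) = indicator {a..<b} x * ennreal \<bar>y\<bar>" for x y
    by (simp add: indicator_def)
  define w where "w x = ennreal \<bar>?I x * f 0 x\<bar> + (\<Sum>n. ennreal \<bar>D n x\<bar>)" for x
  have wm [measurable]: "w \<in> borel_measurable borel" unfolding w_def by measurable
  have Df: "(\<integral>\<^sup>+x. ennreal \<bar>D n x\<bar> \<partial>lborel) \<le> ennreal (c n)" for n
    unfolding D_def using c[of n] normI by simp
  have "(\<integral>\<^sup>+x. w x \<partial>lborel) = (\<integral>\<^sup>+x. ennreal \<bar>?I x * f 0 x\<bar> \<partial>lborel) + (\<Sum>n. \<integral>\<^sup>+x. ennreal \<bar>D n x\<bar> \<partial>lborel)"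
    unfolding w_def by (subst nn_integral_add) (auto simp: nn_integral_suminf)
  also have "\<dots> \<le> (\<integral>\<^sup>+x. ennreal \<bar>?I x * f 0 x\<bar> \<partial>lborel) + (\<Sum>n. ennreal (c n))"
    by (intro add_left_mono suminf_le Df) auto
  also have "\<dots> < \<infinity>"
    using f0 normI cs by (simp add: suminf_ennreal2)
  finally have wfin: "(\<integral>\<^sup>+x. w x \<partial>lborel) < \<infinity>" .
  then have wAE: "AE x in lborel. w x \<noteq> \<infinity>" by (intro nn_integral_noteq_infinite) auto
  define g where "g x = enn2real (w x)" for x
  have fw: "convergent (\<lambda>n. ?I x * f n x) \<and> (\<forall>n. \<bar>?I x * f n x\<bar> \<le> g x)" if "w x \<noteq> \<infinity>" for x
  proof -
    have s: "(\<Sum>n. ennreal \<bar>D n x\<bar>) \<noteq> \<infinity>" using that by (auto simp: w_def)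
    then have sm: "summable (\<lambda>n. \<bar>D n x\<bar>)" by (intro summable_suminf_not_top) auto
    have tel: "?I x * f n x = ?I x * f 0 x + (\<Sum>i<n. D i x)" for n
      by (induction n) (auto simp: D_def algebra_simps)
    have "(\<lambda>n. ?I x * f 0 x + (\<Sum>i<n. D i x)) \<longlonglongrightarrow> ?I x * f 0 x + (\<Sum>i. D i x)"
      by (rule tendsto_add[OF tendsto_const summable_LIMSEQ[OF summable_rabs_cancel[OF sm]]])
    moreover have "(\<lambda>n. ?I x * f n x) = (\<lambda>n. ?I x * f 0 x + (\<Sum>i<n. D i x))" by (rule ext, rule tel)
    ultimately have "convergent (\<lambda>n. ?I x * f n x)" unfolding convergent_def by auto
    moreover have "\<bar>?I x * f n x\<bar> \<le> g x" for n
    proof -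
      have "\<bar>?I x * f n x\<bar> \<le> \<bar>?I x * f 0 x\<bar> + (\<Sum>i<n. \<bar>D i x\<bar>)"
        by (subst tel[of n]) (intro order_trans[OF abs_triangle_ineq] add_left_mono sum_abs)
      also have "(\<Sum>i<n. \<bar>D i x\<bar>) \<le> (\<Sum>i. \<bar>D i x\<bar>)" by (intro sum_le_suminf sm) auto
      also have "\<bar>?I x * f 0 x\<bar> + (\<Sum>i. \<bar>D i x\<bar>) = g x"
        unfolding g_def w_def using sm by (simp add: suminf_ennreal2 suminf_nonneg flip: ennreal_plus)
      finally show ?thesis by simp
    qed
    ultimately show ?thesis by blast
  qed
  show conv: "AE x in lborel. x \<in> {a..<b} \<longrightarrow> convergent (\<lambda>n. f n x)"
    using wAE
  proof eventually_elim
    case (elim x)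
    then show ?case using fw[of x] by auto
  qed
  have gm [measurable]: "g \<in> borel_measurable borel" unfolding g_def by measurable
  have gi: "integrable lborel g"
  proof (rule integrableI_nonneg)
    have "(\<integral>\<^sup>+x. ennreal (g x) \<partial>lborel) \<le> (\<integral>\<^sup>+x. w x \<partial>lborel)"
      unfolding g_def by (intro nn_integral_mono) (simp add: ennreal_enn2real_if)
    then show "(\<integral>\<^sup>+x. ennreal (g x) \<partial>lborel) < \<infinity>" using wfin by (rule order_le_less_trans)
  qed (auto simp: g_def)
  define H where "H x = lim (\<lambda>n. ?I x * f n x)" for x
  have Hm [measurable]: "H \<in> borel_measurable borel" unfolding H_def by measurable
  have limH: "AE x in lborel. (\<lambda>n. ?I x * f n x) \<longlonglongrightarrow> H x"
    using wAE
  proof eventually_elim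
    case (elim x)
    then show ?case using fw[of x] by (simp add: H_def convergent_LIMSEQ_iff)
  qed
  have bd: "AE x in lborel. norm (?I x * f n x) \<le> g x" for n
    using wAE
  proof eventually_elim
    case (elim x)
    then show ?case using fw[of x] by simp
  qed
  have Hi: "integrable lborel H"
    by (rule integrable_dominated_convergence[OF _ _ gi limH bd]) auto
  have HI: "H x = ?I x * lim (\<lambda>n. f n x)" for x
    by (auto simp: H_def indicator_def)
  have "H integrable_on UNIV" using Hi by (rule integrable_on_lborel)
  then have "H integrable_on {a..b}" by (rule integrable_on_subinterval) auto
  then show "(\<lambda>x. lim (\<lambda>n. f n x)) integrable_on {a..b}"
    by (rule integrable_spike[where S="{b}"]) (auto simp: HI)
  fix s t assume st: "a \<le> s" "s \<le> t" "t < b"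
  let ?J = "indicator {s..t} :: real \<Rightarrow> real"
  have "(\<lambda>n. \<integral>x. ?J x * (?I x * f n x) \<partial>lborel) \<longlonglongrightarrow> (\<integral>x. ?J x * H x \<partial>lborel)"
  proof (rule integral_dominated_convergence[OF _ _ gi])
    show "AE x in lborel. (\<lambda>n. ?J x * (?I x * f n x)) \<longlonglongrightarrow> ?J x * H x"
      using limH by eventually_elim (intro tendsto_intros)
    show "AE x in lborel. norm (?J x * (?I x * f n x)) \<le> g x" for n
      using bd[of n] by eventually_elim (auto simp: indicator_def)
  qed auto
  moreover have "(\<integral>x. ?J x * (?I x * f n x) \<partial>lborel) = integral {s..t} (f n)" for n
  proof -
    have "(\<integral>x. ?J x * (?I x * f n x) \<partial>lborel) = (LINT x:{s..t}|lborel. f n x)"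
      unfolding set_lebesgue_integral_def using st by (intro Bochner_Integration.integral_cong) (auto simp: indicator_def)
    also have "\<dots> = integral {s..t} (f n)"
      using st by (intro set_borel_integral_eq_integral borel_integrable_atLeastAtMost' continuous_on_subset[OF m]) auto
    finally show ?thesis .
  qed
  moreover have "(\<integral>x. ?J x * H x \<partial>lborel) = integral {s..t} (\<lambda>x. lim (\<lambda>n. f n x))"
  proof -
    have "(\<integral>x. ?J x * H x \<partial>lborel) = (LINT x:{s..t}|lborel. H x)"
      unfolding set_lebesgue_integral_def by simp
    also have "\<dots> = integral {s..t} H"
      using integrable_mult_indicator[of "{s..t}" lborel H] Hi
      by (intro set_borel_integral_eq_integral) (simp add: set_integrable_def)
    also have "\<dots> = integral {s..t} (\<lambda>x. lim (\<lambda>n. f n x))"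
      using st by (intro integral_cong) (auto simp: HI)
    finally show ?thesis .
  qed
  ultimately show "(\<lambda>n. integral {s..t} (f n)) \<longlonglongrightarrow> integral {s..t} (\<lambda>x. lim (\<lambda>n. f n x))" by simp
qed

text \<open>An elementary substitute for Hoelder with a free threshold d: values up to d are bounded
  by d, larger ones by their p-th power. Choosing d later makes the first term as small as
  desired.\<close>

lemma abs_le_powr:
  fixes x d p :: real
  assumes "d > 0" "p \<ge> 1"
  shows "\<bar>x\<bar> \<le> d + d powr (1 - p) * \<bar>x\<bar> powr p"
proof (cases "\<bar>x\<bar> \<le> d")
  case True
  then show ?thesis by (simp add: add_increasing2)
next
  case False
  then have x: "\<bar>x\<bar> > 0" using assms by linarith
  have "\<bar>x\<bar> powr (1 - p) \<le> d powr (1 - p)"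
    using False assms by (intro powr_mono2') auto
  then have "\<bar>x\<bar> powr (1 - p) * \<bar>x\<bar> powr p \<le> d powr (1 - p) * \<bar>x\<bar> powr p"
    by (intro mult_right_mono) auto
  moreover have "\<bar>x\<bar> powr (1 - p) * \<bar>x\<bar> powr p = \<bar>x\<bar>"
    using x by (simp flip: powr_add)
  ultimately show ?thesis using assms by linarith
qed

lemma chain_abs_le:
  fixes a x d p N :: real
  assumes "0 < a" "a \<le> x" "j \<le> k" "d > 0" "p \<ge> 1" "N \<ge> 1"
  shows "\<bar>G j x\<bar> \<le> d + d powr (1 - p) * a powr (1 - N) * (x powr (N - 1) * (\<Sum>j\<le>(k::nat). \<bar>G j x\<bar>) powr p)"
proof -
  have "a powr (N - 1) \<le> x powr (N - 1)" using assms by (intro powr_mono2) auto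
  then have "1 \<le> a powr (1 - N) * x powr (N - 1)"
    using assms mult_left_mono[of "a powr (N - 1)" "x powr (N - 1)" "a powr (1 - N)"]
    by (simp flip: powr_add)
  then have "1 * \<bar>G j x\<bar> powr p \<le> (a powr (1 - N) * x powr (N - 1)) * (\<Sum>j\<le>k. \<bar>G j x\<bar>) powr p"
    by (rule mult_mono[OF _ chain_member_le[OF assms(3,5)]]) simp_all
  then have "d powr (1 - p) * \<bar>G j x\<bar> powr p \<le> d powr (1 - p) * ((a powr (1 - N) * x powr (N - 1)) * (\<Sum>j\<le>k. \<bar>G j x\<bar>) powr p)"
    by (intro mult_left_mono) auto
  with abs_le_powr[OF assms(4,5), of "G j x"] show ?thesis by (simp add: mult.assoc)
qed

text \<open>Away from 0 the energy controls L^1 norms. The threshold d is used at 1 for finiteness,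
  at 2^(-n) for summable increments, and as a free parameter for equicontinuity.\<close>

lemma chain_L1:
  assumes "chain k r G" "k \<ge> 1" "j \<le> k" "0 < a" "s \<le> t" "A = {s..<t} \<or> A = {s..t}" "A \<subseteq> {a..<r}" "d > 0" "p \<ge> 1" "N \<ge> 1"
  shows "nn_on A (\<lambda>x. \<bar>G j x\<bar>)
    \<le> ennreal (d * (t - s)) + ennreal (d powr (1 - p) * a powr (1 - N)) * chain_energy k p N r G"
proof -
  let ?e = "\<lambda>x. x powr (N - 1) * (\<Sum>j\<le>k. \<bar>G j x\<bar>) powr p"
  let ?c = "d powr (1 - p) * a powr (1 - N)"
  have [measurable]: "A \<in> sets borel" using assms(6) by auto
  note [measurable] = chain_energy_measurable[OF assms(1,2,9), of N]
  have "nn_on A (\<lambda>x. \<bar>G j x\<bar>) \<le>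
    (\<integral>\<^sup>+x. ennreal d * indicator A x + ennreal ?c * (indicator {0<..<r} x * ennreal (?e x)) \<partial>lborel)"
  proof (intro nn_integral_mono)
    fix x
    show "indicator A x * ennreal \<bar>G j x\<bar> \<le> ennreal d * indicator A x + ennreal ?c * (indicator {0<..<r} x * ennreal (?e x))"
    proof (cases "x \<in> A")
      case True
      then have x: "a \<le> x" "x < r" "0 < x" using assms by auto
      have "\<bar>G j x\<bar> \<le> d + ?c * ?e x" by (rule chain_abs_le) (use assms x in auto)
      then have "ennreal \<bar>G j x\<bar> \<le> ennreal (d + ?c * ?e x)" by (rule ennreal_leI)
      also have "\<dots> = ennreal d + ennreal ?c * ennreal (?e x)"
        using assms by (subst ennreal_plus) (auto simp flip: ennreal_mult)
      finally show ?thesis using True x by simp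
    qed simp
  qed
  also have "\<dots> = ennreal d * emeasure lborel A + ennreal ?c * chain_energy k p N r G"
    unfolding chain_energy_def by (simp add: nn_integral_add nn_integral_cmult)
  also have "ennreal d * emeasure lborel A = ennreal (d * (t - s))"
    using assms by (auto simp: ennreal_mult)
  finally show ?thesis .
qed

lemma chain_diff:
  assumes "chain k r G" "chain k r G'"
  shows "chain k r (\<lambda>j s. G j s - G' j s)"
  using assms unfolding chain_def C1_on_def by (auto intro!: DERIV_diff continuous_on_diff)

lemma continuous_on_Ioc:
  fixes f :: "real \<Rightarrow> real"
  assumes "\<And>a. 0 < a \<Longrightarrow> a < r \<Longrightarrow> continuous_on {a..r} f"
  shows "continuous_on {0<..r} f"
  unfolding continuous_on_eq_continuous_within
proof
  fix t assume t: "t \<in> {0<..r}"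
  then have "continuous (at t within {t/2..r}) f"
    using assms[of "t/2"] by (auto simp: continuous_on_eq_continuous_within)
  moreover have "at t within {t/2..r} = at t within {0<..r}"
    by (rule at_within_nhd[of t "{t/2<..}"]) (use t in auto)
  ultimately show "continuous (at t within {0<..r}) f" by simp
qed

text \<open>Away from 0 all G n j with j <= k converge in L^1. For j < k one point of convergence
  and the fundamental theorem then give convergence at every point, and each limit is an indefinite
  integral of the next one. The limit of order k is merely integrable, so \<open>W (k - 1)\<close>
  is differentiable only almost everywhere.\<close>

lemma chain_limit:
  fixes G :: "nat \<Rightarrow> nat \<Rightarrow> real \<Rightarrow> real"
  assumes r: "r > 0" and p: "p \<ge> 1" and k: "k \<ge> 1" and N: "N \<ge> 1"
    and G: "\<And>n. chain k r (G n)" and G0: "chain_energy k p N r (G 0) < \<infinity>"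
    and M: "\<And>n. chain_energy k p N r (\<lambda>j s. G (Suc n) j s - G n j s) \<le> ennreal (M * 2 powr (- (real n * p)))" "M \<ge> 0"
  obtains W where "\<And>j s. j < k \<Longrightarrow> s \<in> {0<..<r} \<Longrightarrow> (\<lambda>n. G n j s) \<longlonglongrightarrow> W j s"
    and "\<And>j s. Suc j < k \<Longrightarrow> s \<in> {0<..<r} \<Longrightarrow> (W j has_real_derivative W (Suc j) s) (at s)"
    and "\<And>j. j < k \<Longrightarrow> continuous_on {0<..r} (W j)"
    and "\<exists>Z. negligible Z \<and> (\<forall>s\<in>{0<..<r} - Z. W (k - 1) differentiable (at s))"
proof -
  define H where "H j x = lim (\<lambda>n. G n j x)" for j x
  have Gcont: "continuous_on {0<..<r} (G n j)" if "j \<le> k" for n j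
    by (rule chain_continuous[OF G k that])
  have lim: "AE x in lborel. x \<in> {a..<r} \<longrightarrow> convergent (\<lambda>n. G n j x)"
    "H j integrable_on {a..r}"
    "\<And>s t. a \<le> s \<Longrightarrow> s \<le> t \<Longrightarrow> t < r \<Longrightarrow> (\<lambda>n. integral {s..t} (G n j)) \<longlonglongrightarrow> integral {s..t} (H j)"
    if a: "0 < a" "a < r" and j: "j \<le> k" for a j
  proof -
    \<comment> \<open>From \<open>chain_L1\<close> with d = 2^(-n): the energy of the increment is
      at most M 2^(-np), and d^(1-p) 2^(-np) is again 2^(-n).\<close>
    define c where "c n = (r + a powr (1 - N) * M) * (1/2) ^ n" for n :: nat
    have m: "continuous_on {a..<r} (G n j)" for n
      by (rule continuous_on_subset[OF Gcont[OF j]]) (use a in auto)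
    have "nn_on {a..<r} (\<lambda>x. \<bar>G 0 j x\<bar>)
       \<le> ennreal (1 * (r - a)) + ennreal (1 powr (1 - p) * a powr (1 - N)) * chain_energy k p N r (G 0)"
      using a by (intro chain_L1[OF G k j]) (auto intro: p N)
    also have "\<dots> < \<infinity>" using G0 by (simp add: ennreal_mult_less_top)
    finally have f0: "nn_on {a..<r} (\<lambda>x. \<bar>G 0 j x\<bar>) < \<infinity>" .
    have f1: "nn_on {a..<r} (\<lambda>x. \<bar>G (Suc n) j x - G n j x\<bar>) \<le> ennreal (c n)" for n
    proof -
      let ?d = "(1/2::real) ^ n"
      have d2: "?d = 2 powr (- real n)" by (simp add: powr_minus powr_realpow power_one_over inverse_eq_divide)
      have "nn_on {a..<r} (\<lambda>x. \<bar>G (Suc n) j x - G n j x\<bar>) \<le>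
         ennreal (?d * (r - a)) + ennreal (?d powr (1 - p) * a powr (1 - N)) * chain_energy k p N r (\<lambda>j s. G (Suc n) j s - G n j s)"
        using a chain_L1[OF chain_diff[OF G[of "Suc n"] G[of n]] k j, of a a r "{a..<r}" ?d p N] p N by auto
      also have "\<dots> \<le> ennreal (?d * r) + ennreal (?d powr (1 - p) * a powr (1 - N)) * ennreal (M * 2 powr (- (real n * p)))"
        using a by (intro add_mono mult_left_mono M ennreal_leI) auto
      also have "\<dots> = ennreal (?d * r + ?d powr (1 - p) * a powr (1 - N) * (M * 2 powr (- (real n * p))))"
        using r M(2) by (simp add: ennreal_mult)
      also have "?d powr (1 - p) * a powr (1 - N) * (M * 2 powr (- (real n * p))) = ?d * (a powr (1 - N) * M)"
      proof -
        have "?d powr (1 - p) * 2 powr (- (real n * p)) = ?d"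
          unfolding d2 by (simp add: powr_powr algebra_simps flip: powr_add)
        then show ?thesis by (metis (no_types, lifting) mult.assoc mult.commute)
      qed
      finally show ?thesis by (simp add: c_def algebra_simps)
    qed
    have cs: "summable c" unfolding c_def by (intro summable_mult summable_geometric) auto
    have cn: "c n \<ge> 0" for n using r M by (simp add: c_def)
    show "AE x in lborel. x \<in> {a..<r} \<longrightarrow> convergent (\<lambda>n. G n j x)"
      by (rule L1_limit(1)[OF a(2) m f0 f1 cs cn])
    show "H j integrable_on {a..r}"
      unfolding H_def[abs_def] by (rule L1_limit(2)[OF a(2) m f0 f1 cs cn])
    show "\<And>s t. a \<le> s \<Longrightarrow> s \<le> t \<Longrightarrow> t < r \<Longrightarrow> (\<lambda>n. integral {s..t} (G n j)) \<longlonglongrightarrow> integral {s..t} (H j)"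
      unfolding H_def[abs_def] by (rule L1_limit(3)[OF a(2) m f0 f1 cs cn])
  qed
  have ftc: "integral {s..t} (G n (Suc j)) = G n j t - G n j s" if "j < k" "0 < s" "s \<le> t" "t < r" for n j s t
    using C1_on_ftc[of r "G n j" "G n (Suc j)" s t] G[of n] that by (auto simp: chain_def integral_unique)
  have conv: "(\<lambda>n. G n j s) \<longlonglongrightarrow> H j s" if j: "j < k" and s: "s \<in> {0<..<r}" for j s
  proof -
    \<comment> \<open>Convergence almost everywhere provides a base point in an interval of positive
      length to the left of s; the integral from there to s transports convergence to s.\<close>
    have "\<exists>x\<in>{s/2<..<s}. convergent (\<lambda>n. G n j x)"
    proof (rule ccontr)
      assume no: "\<not> ?thesis"
      have "AE x in lborel. x \<notin> {s/2<..<s}"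
        using lim(1)[of "s/2" j] s j no by (auto elim!: eventually_mono)
      then have "emeasure lborel {s/2<..<s} = 0"
        using AE_iff_null_sets[of "{s/2<..<s}" lborel] by auto
      then show False using s by (simp add: ennreal_eq_0_iff)
    qed
    then obtain x where x: "s/2 < x" "x < s" "convergent (\<lambda>n. G n j x)" by auto
    have "(\<lambda>n. G n j x + integral {x..s} (G n (Suc j))) \<longlonglongrightarrow> H j x + integral {x..s} (H (Suc j))"
      using x s j lim(3)[of x "Suc j" x s] by (intro tendsto_add) (auto simp: H_def convergent_LIMSEQ_iff)
    then have "(\<lambda>n. G n j s) \<longlonglongrightarrow> H j x + integral {x..s} (H (Suc j))"
      using x s j by (simp add: ftc)
    then show ?thesis unfolding H_def by (simp add: limI)
  qed
  have Hint: "H j t - H j s = integral {s..t} (H (Suc j))" if "j < k" "0 < s" "s \<le> t" "t < r" for j s t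
  proof (rule LIMSEQ_unique)
    show "(\<lambda>n. G n j t - G n j s) \<longlonglongrightarrow> H j t - H j s"
      using that by (intro tendsto_diff conv) auto
    show "(\<lambda>n. G n j t - G n j s) \<longlonglongrightarrow> integral {s..t} (H (Suc j))"
      using lim(3)[of s "Suc j" s t] that by (simp add: ftc)
  qed
  \<comment> \<open>The limit is extended to the closed end r by the integral of the next
    derivative, which is integrable up to r; this is the value that makes it continuous
    there.\<close>
  define W where "W j t = (if t < r then H j t else H j (r/2) + integral {r/2..r} (H (Suc j)))" for j t
  have Wint: "W j t = W j s + integral {s..t} (H (Suc j))" if "j < k" "0 < s" "s < r" "s \<le> t" "t \<le> r" for j s t
  proof (cases "t < r")
    case True
    then show ?thesis using Hint[of j s t] that by (simp add: W_def)
  next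
    case False
    then have t: "t = r" using that by simp
    have i: "H (Suc j) integrable_on {min s (r/2)..r}" using lim(2)[of "min s (r/2)" "Suc j"] that r by auto
    show ?thesis
    proof (cases "s \<le> r/2")
      case True
      have "integral {s..r/2} (H (Suc j)) + integral {r/2..r} (H (Suc j)) = integral {s..r} (H (Suc j))"
        using that True i by (intro Henstock_Kurzweil_Integration.integral_combine) (auto simp: min_def)
      then show ?thesis using Hint[of j s "r/2"] that True t by (simp add: W_def)
    next
      case F: False
      have "integral {r/2..s} (H (Suc j)) + integral {s..r} (H (Suc j)) = integral {r/2..r} (H (Suc j))"
        using that F i r by (intro Henstock_Kurzweil_Integration.integral_combine) (auto simp: min_def)
      then show ?thesis using Hint[of j "r/2" s] that F r t by (simp add: W_def)
    qed
  qed
  have Wc: "continuous_on {a..r} (W j)" if "j < k" "0 < a" "a < r" for j a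
  proof -
    have "continuous_on {a..r} (\<lambda>t. W j a + integral {a..t} (H (Suc j)))"
      using lim(2)[of a "Suc j"] that by (intro continuous_on_add continuous_on_const indefinite_integral_continuous_1) auto
    then show ?thesis
      by (rule continuous_on_eq) (rule Wint[symmetric], use that in auto)
  qed
  show ?thesis
  proof (rule that[of W])
    show "(\<lambda>n. G n j s) \<longlonglongrightarrow> W j s" if "j < k" "s \<in> {0<..<r}" for j s
      using conv[OF that] that by (simp add: W_def)
    show "continuous_on {0<..r} (W j)" if "j < k" for j
      using that by (intro continuous_on_Ioc Wc)
    show "(W j has_real_derivative W (Suc j) s) (at s)" if "Suc j < k" "s \<in> {0<..<r}" for j s
    proof -
      define a b where "a = s/2" "b = (s + r)/2"
      have ab: "0 < a" "a < s" "s < b" "b < r" using that by (auto simp: a_b_def)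
      have c: "continuous_on {a..b} (W (Suc j))" by (rule continuous_on_subset[OF Wc[OF that(1) ab(1)]]) (use ab in auto)
      have "((\<lambda>t. integral {a..t} (W (Suc j))) has_real_derivative W (Suc j) s) (at s within {a..b})"
        by (rule integral_has_real_derivative[OF c]) (use ab in auto)
      then have "((\<lambda>t. integral {a..t} (W (Suc j))) has_real_derivative W (Suc j) s) (at s)"
        using ab by (simp add: at_within_Icc_at)
      then have "((\<lambda>t. W j a + integral {a..t} (W (Suc j))) has_real_derivative W (Suc j) s) (at s)"
        by (auto intro!: derivative_eq_intros)
      moreover have "W j t = W j a + integral {a..t} (W (Suc j))" if "t \<in> {a<..<b}" for t
        using Wint[of j a t] that ab \<open>Suc j < k\<close> integral_cong[of "{a..t}" "H (Suc j)" "W (Suc j)"] by (auto simp: W_def)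
      ultimately show ?thesis
        using ab by (subst DERIV_cong_ev[OF refl _ refl, of _ "\<lambda>t. W j a + integral {a..t} (W (Suc j))"])
          (auto intro!: eventually_nhds_in_open[of "{a<..<b}", THEN eventually_mono])
    qed
    have diffa: "\<exists>Z. negligible Z \<and> (\<forall>s\<in>{a<..<r} - Z. W (k - 1) differentiable (at s))" if "0 < a" "a < r" for a
    proof (rule indefinite_integral_AE_derivative)
      show "H k integrable_on {a..r}" using lim(2)[OF that] by simp
      show "W (k - 1) t - W (k - 1) s = integral {s..t} (H k)" if "a \<le> s" "s \<le> t" "t < r" for s t
        using Wint[of "k - 1" s t] that k \<open>0 < a\<close> by simp
    qed
    \<comment> \<open>The intervals from r/(n+2) to r exhaust the open interval, and countably many
      exceptional sets may be united.\<close>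
    have "\<exists>Z. negligible Z \<and> (\<forall>s\<in>{r / real (n + 2)<..<r} - Z. W (k - 1) differentiable (at s))" for n
      by (rule diffa) (use r in \<open>auto simp: divide_less_eq\<close>)
    then obtain Z where Z: "\<And>n. negligible (Z n)" "\<And>n s. s \<in> {r / real (n + 2)<..<r} - Z n \<Longrightarrow> W (k - 1) differentiable (at s)"
      by metis
    show "\<exists>Z. negligible Z \<and> (\<forall>s\<in>{0<..<r} - Z. W (k - 1) differentiable (at s))"
    proof (intro exI[of _ "\<Union>n. Z n"] conjI ballI)
      show "negligible (\<Union>n. Z n)" using Z by (intro negligible_countable_Union) auto
      fix s assume s: "s \<in> {0<..<r} - (\<Union>n. Z n)"
      obtain n :: nat where "r / s < real n" using reals_Archimedean2 by blast
      then have "r / real (n + 2) < s" using s by (simp add: field_simps)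
      then show "W (k - 1) differentiable (at s)" using Z(2)[of s n] s by auto
    qed
  qed
qed

section \<open>Restriction to rays\<close>

text \<open>Continuous partial derivatives give directional derivatives one coordinate at a time:
  the mean value theorem on the last coordinate segment bounds the change against c * D x, with D
  close to D x by continuity.\<close>

lemma directional_derivative_insert:
  fixes f :: "real^'n \<Rightarrow> real"
  assumes S: "open S" "x \<in> S" and D: "\<And>y. y \<in> S \<Longrightarrow> has_pd i f y (D y)" "continuous_on S D"
    and g: "((\<lambda>t. f (x + t *\<^sub>R w)) has_real_derivative d) (at 0)"
  shows "((\<lambda>t. f (x + t *\<^sub>R (w + c *\<^sub>R axis i 1))) has_real_derivative (d + c * D x)) (at 0)"
proof -
  have line: "((\<lambda>\<tau>. f (y + \<tau> *\<^sub>R axis i 1)) has_real_derivative D (y + \<tau> *\<^sub>R axis i 1)) (at \<tau>)" if "y + \<tau> *\<^sub>R axis i 1 \<in> S" for y \<tau>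
  proof -
    have "((\<lambda>t. f ((y + \<tau> *\<^sub>R axis i 1) + t *\<^sub>R axis i 1)) has_real_derivative D (y + \<tau> *\<^sub>R axis i 1)) (at 0)"
      using D(1)[OF that] by (simp add: has_pd_def)
    moreover have "(y + \<tau> *\<^sub>R axis i 1) + t *\<^sub>R axis i 1 = y + (t + \<tau>) *\<^sub>R axis i (1::real)" for t
      by (simp add: algebra_simps)
    ultimately show ?thesis
      using DERIV_shift[of "\<lambda>\<tau>. f (y + \<tau> *\<^sub>R axis i 1)" "D (y + \<tau> *\<^sub>R axis i 1)" 0 \<tau>] by simp
  qed
  have "((\<lambda>t. f (x + t *\<^sub>R (w + c *\<^sub>R axis i 1)) - f (x + t *\<^sub>R w)) has_real_derivative c * D x) (at 0)"
    unfolding DERIV_def LIM_def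
  proof (intro allI impI)
    fix e :: real assume e: "e > 0"
    define e' where "e' = e / (\<bar>c\<bar> + 1)"
    have e': "e' > 0" using e by (simp add: e'_def)
    obtain \<delta> where \<delta>: "\<delta> > 0" "\<And>y. dist y x < \<delta> \<Longrightarrow> y \<in> S \<and> \<bar>D y - D x\<bar> < e'"
    proof -
      have "isCont D x" using D(2) S by (simp add: continuous_on_eq_continuous_at)
      then obtain d1 where d1: "d1 > 0" "\<And>y. dist y x < d1 \<Longrightarrow> dist (D y) (D x) < e'"
        using e' unfolding continuous_at_eps_delta by metis
      obtain d2 where d2: "d2 > 0" "ball x d2 \<subseteq> S" using S openE by blast
      show ?thesis
        by (rule that[of "min d1 d2"]) (use d1 d2 in \<open>auto simp: dist_real_def dist_commute subset_iff\<close>)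
    qed
    \<comment> \<open>Small enough that for |t| < \<eta> the whole segment travelled in direction i
      stays within \<delta> of x.\<close>
    define \<eta> where "\<eta> = \<delta> / (norm w + \<bar>c\<bar> + 1)"
    have den: "norm w + \<bar>c\<bar> + 1 > 0" by (simp add: add_nonneg_pos)
    show "\<exists>s>0. \<forall>t. t \<noteq> 0 \<and> dist t 0 < s \<longrightarrow>
       dist ((f (x + (0 + t) *\<^sub>R (w + c *\<^sub>R axis i 1)) - f (x + (0 + t) *\<^sub>R w) - (f (x + 0 *\<^sub>R (w + c *\<^sub>R axis i 1)) - f (x + 0 *\<^sub>R w))) / t) (c * D x) < e"
    proof (intro exI[of _ \<eta>] conjI allI impI)
      show "\<eta> > 0" using \<delta> den by (simp add: \<eta>_def)
      fix t :: real assume t: "t \<noteq> 0 \<and> dist t 0 < \<eta>"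
      define y where "y = x + t *\<^sub>R w"
      define \<psi> where "\<psi> \<tau> = f (y + \<tau> *\<^sub>R axis i 1) - \<tau> * D x" for \<tau>
      have near: "dist (y + \<tau> *\<^sub>R axis i 1) x < \<delta>" if "\<bar>\<tau>\<bar> \<le> \<bar>t * c\<bar>" for \<tau>
      proof -
        have "dist (y + \<tau> *\<^sub>R axis i 1) x = norm (t *\<^sub>R w + \<tau> *\<^sub>R axis i 1)" by (simp add: y_def dist_norm)
        also have "\<dots> \<le> \<bar>t\<bar> * norm w + \<bar>\<tau>\<bar>" by (rule order_trans[OF norm_triangle_ineq]) simp
        also have "\<dots> \<le> \<bar>t\<bar> * norm w + \<bar>t\<bar> * \<bar>c\<bar>" using that by (simp add: abs_mult)
        also have "\<dots> \<le> \<bar>t\<bar> * (norm w + \<bar>c\<bar> + 1)" by (simp add: algebra_simps)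
        also have "\<dots> < \<delta>" using t den by (simp add: \<eta>_def field_simps)
        finally show ?thesis .
      qed
      have "norm (\<psi> (t * c) - \<psi> 0) \<le> e' * norm (t * c - 0)"
      proof (rule field_differentiable_bound[where S="{-\<bar>t * c\<bar>..\<bar>t * c\<bar>}" and f'="\<lambda>\<tau>. D (y + \<tau> *\<^sub>R axis i 1) - D x"])
        fix \<tau> assume "\<tau> \<in> {-\<bar>t * c\<bar>..\<bar>t * c\<bar>}"
        then have "\<bar>\<tau>\<bar> \<le> \<bar>t * c\<bar>" by auto
        from \<delta>(2)[OF near[OF this]] have in_S: "y + \<tau> *\<^sub>R axis i 1 \<in> S" and bd: "\<bar>D (y + \<tau> *\<^sub>R axis i 1) - D x\<bar> < e'" by auto
        show "norm (D (y + \<tau> *\<^sub>R axis i 1) - D x) \<le> e'" using bd by simp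
        have "(\<psi> has_real_derivative D (y + \<tau> *\<^sub>R axis i 1) - 1 * D x) (at \<tau>)"
          unfolding \<psi>_def by (intro DERIV_diff line in_S DERIV_cmult_right DERIV_ident)
        then show "(\<psi> has_field_derivative D (y + \<tau> *\<^sub>R axis i 1) - D x) (at \<tau> within {-\<bar>t * c\<bar>..\<bar>t * c\<bar>})"
          by (simp add: has_field_derivative_at_within)
      qed auto
      moreover have "y + (t * c) *\<^sub>R axis i 1 = x + t *\<^sub>R (w + c *\<^sub>R axis i 1)" by (simp add: y_def algebra_simps)
      ultimately have "\<bar>f (x + t *\<^sub>R (w + c *\<^sub>R axis i 1)) - f (x + t *\<^sub>R w) - t * (c * D x)\<bar> \<le> e' * (\<bar>t\<bar> * \<bar>c\<bar>)"
        by (simp add: \<psi>_def abs_mult y_def algebra_simps)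
      moreover have "\<bar>z / t - c * D x\<bar> * \<bar>t\<bar> = \<bar>z - t * (c * D x)\<bar>" for z
      proof -
        have "(z / t - c * D x) * t = z - t * (c * D x)" using t by (simp add: left_diff_distrib)
        then show ?thesis by (metis abs_mult)
      qed
      ultimately have "\<bar>(f (x + t *\<^sub>R (w + c *\<^sub>R axis i 1)) - f (x + t *\<^sub>R w)) / t - c * D x\<bar> * \<bar>t\<bar> \<le> e' * \<bar>c\<bar> * \<bar>t\<bar>"
        by (simp add: mult_ac)
      then have "\<bar>(f (x + t *\<^sub>R (w + c *\<^sub>R axis i 1)) - f (x + t *\<^sub>R w)) / t - c * D x\<bar> \<le> e' * \<bar>c\<bar>"
        using t by simp
      also have "e' * \<bar>c\<bar> < e" using e by (simp add: e'_def field_simps)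
      finally show "dist ((f (x + (0 + t) *\<^sub>R (w + c *\<^sub>R axis i 1)) - f (x + (0 + t) *\<^sub>R w) - (f (x + 0 *\<^sub>R (w + c *\<^sub>R axis i 1)) - f (x + 0 *\<^sub>R w))) / t) (c * D x) < e"
        by (simp add: dist_real_def)
    qed
  qed
  from DERIV_add[OF g this] show ?thesis by simp
qed

lemma ray_derivative:
  fixes f :: "real^'n \<Rightarrow> real"
  assumes S: "open S" "s *\<^sub>R w \<in> S" and D: "\<And>i y. y \<in> S \<Longrightarrow> has_pd i f y (D i y)" "\<And>i. continuous_on S (D i)"
  shows "((\<lambda>s. f (s *\<^sub>R w)) has_real_derivative (\<Sum>i\<in>UNIV. w $ i * D i (s *\<^sub>R w))) (at s)"
proof -
  let ?x = "s *\<^sub>R w"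
  have "((\<lambda>t. f (?x + t *\<^sub>R (\<Sum>i\<in>A. (w $ i) *\<^sub>R axis i 1))) has_real_derivative (\<Sum>i\<in>A. w $ i * D i ?x)) (at 0)" for A
  proof (induction A rule: infinite_finite_induct)
    case (insert i A)
    from directional_derivative_insert[where i=i and D="D i" and c="w $ i", OF S D insert.IH] show ?case
      using insert.hyps by (simp add: add.commute)
  qed auto
  from this[of UNIV] have "((\<lambda>t. f (?x + t *\<^sub>R w)) has_real_derivative (\<Sum>i\<in>UNIV. w $ i * D i ?x)) (at 0)"
    using basis_expansion[of w] by (simp add: scalar_mult_eq_scaleR)
  moreover have "?x + t *\<^sub>R w = (t + s) *\<^sub>R w" for t by (simp add: algebra_simps)
  ultimately show ?thesis
    using DERIV_shift[of "\<lambda>s. f (s *\<^sub>R w)" "\<Sum>i\<in>UNIV. w $ i * D i ?x" 0 s] by simp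
qed

text \<open>The j-th derivative of the function s -> u (s w), expanded over ordered index
  lists.\<close>

definition ray_chain :: "(real^'n \<Rightarrow> real) \<Rightarrow> real^'n \<Rightarrow> nat \<Rightarrow> real \<Rightarrow> real" where
  "ray_chain u w j s = (\<Sum>is | length is = j. prod_list (map (\<lambda>i. w $ i) is) * pdl is u (s *\<^sub>R w))"

lemma lists_Suc_bij: "bij_betw (\<lambda>(i, is). i # is) (UNIV \<times> {is::'n::finite list. length is = j}) {is. length is = Suc j}"
  by (rule bij_betwI[where g="\<lambda>xs. (hd xs, tl xs)"]) (auto simp: length_Suc_conv)

lemma ray_chain_derivative:
  fixes u :: "real^'n \<Rightarrow> real"
  assumes "open S" "smooth_on S u" "s *\<^sub>R w \<in> S"
  shows "(ray_chain u w j has_real_derivative ray_chain u w (Suc j) s) (at s)"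
proof -
  have "((\<lambda>s. pdl is u (s *\<^sub>R w)) has_real_derivative (\<Sum>i\<in>UNIV. w $ i * pdl (i # is) u (s *\<^sub>R w))) (at s)" for "is"
    by (rule ray_derivative[OF assms(1,3) smooth_has_pd[OF assms(2)] smooth_continuous_on[OF assms(2)]])
  then have "(ray_chain u w j has_real_derivative
      (\<Sum>is | length is = j. prod_list (map (\<lambda>i. w $ i) is) * (\<Sum>i\<in>UNIV. w $ i * pdl (i # is) u (s *\<^sub>R w)))) (at s)"
    unfolding ray_chain_def[abs_def] by (intro DERIV_sum DERIV_cmult)
  also have "(\<Sum>is | length is = j. prod_list (map (\<lambda>i. w $ i) is) * (\<Sum>i\<in>UNIV. w $ i * pdl (i # is) u (s *\<^sub>R w)))
     = (\<Sum>i\<in>UNIV. \<Sum>is | length is = j. w $ i * prod_list (map (\<lambda>i. w $ i) is) * pdl (i # is) u (s *\<^sub>R w))"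
    unfolding sum_distrib_left by (subst sum.swap) (intro sum.cong refl, simp add: mult_ac)
  also have "\<dots> = (\<Sum>x\<in>UNIV \<times> {is. length is = j}. (\<lambda>is. prod_list (map (\<lambda>i. w $ i) is) * pdl is u (s *\<^sub>R w)) (case x of (i, is) \<Rightarrow> i # is))"
    unfolding sum.cartesian_product by (intro sum.cong refl) auto
  also have "\<dots> = ray_chain u w (Suc j) s"
    unfolding ray_chain_def by (rule sum.reindex_bij_betw[OF lists_Suc_bij])
  finally show ?thesis .
qed

lemma ray_chain_continuous_on:
  assumes "smooth_on S u" "\<And>s. s \<in> A \<Longrightarrow> s *\<^sub>R w \<in> S"
  shows "continuous_on A (ray_chain u w j)"
  unfolding ray_chain_def[abs_def]
  by (intro continuous_on_sum continuous_on_mult continuous_on_const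
      continuous_on_compose2[OF smooth_continuous_on[OF assms(1)]] continuous_intros) (use assms in auto)

lemma chain_ray_chain:
  fixes u :: "real^'n \<Rightarrow> real"
  assumes "smooth_on (ball 0 r) u" "norm w = 1"
  shows "chain k r (ray_chain u w)"
  unfolding chain_def C1_on_def
  using assms by (auto intro!: ray_chain_derivative[of "ball 0 r"] ray_chain_continuous_on[of "ball 0 r"])

lemma ray_chain_le_jet:
  assumes "norm w = 1"
  shows "(\<Sum>j\<le>k. \<bar>ray_chain u w j s\<bar>) \<le> jet k u (s *\<^sub>R w)"
proof -
  have "\<bar>prod_list (map (\<lambda>i. w $ i) is)\<bar> \<le> 1" for "is" :: "'a list"
  proof (induction "is")
    case (Cons i "is")
    have "\<bar>w $ i\<bar> \<le> 1" using component_le_norm_cart[of w i] assms by simp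
    then show ?case using Cons by (simp add: abs_mult mult_le_one)
  qed simp
  then have 1: "\<bar>ray_chain u w j s\<bar> \<le> (\<Sum>is | length is = j. \<bar>pdl is u (s *\<^sub>R w)\<bar>)" for j
    unfolding ray_chain_def
    by (intro order_trans[OF sum_abs] sum_mono) (simp add: abs_mult mult_left_le_one_le)
  show ?thesis
  proof (induction k)
    case 0
    show ?case using 1[of 0] by (simp add: jet_def)
  next
    case (Suc k)
    then show ?case using 1[of "Suc k"] by (simp add: jet_Suc)
  qed
qed

lemma ray_chain_diff:
  fixes u v :: "real^'n \<Rightarrow> real"
  assumes "open S" "smooth_on S u" "smooth_on S v" "s *\<^sub>R w \<in> S"
  shows "ray_chain (\<lambda>x. u x - v x) w j s = ray_chain u w j s - ray_chain v w j s"
  unfolding ray_chain_def by (simp add: smooth_pdl_diff[OF assms] right_diff_distrib sum_subtractf)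

text \<open>G has to agree with a ray chain only on the open interval, so that the estimate also
  covers differences of two ray chains.\<close>

lemma ray_chain_energy_le:
  fixes u :: "real^'n \<Rightarrow> real"
  assumes "R > 0" "norm w = 1" "p \<ge> 1"
    and "\<And>j s. s \<in> {0<..<tanh (R/2)} \<Longrightarrow> G j s = ray_chain u w j s"
  shows "chain_energy k p (real CARD('n)) (tanh (R/2)) G \<le>
    (\<integral>\<^sup>+s. indicator {0<..} s * ennreal (s ^ (CARD('n) - 1)) *
        (indicator (hball R) (s *\<^sub>R w) * ennreal (jet k u (s *\<^sub>R w) powr p)) \<partial>lborel)"
  unfolding chain_energy_def
proof (intro nn_integral_mono)
  fix s :: real
  let ?N = "CARD('n)"
  show "indicator {0<..<tanh (R/2)} s * ennreal (s powr (real ?N - 1) * (\<Sum>j\<le>k. \<bar>G j s\<bar>) powr p)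
    \<le> indicator {0<..} s * ennreal (s ^ (?N - 1)) * (indicator (hball R) (s *\<^sub>R w) * ennreal (jet k u (s *\<^sub>R w) powr p))"
  proof (cases "s \<in> {0<..<tanh (R/2)}")
    case True
    have "real ?N - 1 = real (?N - 1)" by (simp add: of_nat_diff Suc_leI)
    moreover have "s powr real (?N - 1) = s ^ (?N - 1)" using True by (intro powr_realpow) auto
    ultimately have "s powr (real ?N - 1) = s ^ (?N - 1)" by simp
    moreover have "(\<Sum>j\<le>k. \<bar>G j s\<bar>) powr p \<le> jet k u (s *\<^sub>R w) powr p"
      using ray_chain_le_jet[OF assms(2), where k=k and u=u and s=s] assms(3,4) True by (intro powr_mono2) (auto simp: sum_nonneg)
    moreover have "s *\<^sub>R w \<in> hball R" using True assms by (simp add: hball_eq_ball)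
    ultimately show ?thesis
      using True by (simp add: ennreal_mult[symmetric] mult_left_mono)
  qed simp
qed

section \<open>Almost every direction, and the selection of one direction\<close>

lemma shell_norm_pos: "\<omega> \<in> shell \<Longrightarrow> norm \<omega> > 0"
  by (cases "\<omega> = 0") (auto simp: shell_def)

text \<open>The polar integral of the indicator of a null set is 0, so for almost every direction
  its radial integral is 0; the positive weight s^(N-1) then makes the slice null.\<close>

lemma AE_polar:
  fixes P :: "real^'n \<Rightarrow> bool"
  assumes "AE x in lborel. P x"
  shows "AE \<omega> in lborel. \<omega> \<in> shell \<longrightarrow> (AE s in lborel. s > 0 \<longrightarrow> P ((s / norm \<omega>) *\<^sub>R \<omega>))"
proof -
  obtain Z where Z: "Z \<in> null_sets lborel" "{x. \<not> P x} \<subseteq> Z" using assms by (auto simp: eventually_ae_filter)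
  have [measurable]: "Z \<in> sets borel" using Z by auto
  define I where "I \<omega> = (\<integral>\<^sup>+s. indicator {0<..} s * ennreal (s ^ (CARD('n) - 1)) * indicator Z ((s / norm \<omega>) *\<^sub>R \<omega>) \<partial>lborel)" for \<omega> :: "real^'n"
  have Im [measurable]: "I \<in> borel_measurable borel" unfolding I_def by measurable
  have "(\<integral>\<^sup>+\<omega>. indicator shell \<omega> * ennreal (1 / norm \<omega> ^ CARD('n)) * I \<omega> \<partial>lborel) = 0"
    using nn_integral_polar[of "indicator Z :: real^'n \<Rightarrow> ennreal"] null_setsD1[OF Z(1)] by (simp add: I_def)
  then have "AE \<omega> in lborel. indicator shell \<omega> * ennreal (1 / norm \<omega> ^ CARD('n)) * I \<omega> = 0"
    by (subst (asm) nn_integral_0_iff_AE) auto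
  then show ?thesis
  proof eventually_elim
    case (elim \<omega>)
    show ?case
    proof
      assume s: "\<omega> \<in> shell"
      then have "norm \<omega> > 0" by (rule shell_norm_pos)
      then have "ennreal (1 / norm \<omega> ^ CARD('n)) \<noteq> 0" by (simp add: ennreal_eq_0_iff not_le)
      then have "I \<omega> = 0" using elim s by simp
      then have "AE s in lborel. indicator {0<..} s * ennreal (s ^ (CARD('n) - 1)) * indicator Z ((s / norm \<omega>) *\<^sub>R \<omega>) = (0::ennreal)"
        unfolding I_def by (subst (asm) nn_integral_0_iff_AE) auto
      then show "AE s in lborel. s > 0 \<longrightarrow> P ((s / norm \<omega>) *\<^sub>R \<omega>)"
      proof eventually_elim
        case (elim s)
        have "(s / norm \<omega>) *\<^sub>R \<omega> \<notin> Z" if "s > 0"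
        proof -
          have "s ^ (CARD('n) - 1) > 0" using that by simp
          then have "ennreal (s ^ (CARD('n) - 1)) \<noteq> 0" by (simp add: ennreal_eq_0_iff not_le)
          then show ?thesis using elim that by auto
        qed
        then show ?case using Z(2) by auto
      qed
    qed
  qed
qed

lemma shell_not_negligible: "\<not> negligible (shell :: (real^'n) set)"
proof
  assume n: "negligible (shell :: (real^'n) set)"
  obtain i :: 'n where True by simp
  let ?c = "(3/4) *\<^sub>R axis i (1::real)"
  have "ball ?c (1/8) \<subseteq> shell"
  proof
    fix y assume "y \<in> ball ?c (1/8)"
    then have "norm (?c - y) < 1/8" by (simp add: dist_norm)
    moreover have "norm ?c = 3/4" by simp
    ultimately show "y \<in> shell"
      using norm_triangle_ineq2[of ?c y] norm_triangle_ineq2[of y ?c] by (simp add: shell_def norm_minus_commute)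
  qed
  then have "negligible (ball ?c (1/8))" using n negligible_subset by blast
  then show False using open_not_negligible[of "ball ?c (1/8)"] by simp
qed

text \<open>The density of directions in the polar formula. Its total mass is log 2 times the area
  of the unit sphere.\<close>

definition kappa :: "real^'n \<Rightarrow> ennreal" where
  "kappa \<omega> = indicator shell \<omega> * ennreal (1 / norm \<omega> ^ CARD('n))"

lemma kappa_measurable [measurable]: "(kappa :: real^'n \<Rightarrow> ennreal) \<in> borel_measurable borel"
  unfolding kappa_def by measurable

lemma kappa_pos: "\<omega> \<in> shell \<Longrightarrow> kappa \<omega> \<noteq> 0"
  using shell_norm_pos[of \<omega>] by (simp add: kappa_def ennreal_eq_0_iff not_le)

lemma kappa_integral:
  "(\<integral>\<^sup>+\<omega>. kappa (\<omega> :: real^'n) \<partial>lborel) \<noteq> 0" "(\<integral>\<^sup>+\<omega>. kappa (\<omega> :: real^'n) \<partial>lborel) < \<infinity>"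
proof -
  have "(\<integral>\<^sup>+\<omega>. kappa (\<omega> :: real^'n) \<partial>lborel) \<le> (\<integral>\<^sup>+\<omega>. ennreal (2 ^ CARD('n)) * indicator (cball 0 1) (\<omega> :: real^'n) \<partial>lborel)"
  proof (intro nn_integral_mono)
    fix \<omega> :: "real^'n"
    show "kappa \<omega> \<le> ennreal (2 ^ CARD('n)) * indicator (cball 0 1) \<omega>"
    proof (cases "\<omega> \<in> shell")
      case True
      then have "(1/2) ^ CARD('n) \<le> norm \<omega> ^ CARD('n)" by (intro power_mono) (auto simp: shell_def)
      then have "1 / norm \<omega> ^ CARD('n) \<le> 1 / (1/2) ^ CARD('n)" by (intro divide_left_mono) (use shell_norm_pos[OF True] in \<open>auto intro!: mult_pos_pos zero_less_power\<close>)
      then show ?thesis using True by (simp add: kappa_def shell_def power_one_over ennreal_leI)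
    qed (simp add: kappa_def)
  qed
  also have "\<dots> < \<infinity>"
    by (subst nn_integral_cmult_indicator) (use emeasure_compact_finite[OF compact_cball, of "0::real^'n" 1] in \<open>auto simp: ennreal_mult_less_top\<close>)
  finally show "(\<integral>\<^sup>+\<omega>. kappa (\<omega> :: real^'n) \<partial>lborel) < \<infinity>" .
  show "(\<integral>\<^sup>+\<omega>. kappa (\<omega> :: real^'n) \<partial>lborel) \<noteq> 0"
  proof
    assume "(\<integral>\<^sup>+\<omega>. kappa (\<omega> :: real^'n) \<partial>lborel) = 0"
    then have "AE \<omega> in lborel. kappa (\<omega> :: real^'n) = 0" by (subst (asm) nn_integral_0_iff_AE) auto
    then have "AE \<omega> in lborel. (\<omega> :: real^'n) \<notin> shell" by eventually_elim (use kappa_pos in auto)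
    then have "shell \<in> null_sets (lborel :: (real^'n) measure)" by (subst (asm) AE_iff_null_sets[symmetric]) auto
    from null_sets_completionI[OF this] show False using shell_not_negligible by (auto simp: negligible_iff_null_sets)
  qed
qed

text \<open>A value not exceeding the mean is attained, even under a side condition that holds
  almost everywhere: otherwise L - m would be positive almost everywhere on the shell while its
  weighted integral is 0.\<close>

lemma exists_below_mean:
  fixes L :: "real^'n \<Rightarrow> ennreal"
  assumes [measurable]: "L \<in> borel_measurable borel"
    and L: "(\<integral>\<^sup>+\<omega>. kappa \<omega> * L \<omega> \<partial>lborel) \<le> m * (\<integral>\<^sup>+\<omega>. kappa (\<omega>::real^'n) \<partial>lborel)" and m: "m < \<infinity>"
    and P: "AE \<omega> in lborel. \<omega> \<in> shell \<longrightarrow> P \<omega>"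
  shows "\<exists>\<omega>\<in>shell. P \<omega> \<and> L \<omega> \<le> m"
proof (rule ccontr)
  assume no: "\<not> ?thesis"
  let ?S = "\<integral>\<^sup>+\<omega>. kappa (\<omega>::real^'n) \<partial>lborel"
  have gt: "AE \<omega> in lborel. \<omega> \<in> shell \<longrightarrow> L \<omega> > m" using P by eventually_elim (use no in auto)
  \<comment> \<open>L is split as m + (L - m) before integrating, so that only the finite quantity m
    times the mass has to be cancelled in \<open>ennreal\<close>.\<close>
  then have "AE \<omega> in lborel. kappa \<omega> * L \<omega> = m * kappa \<omega> + kappa \<omega> * (L \<omega> - m)"
  proof eventually_elim
    case (elim \<omega>)
    show ?case
    proof (cases "\<omega> \<in> shell")
      case True
      then have "m + (L \<omega> - m) = L \<omega>" using elim by (simp add: add_diff_inverse_ennreal less_imp_le)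
      then show ?thesis by (metis distrib_left mult.commute)
    qed (simp add: kappa_def)
  qed
  then have "(\<integral>\<^sup>+\<omega>. kappa \<omega> * L \<omega> \<partial>lborel) = (\<integral>\<^sup>+\<omega>. m * kappa \<omega> + kappa \<omega> * (L \<omega> - m) \<partial>lborel)"
    by (rule nn_integral_cong_AE)
  also have "\<dots> = m * ?S + (\<integral>\<^sup>+\<omega>. kappa \<omega> * (L \<omega> - m) \<partial>lborel)"
    by (subst nn_integral_add) (auto simp: nn_integral_cmult)
  finally have "m * ?S + (\<integral>\<^sup>+\<omega>. kappa \<omega> * (L \<omega> - m) \<partial>lborel) \<le> m * ?S + 0" using L by simp
  moreover have "m * ?S \<noteq> \<infinity>" using m kappa_integral(2)[where 'n='n] by (simp add: ennreal_mult_eq_top_iff less_top)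
  ultimately have "(\<integral>\<^sup>+\<omega>. kappa \<omega> * (L \<omega> - m) \<partial>lborel) = 0"
    by (metis ennreal_add_left_cancel_le infinity_ennreal_def le_zero_eq)
  then have "AE \<omega> in lborel. kappa \<omega> * (L \<omega> - m) = 0" by (subst (asm) nn_integral_0_iff_AE) auto
  then have "AE \<omega> in lborel. \<omega> \<notin> (shell :: (real^'n) set)"
    using gt
  proof eventually_elim
    case (elim \<omega>)
    then show ?case using kappa_pos[of \<omega>] by (auto simp: diff_eq_0_iff_ennreal)
  qed
  then have "AE \<omega> in lborel. kappa (\<omega>::real^'n) = 0" by eventually_elim (simp add: kappa_def)
  then have "?S = 0" by (subst nn_integral_0_iff_AE) auto
  then show False using kappa_integral(1)[where 'n='n] by simp
qed

section \<open>Approximating sequences and the profile on a ray\<close>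

lemma liminf_cmult_ennreal:
  fixes f :: "nat \<Rightarrow> ennreal"
  assumes "c < \<infinity>"
  shows "liminf (\<lambda>n. c * f n) = c * liminf f"
proof (rule Liminf_compose_continuous_mono)
  show "continuous_on UNIV (\<lambda>x. c * x)"
    unfolding continuous_on_def using assms by (auto intro!: ennreal_tendsto_cmult tendsto_ident_at simp: less_top)
qed (auto simp: mono_def mult_left_mono)

text \<open>\<open>enn2real\<close> sends infinity to 0, so the norm determines its p-th power only
  under finiteness.\<close>

lemma Wnorm_pow_eq:
  assumes "Wnorm_pow k p R u < \<infinity>" "p > 0"
  shows "Wnorm_pow k p R u = ennreal (Wnorm k p R u powr p)"
  using assms unfolding Wnorm_def by (simp add: powr_powr)

text \<open>The Cauchy condition in \<open>approxW\<close> is phrased with \<open>Wnorm\<close>,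
  which would read 0 on a difference of infinite norm. Finiteness is obtained through the energy,
  where the triangle inequality holds pointwise on jets.\<close>

lemma smoothW_diff_finite:
  fixes u v :: "real^'n \<Rightarrow> real"
  assumes "R > 0" "p > 0" "smoothW k p R u" "smoothW k p R v"
  shows "smoothW k p R (\<lambda>x. u x - v x)"
proof -
  obtain C1 where C1: "C1 \<ge> 0" "\<And>u::real^'n \<Rightarrow> real. smooth_on (hball R) u \<Longrightarrow> energy k p R u \<le> ennreal C1 * Wnorm_pow k p R u"
    using energy_le_Wnorm_pow[OF assms(1,2), of k] by blast
  obtain C2 where C2: "C2 \<ge> 0" "\<And>u::real^'n \<Rightarrow> real. smooth_on (hball R) u \<Longrightarrow> Wnorm_pow k p R u \<le> ennreal C2 * energy k p R u"
    using Wnorm_pow_le_energy[OF assms(1,2), of k] by blast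
  have s: "smooth_on (hball R) u" "smooth_on (hball R) v" using assms by (auto simp: smoothW_def)
  have fin: "energy k p R u < \<infinity>" "energy k p R v < \<infinity>"
    using C1(2)[OF s(1)] C1(2)[OF s(2)] assms by (auto simp: smoothW_def ennreal_mult_less_top elim!: order_le_less_trans)
  have d: "smooth_on (hball R) (\<lambda>x. u x - v x)" by (rule smooth_on_diff[OF open_hball[OF assms(1)] s])
  have "energy k p R (\<lambda>x. u x - v x) < \<infinity>"
    using energy_triangle(2)[OF assms(1,2) s, of k] fin by (auto simp: ennreal_mult_less_top elim!: order_le_less_trans)
  then have "Wnorm_pow k p R (\<lambda>x. u x - v x) < \<infinity>"
    using C2(2)[OF d] by (auto simp: ennreal_mult_less_top elim!: order_le_less_trans)
  then show ?thesis using d by (simp add: smoothW_def)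
qed

lemma smooth_measurable_lebesgue:
  fixes f :: "real^'n \<Rightarrow> real"
  assumes "R > 0" "smooth_on (hball R) f"
  shows "(\<lambda>x. indicator (hball R) x * f x) \<in> borel_measurable borel"
  using borel_measurable_continuous_on_indicator[OF _ smooth_continuous_on[OF assms(2), of "[]"]] open_hball[OF assms(1), where 'n='n]
  by simp

text \<open>The series of |\<psi> n - u|^p times the volume factor has finite integral, hence
  converges almost everywhere, and its terms tend to 0.\<close>

lemma Lp_summable_AE:
  fixes \<psi> :: "nat \<Rightarrow> real^'n \<Rightarrow> real"
  assumes R: "R > 0" and p: "p \<ge> 1" and s: "\<And>n. smooth_on (hball R) (\<psi> n)"
    and u: "set_borel_measurable lebesgue (hball R) u"
    and L: "\<And>n. Lp_dist p R (\<psi> n) u \<le> ennreal ((1/2) ^ n)"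
  shows "AE x in lborel. x \<in> hball R \<longrightarrow> (\<lambda>n. \<psi> n x) \<longlonglongrightarrow> u x"
proof -
  define g where "g n x = indicator (hball R) x * ennreal (\<bar>\<psi> n x - u x\<bar> powr p * conf x ^ CARD('n))" for n and x :: "real^'n"
  have hb: "(hball R :: (real^'n) set) \<in> sets borel" using open_hball[OF R] by (rule borel_open)
  have gm: "g n \<in> borel_measurable lebesgue" for n
  proof -
    have 1: "(\<lambda>x. indicator (hball R) x * u x) \<in> borel_measurable lebesgue"
      using u by (simp add: set_borel_measurable_def)
    have 2: "(\<lambda>x. indicator (hball R) x * \<psi> n x) \<in> borel_measurable lebesgue"
      using smooth_measurable_lebesgue[OF R s] by (intro measurable_completion) simp
    have 3: "(\<lambda>x::real^'n. indicator (hball R) x * conf x) \<in> borel_measurable lebesgue"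
      using borel_measurable_continuous_on_indicator[OF hb continuous_on_subset[OF continuous_on_conf hball_subset]]
      by (intro measurable_completion) simp
    have "(\<lambda>x. ennreal (\<bar>indicator (hball R) x * \<psi> n x - indicator (hball R) x * u x\<bar> powr p * (indicator (hball R) x * conf x) ^ CARD('n))) \<in> borel_measurable lebesgue"
      using 1 2 3 by measurable
    then show ?thesis
      unfolding g_def by (rule measurable_cong[THEN iffD1, rotated]) (auto simp: indicator_def)
  qed
  have "(\<integral>\<^sup>+x. (\<Sum>n. g n x) \<partial>lebesgue) = (\<Sum>n. Lp_dist p R (\<psi> n) u)"
    unfolding Lp_dist_def g_def[symmetric] by (rule nn_integral_suminf[OF gm])
  also have "\<dots> \<le> (\<Sum>n. ennreal ((1/2) ^ n))" by (intro suminf_le L) auto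
  also have "\<dots> < \<infinity>" by (subst suminf_ennreal2) (auto intro!: summable_geometric)
  finally have fin: "(\<integral>\<^sup>+x. (\<Sum>n. g n x) \<partial>lebesgue) < \<infinity>" .
  note [measurable] = gm
  have "AE x in lebesgue. (\<Sum>n. g n x) \<noteq> \<infinity>"
    by (intro nn_integral_noteq_infinite) (use fin in auto)
  then have "AE x in lborel. (\<Sum>n. g n x) \<noteq> \<infinity>" by (simp add: AE_completion_iff)
  then show ?thesis
  proof eventually_elim
    case (elim x)
    show ?case
    proof
      assume x: "x \<in> hball R"
      then have c: "conf x \<ge> 2" using hball_subset[of R] conf_ge by blast
      have "summable (\<lambda>n. \<bar>\<psi> n x - u x\<bar> powr p * conf x ^ CARD('n))"
        using elim x c by (intro summable_suminf_not_top) (auto simp: g_def)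
      then have "(\<lambda>n. \<bar>\<psi> n x - u x\<bar> powr p * conf x ^ CARD('n)) \<longlonglongrightarrow> 0" by (rule summable_LIMSEQ_zero)
      from tendsto_mult_right_zero[OF this, of "1 / conf x ^ CARD('n)"]
      have "(\<lambda>n. \<bar>\<psi> n x - u x\<bar> powr p) \<longlonglongrightarrow> 0" using c by simp
      then have "(\<lambda>n. (\<bar>\<psi> n x - u x\<bar> powr p) powr (1/p)) \<longlonglongrightarrow> 0 powr (1/p)"
        using p by (intro tendsto_powr'[OF _ tendsto_const]) auto
      then have "(\<lambda>n. \<bar>\<psi> n x - u x\<bar>) \<longlonglongrightarrow> 0" using p by (simp add: powr_powr)
      then show "(\<lambda>n. \<psi> n x) \<longlonglongrightarrow> u x"
        by (simp add: tendsto_rabs_zero_iff LIM_zero_iff)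
    qed
  qed
qed

text \<open>
  \<open>G n j\<close> is the j-th derivative, along one suitably chosen ray, of the n-th member of a fast Cauchy
  subsequence of the approximants of u, and v is the radial profile of u.
\<close>

definition radial_profile :: "nat \<Rightarrow> real \<Rightarrow> real \<Rightarrow> real \<Rightarrow> (real^'n \<Rightarrow> real) \<Rightarrow> (nat \<Rightarrow> nat \<Rightarrow> real \<Rightarrow> real) \<Rightarrow> (real \<Rightarrow> real) \<Rightarrow> ennreal \<Rightarrow> bool" where
  "radial_profile k p N R u G v E \<longleftrightarrow>
     (\<forall>n. chain k (tanh (R/2)) (G n)) \<and> (\<forall>n. continuous_on {0..<tanh (R/2)} (G n 0)) \<and>
     chain_energy k p N (tanh (R/2)) (G 0) < \<infinity> \<and>
     (\<exists>M\<ge>0. \<forall>n. chain_energy k p N (tanh (R/2)) (\<lambda>j s. G (Suc n) j s - G n j s) \<le> ennreal (M * 2 powr (- (real n * p)))) \<and>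
     (AE s in lborel. s \<in> {0<..<tanh (R/2)} \<longrightarrow> (\<lambda>n. G n 0 s) \<longlonglongrightarrow> v s) \<and>
     liminf (\<lambda>n. chain_energy k p N (tanh (R/2)) (G n)) \<le> E \<and>
     (AE x in lebesgue. x \<in> hball R \<longrightarrow> u x = v (norm x))"

text \<open>The rate 4^(-np) leaves a factor 2^(-np) to spare when the increments are later weighted
  by 2^(np) and summed; the rate 2^(-n) serves convergence almost everywhere.\<close>

lemma approxW_subsequence:
  fixes u :: "real^'n \<Rightarrow> real"
  assumes R: "R > 0" and p: "p \<ge> 1" and a: "approxW k p R \<phi> u"
  obtains \<sigma> where "strict_mono (\<sigma> :: nat \<Rightarrow> nat)"
    "\<And>n. energy k p R (\<lambda>x. \<phi> (\<sigma> (Suc n)) x - \<phi> (\<sigma> n) x) \<le> ennreal (4 powr (- (real n * p)))"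
    "\<And>n. Lp_dist p R (\<phi> (\<sigma> n)) u \<le> ennreal ((1/2) ^ n)"
proof -
  have sW: "smoothW k p R (\<phi> n)" for n using a by (simp add: approxW_def)
  obtain C1 where C1: "C1 \<ge> 0" "\<And>u::real^'n \<Rightarrow> real. smooth_on (hball R) u \<Longrightarrow> energy k p R u \<le> ennreal C1 * Wnorm_pow k p R u"
    using energy_le_Wnorm_pow[OF R, of p k] p by auto
  have "\<exists>M. \<forall>m\<ge>M. \<forall>m'\<ge>M. energy k p R (\<lambda>x. \<phi> m x - \<phi> m' x) \<le> ennreal d" if d: "d > 0" for d
  proof -
    \<comment> \<open>Chosen so that C1 e^p <= d; the summand 1 in the denominator covers C1 =
      0.\<close>
    define e where "e = (d / (C1 + 1)) powr (1/p)"
    have e: "e > 0" using d C1 by (simp add: e_def)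
    then obtain M where M: "\<And>m m'. m \<ge> M \<Longrightarrow> m' \<ge> M \<Longrightarrow> Wnorm k p R (\<lambda>x. \<phi> m x - \<phi> m' x) < e"
      using a unfolding approxW_def by blast
    show ?thesis
    proof (intro exI[of _ M] allI impI)
      fix m m' assume m: "m \<ge> M" "m' \<ge> M"
      let ?d = "\<lambda>x. \<phi> m x - \<phi> m' x"
      have sd: "smoothW k p R ?d" using smoothW_diff_finite[OF R _ sW sW] p by simp
      have "energy k p R ?d \<le> ennreal C1 * Wnorm_pow k p R ?d" using sd by (intro C1) (simp add: smoothW_def)
      also have "Wnorm_pow k p R ?d = ennreal (Wnorm k p R ?d powr p)"
        using sd p by (intro Wnorm_pow_eq) (auto simp: smoothW_def)
      also have "\<dots> \<le> ennreal (e powr p)"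
        using M[OF m] p by (intro ennreal_leI powr_mono2) (auto simp: Wnorm_def)
      also have "e powr p = d / (C1 + 1)" using p d C1 by (simp add: e_def powr_powr)
      also have "ennreal C1 * ennreal (d / (C1 + 1)) = ennreal (C1 * (d / (C1 + 1)))" by (subst ennreal_mult) (use C1(1) d in auto)
      also have "\<dots> \<le> ennreal d" using C1 d by (intro ennreal_leI) (simp add: field_simps)
      finally show "energy k p R ?d \<le> ennreal d" by (auto simp: mult_left_mono)
    qed
  qed
  then have "\<exists>M. \<forall>m\<ge>M. \<forall>m'\<ge>M. energy k p R (\<lambda>x. \<phi> m x - \<phi> m' x) \<le> ennreal (4 powr (- (real n * p)))" for n :: nat by simp
  then obtain M where M: "\<And>n m m'. m \<ge> M n \<Longrightarrow> m' \<ge> M n \<Longrightarrow> energy k p R (\<lambda>x. \<phi> m x - \<phi> m' x) \<le> ennreal (4 powr (- (real n * p)))"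
    by metis
  have "\<exists>L. \<forall>m\<ge>L. Lp_dist p R (\<phi> m) u \<le> ennreal ((1/2) ^ n)" for n :: nat
  proof -
    have "(\<lambda>n. Lp_dist p R (\<phi> n) u) \<longlonglongrightarrow> 0" using a by (simp add: approxW_def)
    then have "\<forall>\<^sub>F m in sequentially. Lp_dist p R (\<phi> m) u < ennreal ((1/2) ^ n)"
      by (rule order_tendstoD) simp
    then show ?thesis by (auto simp: eventually_sequentially intro: less_imp_le)
  qed
  then obtain L where L: "\<And>n m. m \<ge> L n \<Longrightarrow> Lp_dist p R (\<phi> m) u \<le> ennreal ((1/2) ^ n)" by metis
  \<comment> \<open>The partial sums lie above both thresholds at n, and the summand n makes the
    sequence strictly increasing.\<close>
  define \<sigma> where "\<sigma> n = n + (\<Sum>i\<le>n. M i + L i)" for n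
  have ge: "\<sigma> n \<ge> M n" "\<sigma> n \<ge> L n" for n
    using member_le_sum[of n "{..n}" "\<lambda>i. M i + L i"] by (auto simp: \<sigma>_def)
  have sm: "strict_mono \<sigma>" by (rule strict_monoI_Suc) (simp add: \<sigma>_def)
  have le: "\<sigma> n \<le> \<sigma> (Suc n)" for n using sm by (simp add: strict_mono_less_eq)
  show ?thesis
    by (rule that[OF sm M[OF order_trans[OF ge(1) le] ge(1)] L[OF ge(2)]])
qed

text \<open>Three properties hold for almost every direction: rapid decay of the increments, finite
  energy of the first member, and convergence to the profile of u. Among such directions
  \<open>exists_below_mean\<close> finds one whose liminf of energies is at most average. The
  constant precedes u, its approximants and the limit c of norms.\<close>

lemma radial_profile_exists:
  assumes R: "R > 0" and p: "p \<ge> 1" and k: "k \<ge> 1"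
  shows "\<exists>C\<ge>0. \<forall>\<phi> (u::real^'n \<Rightarrow> real) c. approxW k p R \<phi> u \<and> radial R u \<and> (\<lambda>n. Wnorm k p R (\<phi> n)) \<longlonglongrightarrow> c \<longrightarrow>
    (\<exists>G v. radial_profile k p (real CARD('n)) R u G v (ennreal (C * c powr p)))"
proof -
  let ?r = "tanh (R/2)"
  have p0: "p > 0" using p by simp
  obtain C1 where C1: "C1 \<ge> 0" "\<And>u::real^'n \<Rightarrow> real. smooth_on (hball R) u \<Longrightarrow> energy k p R u \<le> ennreal C1 * Wnorm_pow k p R u"
    using energy_le_Wnorm_pow[OF R p0, of k] by blast
  obtain S where S: "(\<integral>\<^sup>+\<omega>. kappa (\<omega>::real^'n) \<partial>lborel) = ennreal S" "S > 0"
    using kappa_integral[where 'n='n] by (cases "\<integral>\<^sup>+\<omega>. kappa (\<omega>::real^'n) \<partial>lborel") (auto simp: less_le)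
  \<comment> \<open>The mean over directions: log 2 comes from the polar formula, C1 from energy
    versus norm, and S is the total mass of \<open>kappa\<close>.\<close>
  define C where "C = ln 2 * C1 / S"
  have C: "C \<ge> 0" using C1 S by (simp add: C_def)
  show ?thesis
  proof (intro exI[of _ C] conjI allI impI C)
    fix \<phi> and u :: "real^'n \<Rightarrow> real" and c
    assume H: "approxW k p R \<phi> u \<and> radial R u \<and> (\<lambda>n. Wnorm k p R (\<phi> n)) \<longlonglongrightarrow> c"
    then have a: "approxW k p R \<phi> u" and rad: "radial R u" and lim: "(\<lambda>n. Wnorm k p R (\<phi> n)) \<longlonglongrightarrow> c" by auto
    obtain \<sigma> where \<sigma>: "strict_mono (\<sigma> :: nat \<Rightarrow> nat)"
      "\<And>n. energy k p R (\<lambda>x. \<phi> (\<sigma> (Suc n)) x - \<phi> (\<sigma> n) x) \<le> ennreal (4 powr (- (real n * p)))"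
      "\<And>n. Lp_dist p R (\<phi> (\<sigma> n)) u \<le> ennreal ((1/2) ^ n)"
      using approxW_subsequence[OF R p a] by blast
    define \<psi> where "\<psi> n = \<phi> (\<sigma> n)" for n
    have sW: "smoothW k p R (\<psi> n)" for n using a by (simp add: approxW_def \<psi>_def)
    then have s: "smooth_on (hball R) (\<psi> n)" for n by (simp add: smoothW_def)
    have sd: "smooth_on (hball R) (\<lambda>x. \<psi> (Suc n) x - \<psi> n x)" for n
      by (rule smooth_on_diff[OF open_hball[OF R] s s])
    define F where "F w x = indicator (hball R) x * ennreal (jet k w x powr p)" for w and x :: "real^'n"
    have Fm: "F w \<in> borel_measurable borel" if "smooth_on (hball R) w" for w
      unfolding F_def by (rule jet_powr_measurable[OF R p0 that])
    define I where "I w \<omega> = (\<integral>\<^sup>+s. indicator {0<..} s * ennreal (s ^ (CARD('n) - 1)) * F w ((s / norm \<omega>) *\<^sub>R \<omega>) \<partial>lborel)" for w and \<omega> :: "real^'n"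
    have Im: "I w \<in> borel_measurable borel" if "smooth_on (hball R) w" for w
    proof -
      note [measurable] = Fm[OF that]
      show ?thesis unfolding I_def by measurable
    qed
    have IE: "(\<integral>\<^sup>+\<omega>. kappa \<omega> * I w \<omega> \<partial>lborel) = ennreal (ln 2) * energy k p R w" if "smooth_on (hball R) w" for w
      using nn_integral_polar[OF Fm[OF that]] by (simp add: I_def kappa_def energy_def F_def)
    define d where "d n = (\<lambda>x. \<psi> (Suc n) x - \<psi> n x)" for n
    have sdn: "smooth_on (hball R) (d n)" for n using sd by (simp add: d_def)
    have dE: "energy k p R (d n) \<le> ennreal (4 powr (- (real n * p)))" for n using \<sigma>(2) by (simp add: d_def \<psi>_def)
    note [measurable] = Im[OF s] Im[OF sdn]
    \<comment> \<open>The increments have energy at most 4^(-np), so with the weights 2^(np) the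
      series is still geometric. On almost every ray the weighted series is finite, and each of its
      terms gives decay 2^(-np).\<close>
    have "(\<integral>\<^sup>+\<omega>. kappa \<omega> * (\<Sum>n. ennreal (2 powr (real n * p)) * I (d n) \<omega>) \<partial>lborel) < \<infinity>"
    proof -
      have "(\<integral>\<^sup>+\<omega>. kappa \<omega> * (\<Sum>n. ennreal (2 powr (real n * p)) * I (d n) \<omega>) \<partial>lborel)
        = (\<integral>\<^sup>+\<omega>. (\<Sum>n. ennreal (2 powr (real n * p)) * (kappa \<omega> * I (d n) \<omega>)) \<partial>lborel)"
        by (intro nn_integral_cong) (simp add: mult.left_commute flip: ennreal_suminf_cmult)
      also have "\<dots> = (\<Sum>n. ennreal (2 powr (real n * p)) * (ennreal (ln 2) * energy k p R (d n)))"
        by (subst nn_integral_suminf) (auto simp: nn_integral_cmult IE[OF sdn])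
      also have "\<dots> \<le> (\<Sum>n. ennreal (ln 2 * (2 powr - p) ^ n))"
      proof (intro suminf_le allI)
        fix n :: nat
        have "ennreal (2 powr (real n * p)) * (ennreal (ln 2) * energy k p R (d n)) \<le>
          ennreal (2 powr (real n * p)) * (ennreal (ln 2) * ennreal (4 powr (- (real n * p))))"
          by (intro mult_left_mono dE) auto
        also have "\<dots> = ennreal (2 powr (real n * p) * (ln 2 * 4 powr (- (real n * p))))" by (simp add: ennreal_mult)
        also have "2 powr (real n * p) * (ln 2 * 4 powr (- (real n * p))) = ln 2 * (2 powr - p) ^ n"
        proof -
          have "(4::real) powr (- (real n * p)) = (2 powr 2) powr (- (real n * p))" by simp
          also have "\<dots> = 2 powr (- 2 * (real n * p))" unfolding powr_powr by simp
          finally have "2 powr (real n * p) * 4 powr (- (real n * p)) = (2::real) powr (- p * real n)"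
            by (simp add: algebra_simps flip: powr_add)
          also have "\<dots> = (2 powr - p) ^ n" by (subst powr_realpow[symmetric]) (auto simp: powr_powr)
          finally show ?thesis by simp
        qed
        finally show "ennreal (2 powr (real n * p)) * (ennreal (ln 2) * energy k p R (d n)) \<le> ennreal (ln 2 * (2 powr - p) ^ n)" .
      qed auto
      also have "\<dots> < \<infinity>"
      proof -
        have "(2::real) powr - p < 1" using p by (simp add: powr_less_one)
        then have "summable (\<lambda>n. ln 2 * ((2::real) powr - p) ^ n)" by (intro summable_mult summable_geometric) auto
        then show ?thesis by (subst suminf_ennreal2) auto
      qed
      finally show ?thesis .
    qed
    then have AE1: "AE \<omega> in lborel. kappa \<omega> * (\<Sum>n. ennreal (2 powr (real n * p)) * I (d n) \<omega>) \<noteq> \<infinity>"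
      by (intro nn_integral_noteq_infinite) auto
    have "energy k p R (\<psi> 0) < \<infinity>"
      using C1(2)[OF s[of 0]] sW[of 0] by (auto simp: smoothW_def ennreal_mult_less_top elim!: order_le_less_trans)
    then have AE2: "AE \<omega> in lborel. kappa \<omega> * I (\<psi> 0) \<omega> \<noteq> \<infinity>"
      by (intro nn_integral_noteq_infinite) (auto simp: IE[OF s] ennreal_mult_eq_top_iff)
    have um: "set_borel_measurable lebesgue (hball R) u" using a by (simp add: approxW_def)
    have conv: "AE x in lborel. x \<in> hball R \<longrightarrow> (\<lambda>n. \<psi> n x) \<longlonglongrightarrow> u x"
      using \<sigma>(3) by (intro Lp_summable_AE[OF R p s um]) (simp add: \<psi>_def)
    obtain v0 where v0: "AE x in lebesgue. x \<in> hball R \<longrightarrow> u x = v0 (hdist0 x)" using rad by (auto simp: radial_def)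
    define v where "v s = v0 (ln ((1 + s) / (1 - s)))" for s :: real
    have uv: "AE x in lebesgue. x \<in> hball R \<longrightarrow> u x = v (norm x)" using v0 by (simp add: v_def hdist0_def)
    then have "AE x in lborel. x \<in> hball R \<longrightarrow> u x = v (norm x)" by (simp add: AE_completion_iff)
    with conv have "AE x in lborel. x \<in> hball R \<longrightarrow> (\<lambda>n. \<psi> n x) \<longlonglongrightarrow> v (norm x)" by eventually_elim auto
    \<comment> \<open>Radiality enters here: the limit on each ray is the same function v of the
      distance.\<close>
    from AE_polar[OF this] have AE3: "AE \<omega> in lborel. \<omega> \<in> shell \<longrightarrow>
       (AE s in lborel. s > 0 \<longrightarrow> (s / norm \<omega>) *\<^sub>R \<omega> \<in> hball R \<longrightarrow> (\<lambda>n. \<psi> n ((s / norm \<omega>) *\<^sub>R \<omega>)) \<longlonglongrightarrow> v (norm ((s / norm \<omega>) *\<^sub>R \<omega>)))" .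
    \<comment> \<open>Fatou in the direction variable, followed by the polar formula and the limit
      of the norms along the subsequence.\<close>
    have mean: "(\<integral>\<^sup>+\<omega>. kappa \<omega> * liminf (\<lambda>n. I (\<psi> n) \<omega>) \<partial>lborel) \<le> ennreal (C * c powr p) * (\<integral>\<^sup>+\<omega>. kappa (\<omega>::real^'n) \<partial>lborel)"
    proof -
      have "kappa \<omega> * liminf (\<lambda>n. I (\<psi> n) \<omega>) \<le> liminf (\<lambda>n. kappa \<omega> * I (\<psi> n) \<omega>)" for \<omega> :: "real^'n"
      proof -
        have "kappa \<omega> < \<infinity>" by (simp add: kappa_def indicator_def ennreal_mult_less_top)
        then have "liminf (\<lambda>n. kappa \<omega> * I (\<psi> n) \<omega>) = kappa \<omega> * liminf (\<lambda>n. I (\<psi> n) \<omega>)"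
          by (rule liminf_cmult_ennreal)
        then show ?thesis by simp
      qed
      then have "(\<integral>\<^sup>+\<omega>. kappa \<omega> * liminf (\<lambda>n. I (\<psi> n) \<omega>) \<partial>lborel) \<le> (\<integral>\<^sup>+\<omega>. liminf (\<lambda>n. kappa \<omega> * I (\<psi> n) \<omega>) \<partial>lborel)"
        by (intro nn_integral_mono) auto
      also have "\<dots> \<le> liminf (\<lambda>n. \<integral>\<^sup>+\<omega>. kappa \<omega> * I (\<psi> n) \<omega> \<partial>lborel)"
        by (rule nn_integral_liminf) measurable
      also have "\<dots> \<le> liminf (\<lambda>n. ennreal (ln 2 * (C1 * Wnorm k p R (\<psi> n) powr p)))"
      proof (intro Liminf_mono always_eventually allI)
        fix n
        have "energy k p R (\<psi> n) \<le> ennreal (C1 * Wnorm k p R (\<psi> n) powr p)"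
          using C1(2)[OF s[of n]] Wnorm_pow_eq[of k p R "\<psi> n"] sW[of n] p0 C1(1) by (simp add: smoothW_def ennreal_mult)
        then show "(\<integral>\<^sup>+\<omega>. kappa \<omega> * I (\<psi> n) \<omega> \<partial>lborel) \<le> ennreal (ln 2 * (C1 * Wnorm k p R (\<psi> n) powr p))"
          unfolding IE[OF s] using C1(1) by (simp add: ennreal_mult mult_left_mono)
      qed
      also have "\<dots> = ennreal (ln 2 * (C1 * c powr p))"
      proof (rule lim_imp_Liminf)
        have "(\<lambda>n. Wnorm k p R (\<psi> n)) \<longlonglongrightarrow> c"
          unfolding \<psi>_def using LIMSEQ_subseq_LIMSEQ[OF lim \<sigma>(1)] by (simp add: o_def)
        then have "(\<lambda>n. Wnorm k p R (\<psi> n) powr p) \<longlonglongrightarrow> c powr p"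
          using p0 by (intro tendsto_powr'[OF _ tendsto_const]) (auto simp: Wnorm_def)
        then show "(\<lambda>n. ennreal (ln 2 * (C1 * Wnorm k p R (\<psi> n) powr p))) \<longlonglongrightarrow> ennreal (ln 2 * (C1 * c powr p))"
          by (intro tendsto_ennrealI tendsto_mult tendsto_const)
      qed simp
      also have "\<dots> = ennreal (C * c powr p) * (\<integral>\<^sup>+\<omega>. kappa (\<omega>::real^'n) \<partial>lborel)"
        unfolding S(1) by (subst ennreal_mult[symmetric]) (use S(2) C C1(1) in \<open>auto simp: C_def\<close>)
      finally show ?thesis .
    qed
    have good: "AE \<omega> in lborel. \<omega> \<in> shell \<longrightarrow> kappa \<omega> * (\<Sum>n. ennreal (2 powr (real n * p)) * I (d n) \<omega>) \<noteq> \<infinity> \<and>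
        kappa \<omega> * I (\<psi> 0) \<omega> \<noteq> \<infinity> \<and> (AE s in lborel. s > 0 \<longrightarrow> (s / norm \<omega>) *\<^sub>R \<omega> \<in> hball R \<longrightarrow>
        (\<lambda>n. \<psi> n ((s / norm \<omega>) *\<^sub>R \<omega>)) \<longlonglongrightarrow> v (norm ((s / norm \<omega>) *\<^sub>R \<omega>)))"
      using AE1 AE2 AE3 by eventually_elim blast
    have "\<exists>\<omega>\<in>shell. (kappa \<omega> * (\<Sum>n. ennreal (2 powr (real n * p)) * I (d n) \<omega>) \<noteq> \<infinity> \<and>
        kappa \<omega> * I (\<psi> 0) \<omega> \<noteq> \<infinity> \<and> (AE s in lborel. s > 0 \<longrightarrow> (s / norm \<omega>) *\<^sub>R \<omega> \<in> hball R \<longrightarrow>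
        (\<lambda>n. \<psi> n ((s / norm \<omega>) *\<^sub>R \<omega>)) \<longlonglongrightarrow> v (norm ((s / norm \<omega>) *\<^sub>R \<omega>)))) \<and> liminf (\<lambda>n. I (\<psi> n) \<omega>) \<le> ennreal (C * c powr p)"
      by (rule exists_below_mean[OF _ mean _ good]) simp_all
    then obtain \<omega> where \<omega>: "\<omega> \<in> shell" and fin1: "kappa \<omega> * (\<Sum>n. ennreal (2 powr (real n * p)) * I (d n) \<omega>) \<noteq> \<infinity>"
      and fin2: "kappa \<omega> * I (\<psi> 0) \<omega> \<noteq> \<infinity>"
      and cv: "AE s in lborel. s > 0 \<longrightarrow> (s / norm \<omega>) *\<^sub>R \<omega> \<in> hball R \<longrightarrow>
        (\<lambda>n. \<psi> n ((s / norm \<omega>) *\<^sub>R \<omega>)) \<longlonglongrightarrow> v (norm ((s / norm \<omega>) *\<^sub>R \<omega>))"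
      and li: "liminf (\<lambda>n. I (\<psi> n) \<omega>) \<le> ennreal (C * c powr p)" by blast
    define w where "w = (1 / norm \<omega>) *\<^sub>R \<omega>"
    have nw: "norm w = 1" using shell_norm_pos[OF \<omega>] by (simp add: w_def)
    have sw: "(s / norm \<omega>) *\<^sub>R \<omega> = s *\<^sub>R w" for s by (simp add: w_def)
    have inb: "s *\<^sub>R w \<in> hball R" if "s \<in> {0..<?r}" for s using that nw R by (simp add: hball_eq_ball)
    define G where "G n = ray_chain (\<psi> n) w" for n
    have sb: "smooth_on (ball 0 ?r) (\<psi> n)" for n using s[of n] R by (simp add: hball_eq_ball)
    have GE: "chain_energy k p (real CARD('n)) ?r (G n) \<le> I (\<psi> n) \<omega>" for n
      unfolding I_def sw F_def by (rule ray_chain_energy_le[OF R nw p]) (simp add: G_def)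
    have dE2: "chain_energy k p (real CARD('n)) ?r (\<lambda>j s. G (Suc n) j s - G n j s) \<le> I (d n) \<omega>" for n
      unfolding I_def sw F_def
    proof (rule ray_chain_energy_le[OF R nw p])
      fix j s assume "s \<in> {0<..<?r}"
      then have "s *\<^sub>R w \<in> hball R" by (intro inb) auto
      then show "G (Suc n) j s - G n j s = ray_chain (d n) w j s"
        unfolding G_def d_def by (rule ray_chain_diff[OF open_hball[OF R] s s, symmetric])
    qed
    have "(\<Sum>n. ennreal (2 powr (real n * p)) * I (d n) \<omega>) \<noteq> \<infinity>"
      using fin1 kappa_pos[OF \<omega>] by (auto simp: ennreal_mult_eq_top_iff)
    then obtain M where M: "(\<Sum>n. ennreal (2 powr (real n * p)) * I (d n) \<omega>) = ennreal M" "M \<ge> 0"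
      by (cases "\<Sum>n. ennreal (2 powr (real n * p)) * I (d n) \<omega>") auto
    have IM: "I (d n) \<omega> \<le> ennreal (M * 2 powr (- (real n * p)))" for n
    proof -
      have "ennreal (2 powr (real n * p)) * I (d n) \<omega> \<le> ennreal M"
        unfolding M(1)[symmetric] using sum_le_suminf[of "\<lambda>n. ennreal (2 powr (real n * p)) * I (d n) \<omega>" "{n}"] by simp
      then have "ennreal (2 powr (- (real n * p))) * (ennreal (2 powr (real n * p)) * I (d n) \<omega>) \<le> ennreal (2 powr (- (real n * p))) * ennreal M"
        by (intro mult_left_mono) auto
      moreover have "ennreal (2 powr (- (real n * p))) * ennreal (2 powr (real n * p)) = 1"
        by (simp flip: ennreal_mult powr_add)
      ultimately have "I (d n) \<omega> \<le> ennreal (2 powr (- (real n * p))) * ennreal M"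
        by (simp only: mult.assoc[symmetric] mult_1_left)
      also have "\<dots> = ennreal (2 powr (- (real n * p)) * M)"
        by (rule ennreal_mult[symmetric]) (use M(2) in auto)
      finally show ?thesis by (simp only: mult.commute)
    qed
    have "radial_profile k p (real CARD('n)) R u G v (ennreal (C * c powr p))"
      unfolding radial_profile_def
    proof (intro conjI allI)
      show "chain k ?r (G n)" for n unfolding G_def by (rule chain_ray_chain[OF sb nw])
      show "continuous_on {0..<?r} (G n 0)" for n
        unfolding G_def by (rule ray_chain_continuous_on[OF s]) (rule inb)
      have "I (\<psi> 0) \<omega> < \<infinity>" using fin2 kappa_pos[OF \<omega>] by (auto simp: ennreal_mult_eq_top_iff less_top)
      then show "chain_energy k p (real CARD('n)) ?r (G 0) < \<infinity>" using GE[of 0] by (rule order_le_less_trans[rotated])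
      show "\<exists>M\<ge>0. \<forall>n. chain_energy k p (real CARD('n)) ?r (\<lambda>j s. G (Suc n) j s - G n j s) \<le> ennreal (M * 2 powr (- (real n * p)))"
        using M(2) order_trans[OF dE2 IM] by blast
      show "AE s in lborel. s \<in> {0<..<?r} \<longrightarrow> (\<lambda>n. G n 0 s) \<longlonglongrightarrow> v s"
        using cv
      proof eventually_elim
        case (elim s)
        have "G n 0 s = \<psi> n (s *\<^sub>R w)" for n by (simp add: G_def ray_chain_def)
        then show ?case using elim inb[of s] nw by (auto simp: sw)
      qed
      show "liminf (\<lambda>n. chain_energy k p (real CARD('n)) ?r (G n)) \<le> ennreal (C * c powr p)"
        by (rule order_trans[OF Liminf_mono li]) (auto intro!: always_eventually GE)
      show "AE x in lebesgue. x \<in> hball R \<longrightarrow> u x = v (norm x)" by (rule uv)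
    qed
    then show "\<exists>G v. radial_profile k p (real CARD('n)) R u G v (ennreal (C * c powr p))" by blast
  qed
qed

lemma approxW_subseq:
  assumes "approxW k p R \<phi> u" "\<And>n. \<sigma> n \<ge> (n::nat)"
  shows "approxW k p R (\<lambda>n. \<phi> (\<sigma> n)) u"
proof -
  have f: "filterlim \<sigma> sequentially sequentially"
    using assms(2) by (intro filterlim_at_top_mono[OF filterlim_ident]) auto
  have "(\<lambda>n. Lp_dist p R (\<phi> (\<sigma> n)) u) \<longlonglongrightarrow> 0"
    using assms(1) filterlim_compose[OF _ f] by (auto simp: approxW_def)
  moreover have "\<exists>M. \<forall>m\<ge>M. \<forall>n\<ge>M. Wnorm k p R (\<lambda>x. \<phi> (\<sigma> m) x - \<phi> (\<sigma> n) x) < e" if e: "e > 0" for e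
  proof -
    obtain M where "\<And>m n. m \<ge> M \<Longrightarrow> n \<ge> M \<Longrightarrow> Wnorm k p R (\<lambda>x. \<phi> m x - \<phi> n x) < e"
      using assms(1) e unfolding approxW_def by blast
    then show ?thesis using assms(2) order_trans by blast
  qed
  ultimately show ?thesis using assms(1) by (simp add: approxW_def)
qed

text \<open>
  \<open>Wnormc\<close> picks an arbitrary limit of norms, so only the existence of such a limit is needed, not its
  independence of the approximating sequence. Boundedness suffices, since a subsequence still approximates u.
\<close>

lemma Wnormc_limit:
  fixes u :: "real^'n \<Rightarrow> real"
  assumes R: "R > 0" and p: "p \<ge> 1" and W: "Wrad k p R u"
  obtains \<phi> where "approxW k p R \<phi> u" "(\<lambda>n. Wnorm k p R (\<phi> n)) \<longlonglongrightarrow> Wnormc k p R u"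
proof -
  have p0: "p > 0" using p by simp
  obtain \<phi> where a: "approxW k p R \<phi> u" using W by (auto simp: Wrad_def)
  have sW: "smoothW k p R (\<phi> n)" for n using a by (simp add: approxW_def)
  then have s: "smooth_on (hball R) (\<phi> n)" for n by (simp add: smoothW_def)
  obtain C1 where C1: "C1 \<ge> 0" "\<And>u::real^'n \<Rightarrow> real. smooth_on (hball R) u \<Longrightarrow> energy k p R u \<le> ennreal C1 * Wnorm_pow k p R u"
    using energy_le_Wnorm_pow[OF R p0, of k] by blast
  obtain C2 where C2: "C2 \<ge> 0" "\<And>u::real^'n \<Rightarrow> real. smooth_on (hball R) u \<Longrightarrow> Wnorm_pow k p R u \<le> ennreal C2 * energy k p R u"
    using Wnorm_pow_le_energy[OF R p0, of k] by blast
  obtain M where M: "\<And>m n. m \<ge> M \<Longrightarrow> n \<ge> M \<Longrightarrow> Wnorm k p R (\<lambda>x. \<phi> m x - \<phi> n x) < 1"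
    using a unfolding approxW_def by (metis zero_less_one)
  define B where "B = ennreal C2 * (ennreal (2 powr p) * (ennreal C1 + energy k p R (\<phi> M)))"
  have "energy k p R (\<phi> M) < \<infinity>"
    using C1(2)[OF s[of M]] sW[of M] by (auto simp: smoothW_def ennreal_mult_less_top elim!: order_le_less_trans)
  then have Bfin: "B < \<infinity>" by (simp add: B_def ennreal_mult_less_top)
  have WB: "Wnorm_pow k p R (\<phi> n) \<le> B" if n: "n \<ge> M" for n
  proof -
    let ?d = "\<lambda>x. \<phi> n x - \<phi> M x"
    have sd: "smoothW k p R ?d" by (rule smoothW_diff_finite[OF R p0 sW sW])
    have "Wnorm k p R ?d powr p \<le> 1 powr p" using M[OF n order_refl] p0 by (intro powr_mono2) (auto simp: Wnorm_def)
    then have "Wnorm_pow k p R ?d \<le> 1" using Wnorm_pow_eq[of k p R ?d] sd p0 by (auto simp: smoothW_def)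
    then have "ennreal C1 * Wnorm_pow k p R ?d \<le> ennreal C1 * 1" by (intro mult_left_mono) auto
    then have "energy k p R ?d \<le> ennreal C1" using C1(2)[of ?d] sd by (auto simp: smoothW_def intro: order_trans)
    then have "energy k p R (\<phi> n) \<le> ennreal (2 powr p) * (ennreal C1 + energy k p R (\<phi> M))"
      by (intro order_trans[OF energy_triangle(1)[OF R p0 s[of n] s[of M]]] mult_left_mono add_right_mono) auto
    then show ?thesis unfolding B_def by (intro order_trans[OF C2(2)[OF s]] mult_left_mono) auto
  qed
  define X where "X n = Wnorm k p R (\<phi> (n + M))" for n
  have "bounded (range X)"
  proof (rule boundedI[of _ "enn2real B powr (1/p)"])
    fix y assume "y \<in> range X"
    then obtain n where y: "y = X n" by auto
    have "enn2real (Wnorm_pow k p R (\<phi> (n + M))) \<le> enn2real B"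
      using WB[of "n + M"] Bfin by (intro enn2real_mono) auto
    then show "norm y \<le> enn2real B powr (1/p)" using p0 by (simp add: y X_def Wnorm_def powr_mono2)
  qed
  then obtain l \<rho> where \<rho>: "strict_mono \<rho>" "(X \<circ> \<rho>) \<longlonglongrightarrow> l" using bounded_imp_convergent_subsequence by blast
  have "approxW k p R (\<lambda>n. \<phi> (\<rho> n + M)) u"
    using seq_suble[OF \<rho>(1)] by (intro approxW_subseq[OF a]) (auto intro: trans_le_add1)
  moreover have "(\<lambda>n. Wnorm k p R (\<phi> (\<rho> n + M))) \<longlonglongrightarrow> l" using \<rho>(2) by (simp add: X_def o_def)
  ultimately have "\<exists>c \<phi>. approxW k p R \<phi> u \<and> (\<lambda>n. Wnorm k p R (\<phi> n)) \<longlonglongrightarrow> c" by blast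
  then have "\<exists>\<phi>. approxW k p R \<phi> u \<and> (\<lambda>n. Wnorm k p R (\<phi> n)) \<longlonglongrightarrow> Wnormc k p R u"
    unfolding Wnormc_def by (rule someI_ex)
  then show ?thesis using that by blast
qed

text \<open>In the polar formula the indicator of a null set of radii has radial integral 0 in every
  direction of the shell.\<close>

lemma AE_norm:
  assumes "AE s in lborel. Q s"
  shows "AE x in lborel. Q (norm (x::real^'n))"
proof -
  obtain Z where Z: "Z \<in> null_sets lborel" "{s. \<not> Q s} \<subseteq> Z" using assms by (auto simp: eventually_ae_filter)
  have [measurable]: "Z \<in> sets borel" using Z by auto
  define f where "f x = (indicator Z (norm x) :: ennreal)" for x :: "real^'n"
  have fm: "f \<in> borel_measurable borel" unfolding f_def by measurable
  have z: "indicator shell \<omega> * ennreal (1 / norm \<omega> ^ CARD('n)) *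
      (\<integral>\<^sup>+s. indicator {0<..} s * ennreal (s ^ (CARD('n) - 1)) * f ((s / norm \<omega>) *\<^sub>R \<omega>) \<partial>lborel) = 0" for \<omega> :: "real^'n"
  proof (cases "\<omega> \<in> shell")
    case True
    have "(\<integral>\<^sup>+s. indicator {0<..} s * ennreal (s ^ (CARD('n) - 1)) * f ((s / norm \<omega>) *\<^sub>R \<omega>) \<partial>lborel)
      = (\<integral>\<^sup>+s. 0 \<partial>(lborel :: real measure))"
    proof (rule nn_integral_cong_AE)
      have "AE s in lborel. s \<notin> Z" by (rule AE_not_in[OF Z(1)])
      then show "AE s in lborel. indicator {0<..} s * ennreal (s ^ (CARD('n) - 1)) * f ((s / norm \<omega>) *\<^sub>R \<omega>) = 0"
        by eventually_elim (use shell_norm_pos[OF True] in \<open>auto simp: f_def indicator_def\<close>)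
    qed
    then show ?thesis by simp
  qed simp
  have "ennreal (ln 2) * (\<integral>\<^sup>+x. f x \<partial>lborel) = 0" unfolding nn_integral_polar[OF fm] z by simp
  then have "(\<integral>\<^sup>+x. f x \<partial>lborel) = 0" by (simp add: ennreal_eq_0_iff)
  then have "AE x in lborel. f x = 0" using fm by (subst (asm) nn_integral_0_iff_AE) auto
  then show ?thesis by eventually_elim (use Z in \<open>auto simp: f_def indicator_def split: if_splits\<close>)
qed

lemma le_liminf_bound:
  fixes f :: "nat \<Rightarrow> ennreal"
  assumes "X \<longlonglongrightarrow> x" "\<And>n. X n \<le> A + ennreal C * f n" "liminf f \<le> E"
  shows "x \<le> A + ennreal C * E"
proof -
  have "x = liminf X" using assms(1) by (simp add: lim_imp_Liminf)
  also have "\<dots> \<le> liminf (\<lambda>n. A + ennreal C * f n)" by (intro Liminf_mono always_eventually allI assms)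
  also have "\<dots> = A + liminf (\<lambda>n. ennreal C * f n)"
    by (rule Liminf_compose_continuous_mono[of "\<lambda>x. A + x"], intro continuous_on_add_ennreal continuous_on_const continuous_on_id) (auto simp: mono_def add_left_mono)
  also have "\<dots> \<le> A + ennreal C * E" by (subst liminf_cmult_ennreal) (auto intro!: add_left_mono mult_left_mono assms)
  finally show ?thesis .
qed

text \<open>On the chosen ray the approximants tend to v almost everywhere and to \<open>W 0\<close>
  everywhere, so v and \<open>W 0\<close> agree for almost every radius; \<open>AE_norm\<close>
  carries this, and the differentiability of the last derivative, to almost every point of the
  ball.\<close>

lemma profile_limit:
  fixes u :: "real^'n \<Rightarrow> real"
  assumes R: "R > 0" and p: "p \<ge> 1" and k: "k \<ge> 1" and N: "N \<ge> 1" and P: "radial_profile k p N R u G v E"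
  shows "\<exists>W. (\<forall>j s. j < k \<and> s \<in> {0<..<tanh (R/2)} \<longrightarrow> (\<lambda>n. G n j s) \<longlonglongrightarrow> W j s) \<and>
    (\<forall>j s. Suc j < k \<and> s \<in> {0<..<tanh (R/2)} \<longrightarrow> (W j has_real_derivative W (Suc j) s) (at s)) \<and>
    (\<forall>j<k. continuous_on {0<..tanh (R/2)} (W j)) \<and>
    (AE x in lebesgue. norm (x::real^'n) \<in> {0<..<tanh (R/2)} \<longrightarrow> W (k - 1) differentiable (at (norm x))) \<and>
    (AE x in lebesgue. x \<in> hball R \<longrightarrow> u x = W 0 (norm x))"
proof -
  let ?r = "tanh (R/2)"
  have r: "?r > 0" using R by simp
  have ch: "\<And>n. chain k ?r (G n)" and G0: "chain_energy k p N ?r (G 0) < \<infinity>"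
    and M: "\<exists>M\<ge>0. \<forall>n. chain_energy k p N ?r (\<lambda>j s. G (Suc n) j s - G n j s) \<le> ennreal (M * 2 powr (- (real n * p)))"
    and cv: "AE s in lborel. s \<in> {0<..<?r} \<longrightarrow> (\<lambda>n. G n 0 s) \<longlonglongrightarrow> v s"
    and uv: "AE x in lebesgue. x \<in> hball R \<longrightarrow> u x = v (norm x)"
    using P by (auto simp: radial_profile_def)
  obtain M where M: "\<And>n. chain_energy k p N ?r (\<lambda>j s. G (Suc n) j s - G n j s) \<le> ennreal (M * 2 powr (- (real n * p)))" "M \<ge> 0"
    using M by blast
  obtain W where W: "\<And>j s. j < k \<Longrightarrow> s \<in> {0<..<?r} \<Longrightarrow> (\<lambda>n. G n j s) \<longlonglongrightarrow> W j s"
    "\<And>j s. Suc j < k \<Longrightarrow> s \<in> {0<..<?r} \<Longrightarrow> (W j has_real_derivative W (Suc j) s) (at s)"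
    "\<And>j. j < k \<Longrightarrow> continuous_on {0<..?r} (W j)"
    "\<exists>Z. negligible Z \<and> (\<forall>s\<in>{0<..<?r} - Z. W (k - 1) differentiable (at s))"
    using chain_limit[OF r p k N ch G0 M] by blast
  show ?thesis
  proof (intro exI[of _ W] conjI allI impI)
    obtain Z where Z: "negligible Z" "\<And>s. s \<in> {0<..<?r} - Z \<Longrightarrow> W (k - 1) differentiable (at s)" using W(4) by blast
    have "AE s in lebesgue. s \<notin> Z" using Z(1) by (intro AE_not_in) (simp add: negligible_iff_null_sets)
    then have "AE s in lborel. s \<notin> Z" by (simp add: AE_completion_iff)
    from AE_norm[OF this] have "AE x in lborel. norm (x::real^'n) \<notin> Z" .
    then have "AE x in lborel. norm (x::real^'n) \<in> {0<..<?r} \<longrightarrow> W (k - 1) differentiable (at (norm x))"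
      by eventually_elim (use Z(2) in auto)
    then show "AE x in lebesgue. norm (x::real^'n) \<in> {0<..<?r} \<longrightarrow> W (k - 1) differentiable (at (norm x))"
      by (simp only: AE_completion_iff)
    have "AE s in lborel. s \<in> {0<..<?r} \<longrightarrow> v s = W 0 s"
      using cv by eventually_elim (use W(1)[of 0] k in \<open>auto intro: LIMSEQ_unique\<close>)
    from AE_norm[OF this] have "AE x in lborel. norm (x::real^'n) \<in> {0<..<?r} \<longrightarrow> v (norm x) = W 0 (norm x)" .
    moreover have "AE x in lborel. x \<noteq> (0::real^'n)" by (rule AE_lborel_singleton)
    moreover have "AE x in lborel. x \<in> hball R \<longrightarrow> u x = v (norm x)" using uv by (simp only: AE_completion_iff)
    ultimately have "AE x in lborel. x \<in> hball R \<longrightarrow> u x = W 0 (norm x)"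
      by eventually_elim (use R in \<open>auto simp: hball_eq_ball\<close>)
    then show "AE x in lebesgue. x \<in> hball R \<longrightarrow> u x = W 0 (norm x)" by (simp only: AE_completion_iff)
  qed (use W in auto)
qed

section \<open>Regularity of the profile\<close>

text \<open>A pointwise form of \<open>rep_deriv\<close> that asks for mere existence. It serves the
  derivatives of order k, where \<open>W (k - 1)\<close> is differentiable at almost every radius
  but no formula for its derivative is at hand.\<close>

lemma rep_differentiable:
  assumes "rep b ok T" "pd_closed S b" "x \<in> S" "\<And>\<iota>. ok \<iota> \<Longrightarrow> \<exists>d. has_pd i (B \<iota>) x d"
  shows "\<exists>d. has_pd i (T B) x d"
  using assms(1)
proof induction
  case rep_zero
  show ?case using has_pd_const[of i 0 x] by blast
next
  case (rep_term P \<iota>)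
  obtain P' where "has_pd i P x (P' x)" using alg_has_pd[OF rep_term(1) assms(2), of i] assms(3) by blast
  moreover obtain d where "has_pd i (B \<iota>) x d" using assms(4)[OF rep_term(2)] by blast
  ultimately show ?case using has_pd_mult by blast
next
  case (rep_add T T')
  then show ?case using has_pd_add by blast
qed

text \<open>The chain rule gives d/dx_i of W_j(|x|) as (x_i/|x|) W_(j+1)(|x|), so the coefficients
  remain polynomial in the coordinates and 1/|x|. Continuity of the operator then extends the
  derivatives to the outer sphere.\<close>

lemma radial_pdl:
  fixes W :: "nat \<Rightarrow> real \<Rightarrow> real" and "is" :: "'n::finite list"
  assumes W: "\<And>j s. Suc j < k \<Longrightarrow> s \<in> {0<..<r} \<Longrightarrow> (W j has_real_derivative W (Suc j) s) (at s)"
    and len: "length is < k"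
  shows "\<exists>T. rep (\<lambda>x. inverse (norm x)) (\<lambda>j. j \<le> length is) T \<and>
    (\<forall>x\<in>ball 0 r - {0}. pdl_ex is (\<lambda>x. W 0 (norm x)) x \<and> pdl is (\<lambda>x. W 0 (norm x)) x = T (\<lambda>j x. W j (norm x)) x)"
  using len
proof (induction "is")
  case Nil
  show ?case by (rule exI[of _ "\<lambda>B x. B 0 x"]) (auto intro: rep_single)
next
  case (Cons i "is")
  let ?U = "\<lambda>x::real^'n. W 0 (norm x)"
  let ?B = "\<lambda>j (x::real^'n). W j (norm x)"
  let ?b = "\<lambda>x::real^'n. inverse (norm x)"
  obtain T where T: "rep ?b (\<lambda>j. j \<le> length is) T"
    "\<And>x. x \<in> ball 0 r - {0} \<Longrightarrow> pdl_ex is ?U x \<and> pdl is ?U x = T ?B x"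
    using Cons by auto
  define D where "D j B x = (x $ i * ?b x) * B (Suc j) x" for j B x
  have ok: "j \<le> length is \<Longrightarrow> j \<le> length (i # is)" for j by simp
  have Drep: "rep ?b (\<lambda>j. j \<le> length (i # is)) (D j)" if "j \<le> length is" for j
    unfolding D_def using that by (intro rep_term alg_mult alg_coord alg_base) auto
  obtain T' where T': "rep ?b (\<lambda>j. j \<le> length (i # is)) T'"
    "\<And>B x. x \<in> - {0} \<Longrightarrow> (\<forall>j. j \<le> length is \<longrightarrow> has_pd i (B j) x (D j B x)) \<Longrightarrow> has_pd i (T B) x (T' B x)"
    using rep_deriv[where i=i and D=D, OF T(1) pd_closed_inverse_norm ok Drep] by blast
  have op: "open (ball (0::real^'n) r - {0})" by (intro open_Diff) auto
  show ?case
  proof (intro exI[of _ T'] conjI ballI T'(1))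
    fix x assume x: "x \<in> ball 0 r - {0::real^'n}"
    have "has_pd i (?B j) x (D j ?B x)" if "j \<le> length is" for j
    proof -
      have "(W j has_real_derivative W (Suc j) (norm x)) (at (norm x))"
        using x that Cons.prems by (intro W) auto
      from has_pd_chain[OF has_pd_norm this] x show ?thesis by (simp add: D_def divide_inverse mult_ac)
    qed
    then have "has_pd i (T ?B) x (T' ?B x)" using x by (intro T'(2)) auto
    from has_pd_cong[OF op x _ this] have pd: "has_pd i (pdl is ?U) x (T' ?B x)" using T(2) by simp
    then show "pdl (i # is) ?U x = T' ?B x" by (simp add: has_pd_imp_pdv)
    have "\<forall>\<^sub>F t in nhds 0. pdl_ex is ?U (x + t *\<^sub>R axis i 1)"
      using has_pd_eventually_line[OF op x] by eventually_elim (use T(2) in auto)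
    then show "pdl_ex (i # is) ?U x" using pd by (auto simp: has_pd_def real_differentiable_def)
  qed
qed

lemma radial_Ck_representative:
  fixes u :: "real^'n \<Rightarrow> real"
  assumes R: "R > 0" and p: "p \<ge> 1" and k: "k \<ge> 1" and u: "Wrad k p R u"
  shows "\<exists>U. Ck_on (k - 1) (closure (hball R) - {0}) U \<and>
            (AE x in lebesgue. x \<in> hball R \<longrightarrow> u x = U x) \<and>
            (AE x in lebesgue. x \<in> hball R - {0} \<longrightarrow> (\<forall>is. length is = k \<longrightarrow> pdl_ex is U x))"
proof -
  let ?r = "tanh (R/2)"
  let ?b = "\<lambda>x::real^'n. inverse (norm x)"
  have N: "real CARD('n) \<ge> 1" by (simp add: Suc_leI)
  obtain \<phi> where \<phi>: "approxW k p R \<phi> u" "(\<lambda>n. Wnorm k p R (\<phi> n)) \<longlonglongrightarrow> Wnormc k p R u"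
    using Wnormc_limit[OF R p u] by blast
  have rad: "radial R u" using u by (simp add: Wrad_def)
  obtain C where C: "\<forall>\<phi> (u::real^'n \<Rightarrow> real) c. approxW k p R \<phi> u \<and> radial R u \<and> (\<lambda>n. Wnorm k p R (\<phi> n)) \<longlonglongrightarrow> c \<longrightarrow>
    (\<exists>G v. radial_profile k p (real CARD('n)) R u G v (ennreal (C * c powr p)))"
    using radial_profile_exists[OF R p k, where 'n='n] by (elim exE conjE)
  obtain G v E where P: "radial_profile k p (real CARD('n)) R u G v E"
    using C[rule_format, OF conjI[OF \<phi>(1) conjI[OF rad \<phi>(2)]]] by (elim exE)
  from profile_limit[OF R p k N P] obtain W where
    W1: "\<forall>j s. Suc j < k \<and> s \<in> {0<..<?r} \<longrightarrow> (W j has_real_derivative W (Suc j) s) (at s)" and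
    W2: "\<forall>j<k. continuous_on {0<..?r} (W j)" and
    W3: "AE x in lebesgue. norm (x::real^'n) \<in> {0<..<?r} \<longrightarrow> W (k - 1) differentiable (at (norm x))" and
    W4: "AE x in lebesgue. x \<in> hball R \<longrightarrow> u x = W 0 (norm x)"
    by (elim exE conjE)
  have W: "(W j has_real_derivative W (Suc j) s) (at s)" if "Suc j < k" "s \<in> {0<..<?r}" for j s
    using W1 that by simp
  let ?U = "\<lambda>x::real^'n. W 0 (norm x)"
  let ?B = "\<lambda>j (x::real^'n). W j (norm x)"
  let ?S = "closure (hball R) - {0 :: real^'n}"
  have S: "?S = cball 0 ?r - {0}" by (simp add: closure_hball[OF R])
  \<comment> \<open>\<open>Ck_on\<close> asks for derivatives in the interior only, and that
    interior lies in the open punctured ball, where \<open>radial_pdl\<close> applies.\<close>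
  have "interior ?S \<subseteq> interior (cball 0 ?r)" unfolding S by (intro interior_mono) auto
  then have int: "interior ?S \<subseteq> ball 0 ?r - {0}" using interior_subset[of ?S] by auto
  have Bc: "continuous_on ?S (?B j)" if "j < k" for j
    by (rule continuous_on_compose2[OF W2[rule_format, OF that] continuous_on_norm_id]) (auto simp: S)
  have bc: "continuous_on ?S ?b" by (intro continuous_intros) auto
  have Ck: "Ck_on (k - 1) ?S ?U"
    unfolding Ck_on_def
  proof (intro conjI allI impI)
    show "continuous_on ?S ?U" using Bc[of 0] k by simp
    fix "is" :: "'n list" assume "length is \<le> k - 1"
    then have len: "length is < k" using k by simp
    obtain T where T: "rep ?b (\<lambda>j. j \<le> length is) T"
      "\<And>x. x \<in> ball 0 ?r - {0} \<Longrightarrow> pdl_ex is ?U x \<and> pdl is ?U x = T ?B x"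
      using radial_pdl[where W=W and k=k and r="tanh (R/2)", OF W len] by blast
    show "\<forall>x\<in>interior ?S. pdl_ex is ?U x" using T(2) int by blast
    have "continuous_on ?S (T ?B)" using len by (intro rep_continuous_on[OF T(1) bc] Bc) auto
    moreover have "T ?B x = pdl is ?U x" if "x \<in> interior ?S" for x
    proof -
      have "x \<in> ball 0 ?r - {0}" using that int by (rule subsetD[rotated])
      from T(2)[OF this] show ?thesis by simp
    qed
    ultimately show "\<exists>g. continuous_on ?S g \<and> (\<forall>x\<in>interior ?S. g x = pdl is ?U x)" by blast
  qed
  have ex: "AE x in lebesgue. x \<in> hball R - {0} \<longrightarrow> (\<forall>is. length is = k \<longrightarrow> pdl_ex is ?U x)"
    using W3
  proof eventually_elim
    case (elim x)
    show ?case
    proof (intro impI allI)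
      fix "is" :: "'n list" assume x: "x \<in> hball R - {0}" and len: "length is = k"
      then have xb: "x \<in> ball 0 ?r - {0}" using R by (simp add: hball_eq_ball)
      obtain i is' where is': "is = i # is'" "length is' < k" using len k by (cases "is") auto
      obtain T where T: "rep ?b (\<lambda>j. j \<le> length is') T"
        "\<And>x. x \<in> ball 0 ?r - {0} \<Longrightarrow> pdl_ex is' ?U x \<and> pdl is' ?U x = T ?B x"
        using radial_pdl[where W=W and k=k and r="tanh (R/2)", OF W is'(2)] by blast
      have op: "open (ball (0::real^'n) ?r - {0})" by (intro open_Diff) auto
      \<comment> \<open>Below the last index the derivative exists at every radius; for j = k - 1
        the exceptional null set is excluded by the choice of x.\<close>
      have "\<exists>d. has_pd i (?B j) x d" if j: "j \<le> length is'" for j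
      proof -
        have "\<exists>e. (W j has_real_derivative e) (at (norm x))"
        proof (cases "Suc j < k")
          case True
          then show ?thesis using W[of j "norm x"] xb by auto
        next
          case False
          then have "j = k - 1" using j is' by auto
          then show ?thesis using elim xb by (auto simp: real_differentiable_def)
        qed
        then show ?thesis using has_pd_chain[OF has_pd_norm] xb by blast
      qed
      from rep_differentiable[where B="?B" and x=x and i=i, OF T(1) pd_closed_inverse_norm _ this] xb obtain d where "has_pd i (T ?B) x d" by auto
      from has_pd_cong[OF op xb _ this] have pd: "has_pd i (pdl is' ?U) x d" using T(2) by simp
      have "\<forall>\<^sub>F t in nhds 0. pdl_ex is' ?U (x + t *\<^sub>R axis i 1)"
        using has_pd_eventually_line[OF op xb] by eventually_elim (use T(2) in auto)
      then show "pdl_ex is ?U x" using pd by (auto simp: is'(1) has_pd_def real_differentiable_def)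
    qed
  qed
  show ?thesis using Ck ex W4 by blast
qed

section \<open>Embeddings\<close>

text \<open>Makes the weight sinh^\<theta> d(x) comparable with |x|^\<theta> on the ball.\<close>

lemma sinh_hdist0:
  assumes "norm x < 1"
  shows "sinh (hdist0 x) = conf x * norm x"
proof -
  define s where "s = norm x"
  have s: "0 \<le> s" "s < 1" using assms by (auto simp: s_def)
  then have "s\<^sup>2 < 1" by (simp add: power_less_one_iff)
  then have nz: "1 - s \<noteq> 0" "1 + s \<noteq> 0" "1 - s\<^sup>2 \<noteq> 0" using s by auto
  have "sinh (hdist0 x) = ((1 + s) / (1 - s) - inverse ((1 + s) / (1 - s))) / 2"
    unfolding hdist0_def s_def[symmetric] using s by (intro sinh_ln_real) auto
  also have "\<dots> = ((1 + s) * (1 + s) - (1 - s) * (1 - s)) / (2 * ((1 - s) * (1 + s)))"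
    using nz by (simp add: divide_simps)
  also have "\<dots> = 4 * s / (2 * (1 - s\<^sup>2))" by (simp add: algebra_simps power2_eq_square)
  also have "\<dots> = 2 / (1 - s\<^sup>2) * s" using nz by (simp add: divide_simps)
  also have "\<dots> = conf x * norm x" by (simp add: conf_def s_def)
  finally show ?thesis .
qed

lemma nn_integral_radial:
  fixes F :: "real \<Rightarrow> ennreal"
  assumes [measurable]: "F \<in> borel_measurable borel"
  shows "ennreal (ln 2) * (\<integral>\<^sup>+x. F (norm (x::real^'n)) \<partial>lborel) =
    (\<integral>\<^sup>+\<omega>. kappa (\<omega>::real^'n) \<partial>lborel) * (\<integral>\<^sup>+s. indicator {0<..} s * ennreal (s ^ (CARD('n) - 1)) * F s \<partial>lborel)"
proof -
  let ?J = "\<integral>\<^sup>+s. indicator {0<..} s * ennreal (s ^ (CARD('n) - 1)) * F s \<partial>lborel"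
  have "kappa \<omega> * (\<integral>\<^sup>+s. indicator {0<..} s * ennreal (s ^ (CARD('n) - 1)) * F (norm ((s / norm \<omega>) *\<^sub>R \<omega>)) \<partial>lborel) = kappa \<omega> * ?J" for \<omega> :: "real^'n"
  proof (cases "\<omega> \<in> shell")
    case True
    then have "(\<integral>\<^sup>+s. indicator {0<..} s * ennreal (s ^ (CARD('n) - 1)) * F (norm ((s / norm \<omega>) *\<^sub>R \<omega>)) \<partial>lborel) = ?J"
      using shell_norm_pos[OF True] by (intro nn_integral_cong) (auto simp: indicator_def)
    then show ?thesis by (simp only:)
  qed (simp add: kappa_def)
  then show ?thesis
    using nn_integral_polar[of "\<lambda>x::real^'n. F (norm x)"] by (simp add: kappa_def[symmetric] nn_integral_multc)
qed

lemma Lqs_pow_le: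
  assumes R: "R > 0" and \<theta>: "\<theta> \<ge> 0"
  shows "\<exists>A\<ge>0. \<forall>(u::real^'n \<Rightarrow> real) V. (AE x in lebesgue. x \<in> hball R \<longrightarrow> u x = V (norm x)) \<longrightarrow>
    (\<lambda>s. indicator {0<..<tanh (R/2)} s * V s) \<in> borel_measurable borel \<longrightarrow>
    Lqs_pow q \<theta> R u \<le> ennreal A * nn_on {0<..<tanh (R/2)} (\<lambda>s. s powr (real CARD('n) - 1 + \<theta>) * \<bar>V s\<bar> powr q)"
proof -
  let ?r = "tanh (R/2)"
  let ?N = "CARD('n)"
  define D where "D = 2 / (1 - ?r\<^sup>2)"
  have D: "D \<ge> 0" unfolding D_def using tanh_real_lt_1[of "R/2"] R by (simp add: power_le_one less_imp_le)
  obtain S where S: "(\<integral>\<^sup>+\<omega>. kappa (\<omega>::real^'n) \<partial>lborel) = ennreal S" "S > 0"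
    using kappa_integral[where 'n='n] by (cases "\<integral>\<^sup>+\<omega>. kappa (\<omega>::real^'n) \<partial>lborel") (auto simp: less_le)
  \<comment> \<open>D bounds \<open>conf\<close>: its power \<theta> comes from the sinh weight and
    its power N from the volume element, while S / ln 2 is the area of the sphere.\<close>
  define A where "A = D powr \<theta> * D ^ ?N * (S / ln 2)"
  show ?thesis
  proof (intro exI[of _ A] conjI allI impI)
    show "A \<ge> 0" using D S by (simp add: A_def)
    fix u :: "real^'n \<Rightarrow> real" and V
    assume uV: "AE x in lebesgue. x \<in> hball R \<longrightarrow> u x = V (norm x)"
      and m [measurable]: "(\<lambda>s. indicator {0<..<?r} s * V s) \<in> borel_measurable borel"
    define F where "F s = indicator {0<..<?r} s * ennreal (s powr \<theta> * \<bar>V s\<bar> powr q)" for s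
    have [measurable]: "F \<in> borel_measurable borel"
    proof -
      have "(\<lambda>s. indicator {0<..<?r} s * ennreal (s powr \<theta> * \<bar>indicator {0<..<?r} s * V s\<bar> powr q)) \<in> borel_measurable borel" by measurable
      then show ?thesis unfolding F_def by (rule measurable_cong[THEN iffD1, rotated]) (auto simp: indicator_def)
    qed
    have "AE x in lborel. x \<in> hball R \<longrightarrow> u x = V (norm x)" using uV by (simp only: AE_completion_iff)
    moreover have "AE x in lborel. x \<noteq> (0::real^'n)" by (rule AE_lborel_singleton)
    ultimately have "AE x in lborel. indicator (hball R) x * ennreal (\<bar>u x\<bar> powr q * sinh (hdist0 x) powr \<theta> * conf x ^ ?N)
       \<le> ennreal (D powr \<theta> * D ^ ?N) * F (norm x)"
    proof eventually_elim
      case (elim x)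
      show ?case
      proof (cases "x \<in> hball R")
        case True
        have xb: "x \<in> ball 0 1" using True hball_subset[of R] by auto
        have c: "2 \<le> conf x" "conf x \<le> D" using conf_ge[OF xb] conf_le[OF R True] by (auto simp: D_def)
        have nr: "norm x \<in> {0<..<?r}" using True elim R by (auto simp: hball_eq_ball)
        have "sinh (hdist0 x) powr \<theta> = conf x powr \<theta> * norm x powr \<theta>"
          using xb c by (subst sinh_hdist0) (auto simp: powr_mult)
        also have "\<dots> \<le> D powr \<theta> * norm x powr \<theta>" using c \<theta> by (intro mult_right_mono powr_mono2) auto
        finally have "\<bar>u x\<bar> powr q * sinh (hdist0 x) powr \<theta> * conf x ^ ?N \<le> \<bar>u x\<bar> powr q * (D powr \<theta> * norm x powr \<theta>) * D ^ ?N"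
          using c by (intro mult_mono power_mono) auto
        also have "\<dots> = (D powr \<theta> * D ^ ?N) * (norm x powr \<theta> * \<bar>V (norm x)\<bar> powr q)" using elim True by simp
        finally show ?thesis using True nr D by (simp add: F_def ennreal_mult[symmetric] ennreal_leI)
      qed simp
    qed
    then have "Lqs_pow q \<theta> R u \<le> (\<integral>\<^sup>+x. ennreal (D powr \<theta> * D ^ ?N) * F (norm (x::real^'n)) \<partial>lborel)"
      unfolding Lqs_pow_def nn_integral_completion by (rule nn_integral_mono_AE)
    also have "\<dots> = ennreal (D powr \<theta> * D ^ ?N) * (\<integral>\<^sup>+x. F (norm (x::real^'n)) \<partial>lborel)"
      by (rule nn_integral_cmult) measurable
    also have "(\<integral>\<^sup>+x. F (norm (x::real^'n)) \<partial>lborel) = ennreal (S / ln 2) * (\<integral>\<^sup>+s. indicator {0<..} s * ennreal (s ^ (?N - 1)) * F s \<partial>lborel)"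
    proof -
      have "ennreal (1 / ln 2) * (ennreal (ln 2) * (\<integral>\<^sup>+x. F (norm (x::real^'n)) \<partial>lborel)) =
        ennreal (1 / ln 2) * (ennreal S * (\<integral>\<^sup>+s. indicator {0<..} s * ennreal (s ^ (?N - 1)) * F s \<partial>lborel))"
        using nn_integral_radial[of F, where 'n='n] S(1) by simp
      moreover have "ennreal (1 / ln 2) * ennreal (ln 2) = 1" "ennreal (1 / ln 2) * ennreal S = ennreal (S / ln 2)"
        using S(2) by (simp_all flip: ennreal_mult)
      ultimately show ?thesis by (simp only: mult.assoc[symmetric] mult_1_left)
    qed
    also have "(\<integral>\<^sup>+s. indicator {0<..} s * ennreal (s ^ (?N - 1)) * F s \<partial>lborel)
      = nn_on {0<..<?r} (\<lambda>s. s powr (real ?N - 1 + \<theta>) * \<bar>V s\<bar> powr q)"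
    proof (intro nn_integral_cong)
      fix s :: real
      have "s powr (real ?N - 1 + \<theta>) = s ^ (?N - 1) * s powr \<theta>" if "s > 0"
      proof -
        have e: "real ?N - 1 = real (?N - 1)" by (simp add: of_nat_diff Suc_leI)
        have "s powr real (?N - 1) = s ^ (?N - 1)" using that by (rule powr_realpow)
        then show ?thesis by (simp only: e powr_add)
      qed
      then show "indicator {0<..} s * ennreal (s ^ (?N - 1)) * F s = indicator {0<..<?r} s * ennreal (s powr (real ?N - 1 + \<theta>) * \<bar>V s\<bar> powr q)"
        by (auto simp: F_def indicator_def mult.assoc simp flip: ennreal_mult)
    qed
    finally have *: "Lqs_pow q \<theta> R u \<le> ennreal (D powr \<theta> * D ^ ?N) * (ennreal (S / ln 2) * nn_on {0<..<?r} (\<lambda>s. s powr (real ?N - 1 + \<theta>) * \<bar>V s\<bar> powr q))" .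
    show "Lqs_pow q \<theta> R u \<le> ennreal A * nn_on {0<..<?r} (\<lambda>s. s powr (real ?N - 1 + \<theta>) * \<bar>V s\<bar> powr q)"
    proof -
      have "ennreal A = ennreal (D powr \<theta> * D ^ ?N) * ennreal (S / ln 2)"
        unfolding A_def using D S(2) by (intro ennreal_mult) auto
      then show ?thesis using * by (simp only: mult.assoc)
    qed
  qed
qed

section \<open>Weighted integrals under a power bound\<close>

lemma pointwise_root:
  fixes s b p K y :: real
  assumes "s > 0" "p \<ge> 1" "K \<ge> 0" "s powr b * \<bar>y\<bar> powr p \<le> K powr p"
  shows "\<bar>y\<bar> \<le> K * s powr (- b / p)"
proof -
  have "(s powr b * \<bar>y\<bar> powr p) powr (1/p) \<le> (K powr p) powr (1/p)"
    using assms by (intro powr_mono2) auto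
  moreover have "(s powr b * \<bar>y\<bar> powr p) powr (1/p) = s powr (b/p) * \<bar>y\<bar>"
    using assms by (simp add: powr_mult powr_powr)
  moreover have "(K powr p) powr (1/p) = K" using assms by (simp add: powr_powr)
  ultimately have "s powr (b/p) * \<bar>y\<bar> \<le> K" by simp
  then have "s powr (- b / p) * (s powr (b/p) * \<bar>y\<bar>) \<le> s powr (- b / p) * K" by (intro mult_left_mono) auto
  moreover have "s powr (- b / p) * s powr (b/p) = 1" using assms by (simp flip: powr_add)
  ultimately have "\<bar>y\<bar> \<le> s powr (- b / p) * K" by (simp only: mult.assoc[symmetric] mult_1_left)
  then show ?thesis by (simp only: mult.commute)
qed

lemma nn_integral_powr_0:
  assumes "r > 0" "\<alpha> > 0"
  shows "nn_on {0<..<r} (\<lambda>s. s powr (\<alpha> - 1)) \<le> ennreal (r powr \<alpha> / \<alpha>)"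
proof -
  have "((\<lambda>x. x powr (\<alpha> - 1)) has_integral (r powr (\<alpha> - 1 + 1) / (\<alpha> - 1 + 1))) {0..r}"
    using assms by (intro has_integral_powr_from_0) auto
  from nn_integral_has_integral_lebesgue'[OF _ this]
  have "(\<integral>\<^sup>+s. ennreal (s powr (\<alpha> - 1)) * indicator {0..r} s \<partial>lborel) = ennreal (r powr \<alpha> / \<alpha>)" by simp
  moreover have "nn_on {0<..<r} (\<lambda>s. s powr (\<alpha> - 1)) \<le> (\<integral>\<^sup>+s. ennreal (s powr (\<alpha> - 1)) * indicator {0..r} s \<partial>lborel)"
    by (intro nn_integral_mono) (auto simp: indicator_def)
  ultimately show ?thesis by simp
qed

lemma subcritical_pointwise:
  fixes s b p q K y :: real
  assumes "s > 0" "p \<ge> 1" "q \<ge> 1" "K \<ge> 0" "s powr b * \<bar>y\<bar> powr p \<le> K powr p"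
  shows "s powr (N - 1 + \<theta>) * \<bar>y\<bar> powr q \<le> K powr q * s powr ((\<theta> + N - b * q / p) - 1)"
proof -
  have "\<bar>y\<bar> powr q \<le> (K * s powr (- b / p)) powr q"
    using pointwise_root[OF assms(1,2,4,5)] assms by (intro powr_mono2) auto
  also have "\<dots> = K powr q * s powr (- b / p * q)" using assms by (simp add: powr_mult powr_powr)
  finally have "s powr (N - 1 + \<theta>) * \<bar>y\<bar> powr q \<le> s powr (N - 1 + \<theta>) * (K powr q * s powr (- b / p * q))"
    by (intro mult_left_mono) auto
  also have "\<dots> = K powr q * (s powr (N - 1 + \<theta>) * s powr (- b / p * q))" by simp
  also have "s powr (N - 1 + \<theta>) * s powr (- b / p * q) = s powr ((\<theta> + N - b * q / p) - 1)"
    by (simp add: algebra_simps flip: powr_add)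
  finally show ?thesis .
qed

text \<open>The pointwise bound |V| <= K s^(-b/p) alone suffices, because the strict inequality
  makes the resulting power of s integrable at 0.\<close>

lemma subcritical_integral:
  assumes "r > 0" "p \<ge> 1" "q \<ge> 1" "K \<ge> 0" "b * q / p < \<theta> + N" "\<And>s. s \<in> {0<..<r} \<Longrightarrow> s powr b * \<bar>V s\<bar> powr p \<le> K powr p"
  shows "nn_on {0<..<r} (\<lambda>s. s powr (N - 1 + \<theta>) * \<bar>V s\<bar> powr q)
    \<le> ennreal (r powr (\<theta> + N - b * q / p) / (\<theta> + N - b * q / p) * K powr q)"
proof -
  let ?a = "\<theta> + N - b * q / p"
  have "nn_on {0<..<r} (\<lambda>s. s powr (N - 1 + \<theta>) * \<bar>V s\<bar> powr q) \<le>
     ennreal (K powr q) * nn_on {0<..<r} (\<lambda>s. s powr (?a - 1))"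
  proof (rule nn_integral_le_weight)
    fix s assume s: "s \<in> {0<..<r}"
    have "s powr (N - 1 + \<theta>) * \<bar>V s\<bar> powr q \<le> K powr q * s powr (?a - 1)"
      using s by (intro subcritical_pointwise[OF _ assms(2,3,4) assms(6)]) auto
    then show "s \<in> {0<..<r} \<and> 0 \<le> s powr (N - 1 + \<theta>) * \<bar>V s\<bar> powr q \<and> s powr (N - 1 + \<theta>) * \<bar>V s\<bar> powr q \<le> K powr q * s powr (?a - 1)"
      using s by simp
  qed auto
  also have "\<dots> \<le> ennreal (K powr q) * ennreal (r powr ?a / ?a)"
    using assms by (intro mult_left_mono nn_integral_powr_0) auto
  also have "\<dots> = ennreal (r powr ?a / ?a * K powr q)"
    using assms by (subst ennreal_mult[symmetric]) (auto simp: mult.commute)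
  finally show ?thesis .
qed

text \<open>At equality the pointwise bound misses integrability by a logarithm. Writing |V|^q as
  |V|^(q-p) |V|^p, the first factor takes the pointwise bound and the second the Hardy integral; the
  exponents add up to b - 1 exactly when bq/p = \<theta> + N.\<close>

lemma critical_integral:
  assumes "r > 0" "p \<ge> 1" "q \<ge> p" "K \<ge> 0" "b * q / p = \<theta> + N" "\<And>s. s \<in> {0<..<r} \<Longrightarrow> s powr b * \<bar>V s\<bar> powr p \<le> K powr p"
    and V: "continuous_on {0<..<r} V"
    and I: "nn_on {0<..<r} (\<lambda>s. s powr (b - 1) * \<bar>V s\<bar> powr p) \<le> ennreal (K powr p)"
  shows "nn_on {0<..<r} (\<lambda>s. s powr (N - 1 + \<theta>) * \<bar>V s\<bar> powr q) \<le> ennreal (1 * K powr q)"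
proof -
  have "nn_on {0<..<r} (\<lambda>s. s powr (N - 1 + \<theta>) * \<bar>V s\<bar> powr q) \<le>
     ennreal (K powr (q - p)) * nn_on {0<..<r} (\<lambda>s. s powr (b - 1) * \<bar>V s\<bar> powr p)"
  proof (rule nn_integral_le_weight)
    show "(\<lambda>s. indicator {0<..<r} s * ennreal (s powr (b - 1) * \<bar>V s\<bar> powr p)) \<in> borel_measurable borel"
      using assms(2) by (intro measurable_indicator_continuous continuous_on_mult continuous_on_powr' continuous_on_rabs V
           continuous_on_id continuous_on_const) auto
    fix s assume s: "s \<in> {0<..<r}"
    have "\<bar>V s\<bar> powr (q - p) \<le> (K * s powr (- b / p)) powr (q - p)"
      using pointwise_root[OF _ assms(2,4) assms(6)[OF s]] s assms by (intro powr_mono2) auto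
    also have "\<dots> = K powr (q - p) * s powr (- b / p * (q - p))" using assms by (simp add: powr_mult powr_powr)
    finally have "s powr (N - 1 + \<theta>) * \<bar>V s\<bar> powr (q - p) * \<bar>V s\<bar> powr p \<le> s powr (N - 1 + \<theta>) * (K powr (q - p) * s powr (- b / p * (q - p))) * \<bar>V s\<bar> powr p"
      by (intro mult_left_mono mult_right_mono) auto
    moreover have "\<bar>V s\<bar> powr (q - p) * \<bar>V s\<bar> powr p = \<bar>V s\<bar> powr q" by (simp flip: powr_add)
    moreover have "s powr (N - 1 + \<theta>) * s powr (- b / p * (q - p)) = s powr (b - 1)"
    proof -
      have eq: "N - 1 + \<theta> + (- b / p * (q - p)) = b - 1" using assms(2,5) by (simp add: field_simps)
      show ?thesis unfolding powr_add[symmetric] eq ..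
    qed
    moreover have "s powr (N - 1 + \<theta>) * (K powr (q - p) * s powr (- b / p * (q - p))) * \<bar>V s\<bar> powr p
       = K powr (q - p) * ((s powr (N - 1 + \<theta>) * s powr (- b / p * (q - p))) * \<bar>V s\<bar> powr p)"
      by (simp only: mult_ac)
    ultimately have "s powr (N - 1 + \<theta>) * \<bar>V s\<bar> powr q \<le> K powr (q - p) * (s powr (b - 1) * \<bar>V s\<bar> powr p)"
      by (simp only: mult.assoc)
    then show "s \<in> {0<..<r} \<and> 0 \<le> s powr (N - 1 + \<theta>) * \<bar>V s\<bar> powr q \<and> s powr (N - 1 + \<theta>) * \<bar>V s\<bar> powr q \<le> K powr (q - p) * (s powr (b - 1) * \<bar>V s\<bar> powr p)"
      using s by simp
  qed auto
  also have "\<dots> \<le> ennreal (K powr (q - p)) * ennreal (K powr p)" by (intro mult_left_mono I) auto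
  also have "\<dots> = ennreal (K powr (q - p) * K powr p)" by (rule ennreal_mult[symmetric]) auto
  also have "K powr (q - p) * K powr p = 1 * K powr q" unfolding powr_add[symmetric] by simp
  finally show ?thesis .
qed

text \<open>The pointwise bound, the integral bound for the critical case, and a modulus of
  continuity away from 0 for compactness. The free parameter l balances the two terms of the
  modulus.\<close>

definition radial_bounds :: "real \<Rightarrow> real \<Rightarrow> real \<Rightarrow> real \<Rightarrow> real \<Rightarrow> (real \<Rightarrow> real) \<Rightarrow> bool" where
  "radial_bounds b p N r K V \<longleftrightarrow>
    (\<forall>s\<in>{0<..<r}. s powr b * \<bar>V s\<bar> powr p \<le> K powr p) \<and>
    nn_on {0<..<r} (\<lambda>s. s powr (b - 1) * \<bar>V s\<bar> powr p) \<le> ennreal (K powr p) \<and>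
    (\<forall>l a s t. 0 < l \<and> 0 < a \<and> a \<le> s \<and> s \<le> t \<and> t < r \<longrightarrow>
       \<bar>V t - V s\<bar> \<le> l * (t - s) + l powr (1 - p) * a powr (1 - N) * K powr p)"

lemma radial_bounds_mono:
  assumes "radial_bounds b p N r K V" "0 \<le> K" "K \<le> K'" "p \<ge> 0"
  shows "radial_bounds b p N r K' V"
proof -
  have le: "K powr p \<le> K' powr p" using assms by (intro powr_mono2) auto
  show ?thesis
    unfolding radial_bounds_def
  proof (intro conjI ballI allI impI)
    fix s assume "s \<in> {0<..<r}"
    then show "s powr b * \<bar>V s\<bar> powr p \<le> K' powr p"
      using assms(1) le unfolding radial_bounds_def by (intro order_trans[OF _ le]) auto
  next
    show "nn_on {0<..<r} (\<lambda>s. s powr (b - 1) * \<bar>V s\<bar> powr p) \<le> ennreal (K' powr p)"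
      using assms(1) unfolding radial_bounds_def by (intro order_trans[OF _ ennreal_leI[OF le]]) auto
  next
    fix l a s t :: real assume H: "0 < l \<and> 0 < a \<and> a \<le> s \<and> s \<le> t \<and> t < r"
    have "\<bar>V t - V s\<bar> \<le> l * (t - s) + l powr (1 - p) * a powr (1 - N) * K powr p"
      using assms(1) H unfolding radial_bounds_def by blast
    also have "\<dots> \<le> l * (t - s) + l powr (1 - p) * a powr (1 - N) * K' powr p"
      by (intro add_left_mono mult_left_mono le) auto
    finally show "\<bar>V t - V s\<bar> \<le> l * (t - s) + l powr (1 - p) * a powr (1 - N) * K' powr p" .
  qed
qed

text \<open>Each bound holds for the smooth chains with their own energies; passing to the limit
  uses only that the liminf of these energies is at most a multiple of the p-th power of the
  norm.\<close>

lemma radial_estimates: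
  assumes R: "R > 0" and p: "p \<ge> 1" and k: "k \<ge> 1" and N: "real CARD('n) > real (k - 1) * p"
    and b: "b > 0" "b \<ge> real CARD('n) - real k * p"
  shows "\<exists>C\<ge>0. \<forall>u::real^'n \<Rightarrow> real. Wrad k p R u \<longrightarrow> Wnormc k p R u \<ge> 0 \<and> (\<exists>V.
    continuous_on {0<..tanh (R/2)} V \<and> (AE x in lebesgue. x \<in> hball R \<longrightarrow> u x = V (norm x)) \<and>
    radial_bounds b p (real CARD('n)) (tanh (R/2)) (C * Wnormc k p R u) V)"
proof -
  let ?r = "tanh (R/2)"
  let ?N = "real CARD('n)"
  have r: "?r > 0" using R by simp
  have N1: "?N \<ge> 1" by (simp add: Suc_leI)
  obtain C1 where C1: "C1 > 0" "\<And>G. chain k ?r G \<Longrightarrow>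
    (\<forall>s\<in>{0<..<?r}. ennreal (s powr b * \<bar>G 0 s\<bar> powr p) \<le> ennreal C1 * chain_energy k p ?N ?r G) \<and>
    nn_on {0<..<?r} (\<lambda>x. x powr (b - 1) * \<bar>G 0 x\<bar> powr p) \<le> ennreal C1 * chain_energy k p ?N ?r G"
    using chain_pointwise[OF r p N1 k N b] by blast
  obtain C2 where C2: "C2 \<ge> 0" "\<forall>\<phi> (u::real^'n \<Rightarrow> real) c. approxW k p R \<phi> u \<and> radial R u \<and> (\<lambda>n. Wnorm k p R (\<phi> n)) \<longlonglongrightarrow> c \<longrightarrow>
    (\<exists>G v. radial_profile k p ?N R u G v (ennreal (C2 * c powr p)))"
    using radial_profile_exists[OF R p k, where 'n='n] by (elim exE conjE)
  \<comment> \<open>One constant for three bounds: the factor C1 + 1 dominates both C1, from the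
    Hardy estimates, and 1, from the modulus of continuity.\<close>
  define C where "C = ((C1 + 1) * C2) powr (1/p)"
  show ?thesis
  proof (intro exI[of _ C] conjI allI impI)
    show "C \<ge> 0" by (simp add: C_def)
    fix u :: "real^'n \<Rightarrow> real" assume u: "Wrad k p R u"
    define c where "c = Wnormc k p R u"
    obtain \<phi> where \<phi>: "approxW k p R \<phi> u" "(\<lambda>n. Wnorm k p R (\<phi> n)) \<longlonglongrightarrow> c"
      using Wnormc_limit[OF R p u] by (auto simp: c_def)
    have c0: "c \<ge> 0" by (rule LIMSEQ_le_const[OF \<phi>(2)]) (auto simp: Wnorm_def)
    then show "Wnormc k p R u \<ge> 0" by (simp add: c_def)
    define E where "E = C2 * c powr p"
    have E0: "E \<ge> 0" using C2 by (simp add: E_def)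
    have Cc: "(C * c) powr p = (C1 + 1) * E"
      using C1 C2 p c0 by (simp add: C_def E_def powr_mult powr_powr)
    have EC: "C1 * E \<le> (C * c) powr p" "E \<le> (C * c) powr p" unfolding Cc using C1(1) E0 by (auto simp: distrib_right)
    have rad: "radial R u" using u by (simp add: Wrad_def)
    obtain G v where P: "radial_profile k p ?N R u G v (ennreal E)"
      using C2(2)[rule_format, OF conjI[OF \<phi>(1) conjI[OF rad \<phi>(2)]]] unfolding E_def by (elim exE)
    have ch: "chain k ?r (G n)" for n using P by (simp add: radial_profile_def)
    have li: "liminf (\<lambda>n. chain_energy k p ?N ?r (G n)) \<le> ennreal E" using P by (simp add: radial_profile_def)
    from profile_limit[OF R p k N1 P] obtain W where
      W0: "\<forall>j s. j < k \<and> s \<in> {0<..<?r} \<longrightarrow> (\<lambda>n. G n j s) \<longlonglongrightarrow> W j s" and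
      W2: "\<forall>j<k. continuous_on {0<..?r} (W j)" and
      W4: "AE x in lebesgue. x \<in> hball R \<longrightarrow> u x = W 0 (norm x)"
      by (elim exE conjE)
    have cv: "(\<lambda>n. G n 0 s) \<longlonglongrightarrow> W 0 s" if "s \<in> {0<..<?r}" for s using W0 that k by simp
    have lim_p: "(\<lambda>n. ennreal (s powr e * \<bar>G n 0 s\<bar> powr p)) \<longlonglongrightarrow> ennreal (s powr e * \<bar>W 0 s\<bar> powr p)" if "s \<in> {0<..<?r}" for s e
      using p by (intro tendsto_ennrealI tendsto_mult tendsto_const tendsto_powr'[OF _ tendsto_const] tendsto_rabs cv[OF that]) auto
    have to_real: "x \<le> y" if "ennreal x \<le> ennreal y" "y \<ge> 0" for x y using that by simp
    show "\<exists>V. continuous_on {0<..?r} V \<and> (AE x in lebesgue. x \<in> hball R \<longrightarrow> u x = V (norm x)) \<and>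
      radial_bounds b p ?N ?r (C * Wnormc k p R u) V"
      unfolding c_def[symmetric] radial_bounds_def
    proof (intro exI[of _ "W 0"] conjI ballI allI impI W4)
      show "continuous_on {0<..?r} (W 0)" using W2 k by simp
    next
      fix s assume s: "s \<in> {0<..<?r}"
      have "ennreal (s powr b * \<bar>W 0 s\<bar> powr p) \<le> 0 + ennreal C1 * ennreal E"
        by (rule le_liminf_bound[OF lim_p[OF s] _ li]) (use C1(2)[OF ch] s in auto)
      also have "\<dots> = ennreal (C1 * E)" using C1(1) E0 by (simp add: ennreal_mult)
      finally have "s powr b * \<bar>W 0 s\<bar> powr p \<le> C1 * E" by (rule to_real) (use C1(1) E0 in simp)
      then show "s powr b * \<bar>W 0 s\<bar> powr p \<le> (C * c) powr p" using EC(1) by linarith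
    next
      \<comment> \<open>Fatou once more, now in s: the integrand is the pointwise limit of those of
        the chains.\<close>
      have "nn_on {0<..<?r} (\<lambda>s. s powr (b - 1) * \<bar>W 0 s\<bar> powr p)
        = (\<integral>\<^sup>+s. liminf (\<lambda>n. indicator {0<..<?r} s * ennreal (s powr (b - 1) * \<bar>G n 0 s\<bar> powr p)) \<partial>lborel)"
      proof (intro nn_integral_cong)
        fix s :: real
        show "indicator {0<..<?r} s * ennreal (s powr (b - 1) * \<bar>W 0 s\<bar> powr p) = liminf (\<lambda>n. indicator {0<..<?r} s * ennreal (s powr (b - 1) * \<bar>G n 0 s\<bar> powr p))"
        proof (cases "s \<in> {0<..<?r}")
          case True
          then show ?thesis using lim_imp_Liminf[OF _ lim_p[OF True, of "b - 1"]] by simp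
        qed (simp add: Liminf_const)
      qed
      also have "\<dots> \<le> liminf (\<lambda>n. nn_on {0<..<?r} (\<lambda>s. s powr (b - 1) * \<bar>G n 0 s\<bar> powr p))"
      proof (rule nn_integral_liminf)
        fix n
        have "(\<lambda>s. indicator {0<..<?r} s * ennreal (s powr (b - 1) * \<bar>G n 0 s\<bar> powr p)) \<in> borel_measurable borel"
          using p k by (intro measurable_indicator_continuous continuous_on_mult continuous_on_powr' continuous_on_rabs
             chain_continuous[OF ch] continuous_on_id continuous_on_const) auto
        then show "(\<lambda>s. indicator {0<..<?r} s * ennreal (s powr (b - 1) * \<bar>G n 0 s\<bar> powr p)) \<in> borel_measurable lborel" by simp
      qed
      also have "\<dots> \<le> liminf (\<lambda>n. ennreal C1 * chain_energy k p ?N ?r (G n))"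
        by (intro Liminf_mono always_eventually allI) (use C1(2)[OF ch] in blast)
      also have "\<dots> = ennreal C1 * liminf (\<lambda>n. chain_energy k p ?N ?r (G n))" by (rule liminf_cmult_ennreal) simp
      also have "\<dots> \<le> ennreal C1 * ennreal E" by (intro mult_left_mono li) simp
      also have "\<dots> = ennreal (C1 * E)" using C1(1) E0 by (simp add: ennreal_mult)
      also have "\<dots> \<le> ennreal ((C * c) powr p)" using EC(1) by (rule ennreal_leI)
      finally show "nn_on {0<..<?r} (\<lambda>s. s powr (b - 1) * \<bar>W 0 s\<bar> powr p) \<le> ennreal ((C * c) powr p)" .
    next
      fix l a s t :: real assume A: "0 < l \<and> 0 < a \<and> a \<le> s \<and> s \<le> t \<and> t < ?r"
      let ?D = "l powr (1 - p) * a powr (1 - ?N)"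
      have "ennreal \<bar>W 0 t - W 0 s\<bar> \<le> ennreal (l * (t - s)) + ennreal ?D * ennreal E"
      proof (rule le_liminf_bound[OF _ _ li])
        show "(\<lambda>n. ennreal \<bar>G n 0 t - G n 0 s\<bar>) \<longlonglongrightarrow> ennreal \<bar>W 0 t - W 0 s\<bar>"
          using A by (intro tendsto_ennrealI tendsto_rabs tendsto_diff cv) auto
        fix n
        have "C1_on ?r (G n 0) (G n 1)" using ch[of n] k by (auto simp: chain_def)
        then have "ennreal \<bar>G n 0 t - G n 0 s\<bar> \<le> nn_on {s..t} (\<lambda>x. \<bar>G n 1 x\<bar>)"
          using A by (intro C1_abs_diff_le) auto
        also have "\<dots> \<le> ennreal (l * (t - s)) + ennreal ?D * chain_energy k p ?N ?r (G n)"
          using A by (intro chain_L1[OF ch k k _ _ _ _ _ p N1]) auto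
        finally show "ennreal \<bar>G n 0 t - G n 0 s\<bar> \<le> ennreal (l * (t - s)) + ennreal ?D * chain_energy k p ?N ?r (G n)" .
      qed
      also have "ennreal (l * (t - s)) + ennreal ?D * ennreal E = ennreal (l * (t - s) + ?D * E)"
        using A E0 by (simp add: ennreal_mult)
      finally have "\<bar>W 0 t - W 0 s\<bar> \<le> l * (t - s) + ?D * E" by (rule to_real) (use A E0 in auto)
      also have "\<dots> \<le> l * (t - s) + ?D * (C * c) powr p" using EC(2) by (intro add_left_mono mult_left_mono) auto
      finally show "\<bar>W 0 t - W 0 s\<bar> \<le> l * (t - s) + l powr (1 - p) * a powr (1 - ?N) * (C * c) powr p" .
    qed
  qed
qed

section \<open>Continuous and compact embeddings\<close>

lemma Lqs_norm_bound:
  assumes "Lqs_pow q \<theta> R u \<le> ennreal (A * K powr q)" "A \<ge> 0" "K \<ge> 0" "q \<ge> 1"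
  shows "Lqs_norm q \<theta> R u \<le> A powr (1/q) * K" "Lqs_pow q \<theta> R u < \<infinity>"
proof -
  show "Lqs_pow q \<theta> R u < \<infinity>" using assms(1) by (rule order_le_less_trans) simp
  have "enn2real (Lqs_pow q \<theta> R u) \<le> A * K powr q" using assms by (intro enn2real_leI) auto
  then have "Lqs_norm q \<theta> R u \<le> (A * K powr q) powr (1/q)"
    unfolding Lqs_norm_def using assms by (intro powr_mono2) auto
  also have "\<dots> = A powr (1/q) * K" using assms by (simp add: powr_mult powr_powr)
  finally show "Lqs_norm q \<theta> R u \<le> A powr (1/q) * K" .
qed

lemma measurable_profile:
  fixes V :: "real \<Rightarrow> real"
  assumes "continuous_on {0<..r} V"
  shows "(\<lambda>s. indicator {0<..<r} s * V s) \<in> borel_measurable borel"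
proof -
  have "continuous_on {0<..<r} V" by (rule continuous_on_subset[OF assms]) auto
  from borel_measurable_continuous_on_indicator[OF _ this] show ?thesis by simp
qed

text \<open>The exponent b is a parameter: b = N - kp serves N > kp, including the critical q
  through the second alternative of \<open>cond\<close>, while for N = kp a sufficiently small b
  reaches any q.\<close>

lemma cont_embed_general:
  assumes R: "R > 0" and p: "p \<ge> 1" and k: "k \<ge> 1" and N: "real CARD('n::finite) > real (k - 1) * p"
    and b: "b > 0" "b \<ge> real CARD('n::finite) - real k * p"
    and \<theta>: "\<theta> \<ge> 0" and q: "q \<ge> 1"
    and cond: "b * q / p < \<theta> + real CARD('n::finite) \<or> b * q / p = \<theta> + real CARD('n::finite) \<and> q \<ge> p"
  shows "cont_embed k p R q \<theta> TYPE('n::finite)"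
proof -
  let ?r = "tanh (R/2)"
  let ?N = "real CARD('n)"
  have r: "?r > 0" using R by simp
  obtain C where C: "C \<ge> 0" "\<forall>u::real^'n \<Rightarrow> real. Wrad k p R u \<longrightarrow> Wnormc k p R u \<ge> 0 \<and> (\<exists>V.
    continuous_on {0<..?r} V \<and> (AE x in lebesgue. x \<in> hball R \<longrightarrow> u x = V (norm x)) \<and>
    radial_bounds b p ?N ?r (C * Wnormc k p R u) V)"
    using radial_estimates[OF R p k N b] by (elim exE conjE)
  obtain A where A: "A \<ge> 0" and A': "\<forall>(u::real^'n \<Rightarrow> real) V. (AE x in lebesgue. x \<in> hball R \<longrightarrow> u x = V (norm x)) \<longrightarrow>
    (\<lambda>s. indicator {0<..<?r} s * V s) \<in> borel_measurable borel \<longrightarrow>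
    Lqs_pow q \<theta> R u \<le> ennreal A * nn_on {0<..<?r} (\<lambda>s. s powr (?N - 1 + \<theta>) * \<bar>V s\<bar> powr q)"
    using Lqs_pow_le[OF R \<theta>, where 'n='n and q=q] by (elim exE conjE)
  \<comment> \<open>One constant for both alternatives. At equality the quotient has denominator 0,
    hence value 0, and B is 1.\<close>
  define B where "B = max 1 (?r powr (\<theta> + ?N - b * q / p) / (\<theta> + ?N - b * q / p))"
  have B: "B \<ge> 0" by (simp add: B_def)
  show ?thesis
    unfolding cont_embed_def
  proof (intro exI[of _ "(A * B) powr (1/q) * C"] allI impI)
    fix u :: "real^'n \<Rightarrow> real" assume u: "Wrad k p R u"
    define K where "K = C * Wnormc k p R u"
    obtain V where V: "continuous_on {0<..?r} V" "AE x in lebesgue. x \<in> hball R \<longrightarrow> u x = V (norm x)"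
      "\<And>s. s \<in> {0<..<?r} \<Longrightarrow> s powr b * \<bar>V s\<bar> powr p \<le> K powr p"
      "nn_on {0<..<?r} (\<lambda>s. s powr (b - 1) * \<bar>V s\<bar> powr p) \<le> ennreal (K powr p)"
      using C(2)[rule_format, OF u] unfolding K_def radial_bounds_def by (elim exE conjE) blast
    have K: "K \<ge> 0" using C(1) C(2)[rule_format, OF u] by (simp add: K_def)
    have Vc: "continuous_on {0<..<?r} V" by (rule continuous_on_subset[OF V(1)]) auto
    have "nn_on {0<..<?r} (\<lambda>s. s powr (?N - 1 + \<theta>) * \<bar>V s\<bar> powr q) \<le> ennreal (B * K powr q)"
      using cond
    proof
      assume c: "b * q / p < \<theta> + ?N"
      have "nn_on {0<..<?r} (\<lambda>s. s powr (?N - 1 + \<theta>) * \<bar>V s\<bar> powr q)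
        \<le> ennreal (?r powr (\<theta> + ?N - b * q / p) / (\<theta> + ?N - b * q / p) * K powr q)"
        by (rule subcritical_integral[OF r p q K c V(3)])
      also have "\<dots> \<le> ennreal (B * K powr q)" by (intro ennreal_leI mult_right_mono) (auto simp: B_def)
      finally show ?thesis .
    next
      assume c: "b * q / p = \<theta> + ?N \<and> q \<ge> p"
      have "nn_on {0<..<?r} (\<lambda>s. s powr (?N - 1 + \<theta>) * \<bar>V s\<bar> powr q) \<le> ennreal (1 * K powr q)"
        using c by (intro critical_integral[OF r p _ K _ V(3) Vc V(4)]) auto
      also have "\<dots> \<le> ennreal (B * K powr q)" by (intro ennreal_leI mult_right_mono) (auto simp: B_def)
      finally show ?thesis .
    qed
    then have "Lqs_pow q \<theta> R u \<le> ennreal A * ennreal (B * K powr q)"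
      by (intro order_trans[OF A'[rule_format, OF V(2) measurable_profile[OF V(1)]]] mult_left_mono) auto
    also have "\<dots> = ennreal (A * B * K powr q)" using A B by (simp add: ennreal_mult mult.assoc)
    finally have L: "Lqs_pow q \<theta> R u \<le> ennreal (A * B * K powr q)" .
    have AB: "A * B \<ge> 0" using A B by simp
    have "set_borel_measurable lebesgue (hball R) u" using u by (auto simp: Wrad_def approxW_def)
    then show "in_Lqs q \<theta> R u \<and> Lqs_norm q \<theta> R u \<le> (A * B) powr (1/q) * C * Wnormc k p R u"
      using Lqs_norm_bound[OF L AB K q] by (simp add: in_Lqs_def K_def mult.assoc)
  qed
qed

text \<open>Arzela-Ascoli by hand: a diagonal subsequence converges at all rational radii,
  equicontinuity away from 0 extends this to every radius, and the common bound by a power of s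
  permits dominated convergence in the weighted integral.\<close>

lemma compact_embed_general:
  assumes R: "R > 0" and p: "p > 1" and k: "k \<ge> 1" and N: "real CARD('n::finite) > real (k - 1) * p"
    and b: "b > 0" "b \<ge> real CARD('n::finite) - real k * p"
    and \<theta>: "\<theta> \<ge> 0" and q: "q \<ge> 1" and cond: "b * q / p < \<theta> + real CARD('n::finite)"
  shows "compact_embed k p R q \<theta> TYPE('n::finite)"
proof -
  let ?r = "tanh (R/2)"
  let ?N = "real CARD('n)"
  define \<alpha> where "\<alpha> = \<theta> + ?N - b * q / p"
  have \<alpha>: "\<alpha> > 0" using cond by (simp add: \<alpha>_def)
  have r: "?r > 0" using R by simp
  have p1: "p \<ge> 1" using p by simp
  obtain C where C: "C \<ge> 0" "\<forall>u::real^'n \<Rightarrow> real. Wrad k p R u \<longrightarrow> Wnormc k p R u \<ge> 0 \<and> (\<exists>V.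
    continuous_on {0<..?r} V \<and> (AE x in lebesgue. x \<in> hball R \<longrightarrow> u x = V (norm x)) \<and>
    radial_bounds b p ?N ?r (C * Wnormc k p R u) V)"
    using radial_estimates[OF R p1 k N b] by (elim exE conjE)
  obtain A where A: "A \<ge> 0" and A': "\<forall>(u::real^'n \<Rightarrow> real) V. (AE x in lebesgue. x \<in> hball R \<longrightarrow> u x = V (norm x)) \<longrightarrow>
    (\<lambda>s. indicator {0<..<?r} s * V s) \<in> borel_measurable borel \<longrightarrow>
    Lqs_pow q \<theta> R u \<le> ennreal A * nn_on {0<..<?r} (\<lambda>s. s powr (?N - 1 + \<theta>) * \<bar>V s\<bar> powr q)"
    using Lqs_pow_le[OF R \<theta>, where 'n='n and q=q] by (elim exE conjE)
  have "\<exists>\<sigma> w. strict_mono \<sigma> \<and> in_Lqs q \<theta> R w \<and> (\<lambda>n. Lqs_norm q \<theta> R (\<lambda>x. u (\<sigma> n) x - w x)) \<longlonglongrightarrow> 0"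
    if u: "\<forall>n. Wrad k p R (u n) \<and> Wnormc k p R (u n) \<le> B" for u :: "nat \<Rightarrow> real^'n \<Rightarrow> real" and B
  proof -
    define K where "K = C * max B 0"
    have K: "K \<ge> 0" using C(1) by (simp add: K_def)
    have "\<forall>n. \<exists>V. continuous_on {0<..?r} V \<and> (AE x in lebesgue. x \<in> hball R \<longrightarrow> u n x = V (norm x)) \<and>
      radial_bounds b p ?N ?r K V"
    proof
      fix n
      have un: "Wrad k p R (u n)" "Wnormc k p R (u n) \<le> B" using u by auto
      have nn: "Wnormc k p R (u n) \<ge> 0" using C(2)[rule_format, OF un(1)] by (rule conjunct1)
      have "0 \<le> C * Wnormc k p R (u n)" "C * Wnormc k p R (u n) \<le> K"
        unfolding K_def using C(1) nn un(2) by (auto intro!: mult_left_mono)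
      note mono = radial_bounds_mono[OF _ this]
      obtain V where "continuous_on {0<..?r} V" "AE x in lebesgue. x \<in> hball R \<longrightarrow> u n x = V (norm x)"
        "radial_bounds b p ?N ?r (C * Wnormc k p R (u n)) V"
        using C(2)[rule_format, OF un(1)] by (elim exE conjE)
      then show "\<exists>V. continuous_on {0<..?r} V \<and> (AE x in lebesgue. x \<in> hball R \<longrightarrow> u n x = V (norm x)) \<and>
        radial_bounds b p ?N ?r K V" using mono[of b p ?N ?r V] p1 by auto
    qed
    from choice[OF this] obtain V where V0: "\<forall>n. continuous_on {0<..?r} (V n) \<and> (AE x in lebesgue. x \<in> hball R \<longrightarrow> u n x = V n (norm x)) \<and>
      radial_bounds b p ?N ?r K (V n)" by (elim exE)
    have Vc: "continuous_on {0<..?r} (V n)" and VA: "AE x in lebesgue. x \<in> hball R \<longrightarrow> u n x = V n (norm x)" for n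
      using V0 by auto
    have Vb: "s powr b * \<bar>V n s\<bar> powr p \<le> K powr p" if "s \<in> {0<..<?r}" for n s
      using V0 that unfolding radial_bounds_def by blast
    have Ve: "\<bar>V n t - V n s\<bar> \<le> l * (t - s) + l powr (1 - p) * a powr (1 - ?N) * K powr p"
      if "0 < l" "0 < a" "a \<le> s" "s \<le> t" "t < ?r" for n l a s t
      using V0 that unfolding radial_bounds_def by blast
    \<comment> \<open>Multiplication by s^(b/p) makes the profiles uniformly bounded on the whole
      interval, as the diagonal argument asks for a single bound; the factor is removed again at
      each fixed radius.\<close>
    define f where "f n s = s powr (b/p) * V n s" for n s
    have fb: "norm (f n s) \<le> K" if "s \<in> \<rat> \<inter> {0<..<?r}" for n s
    proof -
      have s: "s \<in> {0<..<?r}" "s > 0" using that by auto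
      have "\<bar>V n s\<bar> \<le> K * s powr (- b / p)" by (rule pointwise_root[OF s(2) p1 K Vb[OF s(1)]])
      then have "s powr (b/p) * \<bar>V n s\<bar> \<le> s powr (b/p) * (K * s powr (- b / p))" by (intro mult_left_mono) auto
      also have "\<dots> = K * (s powr (b/p) * s powr (- b / p))" by (simp only: mult_ac)
      also have "s powr (b/p) * s powr (- b / p) = 1" using s by (simp flip: powr_add)
      finally show ?thesis by (simp add: f_def abs_mult)
    qed
    have "countable (\<rat> \<inter> {0<..<?r})" by (intro countable_Int1 countable_rat)
    then obtain \<sigma> where \<sigma>: "strict_mono (\<sigma>::nat \<Rightarrow> nat)" "\<And>x. x \<in> \<rat> \<inter> {0<..<?r} \<Longrightarrow> \<exists>l. (\<lambda>n. f (\<sigma> n) x) \<longlonglongrightarrow> l"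
      using function_convergent_subsequence[of "\<rat> \<inter> {0<..<?r}" f K] fb by blast
    have conv_rat: "Cauchy (\<lambda>n. V (\<sigma> n) x)" if x: "x \<in> \<rat>" "0 < x" "x < ?r" for x
    proof -
      obtain l where "(\<lambda>n. f (\<sigma> n) x) \<longlonglongrightarrow> l" using \<sigma>(2)[of x] x by auto
      from tendsto_mult_left[OF this, of "x powr (- b / p)"]
      have "(\<lambda>n. x powr (- b / p) * f (\<sigma> n) x) \<longlonglongrightarrow> x powr (- b / p) * l" .
      moreover have "x powr (- b / p) * f n x = V n x" for n
      proof -
        have "x powr (- b / p) * x powr (b/p) = 1" using x by (simp flip: powr_add)
        then show ?thesis by (simp add: f_def mult.assoc[symmetric])
      qed
      ultimately show ?thesis by (intro convergent_Cauchy) (auto simp: convergent_def)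
    qed
    have conv: "convergent (\<lambda>n. V (\<sigma> n) s)" if s: "s \<in> {0<..<?r}" for s
    proof (rule Cauchy_convergent, rule metric_CauchyI)
      fix e :: real assume e: "e > 0"
      \<comment> \<open>T exceeds the coefficient of l^(1-p) in the modulus of continuity on radii
        above s/2; the summand 1 keeps it positive when K = 0.\<close>
      define T where "T = (s/2) powr (1 - ?N) * K powr p + 1"
      have T: "T > 0" by (simp add: T_def add_nonneg_pos)
      \<comment> \<open>Solves l^(1-p) = e/(6T), which is possible because p > 1; at p = 1 this term
        could not be made small. The remaining term l (x - s) is then made small by a rational x
        close to s.\<close>
      define l where "l = (e / (6 * T)) powr (1 / (1 - p))"
      have l: "l > 0" using e T by (simp add: l_def)
      have lp: "l powr (1 - p) = e / (6 * T)" using e T p by (simp add: l_def powr_powr)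
      obtain x where x: "x \<in> \<rat>" "s < x" "x < min ?r (s + e / (6 * l))"
        using Rats_dense_in_real[of s "min ?r (s + e / (6 * l))"] s e l by auto
      have close: "\<bar>V n x - V n s\<bar> < e / 3" for n
      proof -
        have "\<bar>V n x - V n s\<bar> \<le> l * (x - s) + l powr (1 - p) * (s/2) powr (1 - ?N) * K powr p"
          using l s x by (intro Ve) auto
        also have "l * (x - s) < e / 6"
        proof -
          have "x - s < e / (6 * l)" using x by simp
          then have "l * (x - s) < l * (e / (6 * l))" using l by (rule mult_strict_left_mono)
          then show ?thesis using l by simp
        qed
        also have "l powr (1 - p) * (s/2) powr (1 - ?N) * K powr p = e / (6 * T) * (T - 1)"
          unfolding lp T_def by simp
        also have "e / (6 * T) * (T - 1) < e / 6" using e T by (simp add: field_simps)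
        finally show ?thesis by simp
      qed
      obtain M where M: "\<And>m n. m \<ge> M \<Longrightarrow> n \<ge> M \<Longrightarrow> dist (V (\<sigma> m) x) (V (\<sigma> n) x) < e / 3"
        using metric_CauchyD[OF conv_rat[of x], of "e/3"] x s e by auto
      show "\<exists>M. \<forall>m\<ge>M. \<forall>n\<ge>M. dist (V (\<sigma> m) s) (V (\<sigma> n) s) < e"
      proof (intro exI[of _ M] allI impI)
        fix m n assume "m \<ge> M" "n \<ge> M"
        from M[OF this] close[of "\<sigma> m"] close[of "\<sigma> n"] show "dist (V (\<sigma> m) s) (V (\<sigma> n) s) < e"
          unfolding dist_real_def by linarith
      qed
    qed
    \<comment> \<open>The value 0 outside the open interval, in particular at 0, makes the
      restriction of w to the ball a Borel function of |x| including at the origin.\<close>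
    define W where "W s = (if s \<in> {0<..<?r} then lim (\<lambda>n. V (\<sigma> n) s) else 0)" for s
    have lim: "(\<lambda>n. V (\<sigma> n) s) \<longlonglongrightarrow> W s" if "s \<in> {0<..<?r}" for s
      using conv[OF that] that by (simp add: W_def convergent_LIMSEQ_iff)
    have Vm [measurable]: "(\<lambda>s. indicator {0<..<?r} s * V n s) \<in> borel_measurable borel" for n
      by (rule measurable_profile[OF Vc])
    have Wm [measurable]: "(\<lambda>s. indicator {0<..<?r} s * W s) \<in> borel_measurable borel"
    proof (rule borel_measurable_LIMSEQ_real[where u="\<lambda>n s. indicator {0<..<?r} s * V (\<sigma> n) s"])
      fix s :: real
      show "(\<lambda>n. indicator {0<..<?r} s * V (\<sigma> n) s) \<longlonglongrightarrow> indicator {0<..<?r} s * W s"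
        using lim[of s] by (cases "s \<in> {0<..<?r}") auto
    qed measurable
    have Wb: "s powr b * \<bar>W s\<bar> powr p \<le> K powr p" if s: "s \<in> {0<..<?r}" for s
    proof (rule LIMSEQ_le_const2)
      show "(\<lambda>n. s powr b * \<bar>V (\<sigma> n) s\<bar> powr p) \<longlonglongrightarrow> s powr b * \<bar>W s\<bar> powr p"
        using p by (intro tendsto_mult tendsto_const tendsto_powr'[OF _ tendsto_const] tendsto_rabs lim[OF s]) auto
    qed (use Vb[OF s] in auto)
    define w where "w x = W (norm x)" for x :: "real^'n"
    have "in_Lqs q \<theta> R w"
      unfolding in_Lqs_def
    proof
      have "(\<lambda>x::real^'n. (\<lambda>s. indicator {0<..<?r} s * W s) (norm x)) \<in> borel_measurable borel"
        by (rule measurable_compose[OF _ Wm]) measurable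
      then have "(\<lambda>x::real^'n. (\<lambda>s. indicator {0<..<?r} s * W s) (norm x)) \<in> borel_measurable lebesgue"
        by (intro measurable_completion) simp
      moreover have "(\<lambda>x::real^'n. indicator (hball R) x *\<^sub>R w x) = (\<lambda>x. (\<lambda>s. indicator {0<..<?r} s * W s) (norm x))"
        using R by (auto simp: fun_eq_iff w_def indicator_def W_def hball_eq_ball)
      ultimately show "set_borel_measurable lebesgue (hball R) w" by (simp add: set_borel_measurable_def)
      have "Lqs_pow q \<theta> R w \<le> ennreal A * ennreal (?r powr (\<theta> + ?N - b * q / p) / (\<theta> + ?N - b * q / p) * K powr q)"
        by (intro order_trans[OF A'[rule_format, of w W, OF _ Wm]] mult_left_mono subcritical_integral[OF r p1 q K cond Wb]) (auto simp: w_def)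
      also have "\<dots> < \<infinity>" by (simp add: ennreal_mult_less_top)
      finally show "Lqs_pow q \<theta> R w < \<infinity>" .
    qed
    moreover have "(\<lambda>n. Lqs_norm q \<theta> R (\<lambda>x. u (\<sigma> n) x - w x)) \<longlonglongrightarrow> 0"
    proof -
      define h where "h n s = indicator {0<..<?r} s * ennreal (s powr (?N - 1 + \<theta>) * \<bar>V (\<sigma> n) s - W s\<bar> powr q)" for n s
      have dm [measurable]: "(\<lambda>s. indicator {0<..<?r} s * (V (\<sigma> n) s - W s)) \<in> borel_measurable borel" for n
        unfolding right_diff_distrib by measurable
      have hm: "h n \<in> borel_measurable lborel" for n
      proof -
        have "(\<lambda>s. indicator {0<..<?r} s * ennreal (s powr (?N - 1 + \<theta>) * \<bar>indicator {0<..<?r} s * (V (\<sigma> n) s - W s)\<bar> powr q)) \<in> borel_measurable lborel" by measurable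
        then show ?thesis unfolding h_def by (rule measurable_cong[THEN iffD1, rotated]) (auto simp: indicator_def)
      qed
      \<comment> \<open>Both the profiles and their limit are at most K s^(-b/p), so the differences
        obey the pointwise bound with 2K; \<alpha> > 0 makes this power of s integrable.\<close>
      define g where "g s = ennreal ((2 * K) powr q) * (indicator {0<..<?r} s * ennreal (s powr (\<alpha> - 1)))" for s
      have "(\<lambda>n. \<integral>\<^sup>+s. h n s \<partial>lborel) \<longlonglongrightarrow> (\<integral>\<^sup>+s. (0::ennreal) \<partial>(lborel :: real measure))"
      proof (rule nn_integral_dominated_convergence[where w=g])
        show "h n \<in> borel_measurable lborel" for n by (rule hm)
        show "g \<in> borel_measurable lborel" unfolding g_def by measurable
        have "(\<integral>\<^sup>+s. g s \<partial>lborel) = ennreal ((2 * K) powr q) * nn_on {0<..<?r} (\<lambda>s. s powr (\<alpha> - 1))"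
          unfolding g_def by (rule nn_integral_cmult) measurable
        also have "\<dots> \<le> ennreal ((2 * K) powr q) * ennreal (?r powr \<alpha> / \<alpha>)" by (intro mult_left_mono nn_integral_powr_0 r \<alpha>) simp
        also have "\<dots> < \<infinity>" by (simp add: ennreal_mult_less_top)
        finally show "(\<integral>\<^sup>+s. g s \<partial>lborel) < \<infinity>" .
        show "AE s in lborel. h n s \<le> g s" for n
        proof (rule AE_I2)
          fix s :: real
          show "h n s \<le> g s"
          proof (cases "s \<in> {0<..<?r}")
            case True
            then have s0: "s > 0" by simp
            have "\<bar>V (\<sigma> n) s - W s\<bar> \<le> K * s powr (- b / p) + K * s powr (- b / p)"
              using pointwise_root[OF s0 p1 K Vb[OF True, of "\<sigma> n"]] pointwise_root[OF s0 p1 K Wb[OF True]] by linarith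
            then have "\<bar>V (\<sigma> n) s - W s\<bar> powr p \<le> (2 * K * s powr (- b / p)) powr p"
              using p by (intro powr_mono2) auto
            also have "\<dots> = (2 * K) powr p * s powr (- b)" using K p by (simp add: powr_mult powr_powr)
            finally have "s powr b * \<bar>V (\<sigma> n) s - W s\<bar> powr p \<le> s powr b * ((2 * K) powr p * s powr (- b))" by (intro mult_left_mono) auto
            also have "\<dots> = (2 * K) powr p * (s powr b * s powr (- b))" by (simp only: mult_ac)
            also have "s powr b * s powr (- b) = 1" using s0 by (simp flip: powr_add)
            finally have "s powr b * \<bar>V (\<sigma> n) s - W s\<bar> powr p \<le> (2 * K) powr p" by simp
            from subcritical_pointwise[OF s0 p1 q _ this, of ?N \<theta>] K
            have "s powr (?N - 1 + \<theta>) * \<bar>V (\<sigma> n) s - W s\<bar> powr q \<le> (2 * K) powr q * s powr (\<alpha> - 1)" by (simp add: \<alpha>_def)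
            from ennreal_leI[OF this] show ?thesis using True by (simp add: h_def g_def ennreal_mult)
          qed (simp add: h_def)
        qed
        show "AE s in lborel. (\<lambda>n. h n s) \<longlonglongrightarrow> 0"
        proof (rule AE_I2)
          fix s :: real
          show "(\<lambda>n. h n s) \<longlonglongrightarrow> 0"
          proof (cases "s \<in> {0<..<?r}")
            case True
            have "(\<lambda>n. V (\<sigma> n) s - W s) \<longlonglongrightarrow> 0" using lim[OF True] by (simp add: LIM_zero)
            then have "(\<lambda>n. \<bar>V (\<sigma> n) s - W s\<bar>) \<longlonglongrightarrow> 0" by (rule tendsto_rabs_zero)
            then have "(\<lambda>n. \<bar>V (\<sigma> n) s - W s\<bar> powr q) \<longlonglongrightarrow> 0 powr q" using q by (intro tendsto_powr'[OF _ tendsto_const]) auto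
            then have "(\<lambda>n. s powr (?N - 1 + \<theta>) * \<bar>V (\<sigma> n) s - W s\<bar> powr q) \<longlonglongrightarrow> s powr (?N - 1 + \<theta>) * 0 powr q" by (intro tendsto_mult tendsto_const)
            from tendsto_ennrealI[OF this] show ?thesis using True q by (simp add: h_def)
          qed (simp add: h_def)
        qed
      qed simp
      then have J: "(\<lambda>n. \<integral>\<^sup>+s. h n s \<partial>lborel) \<longlonglongrightarrow> 0" by simp
      have AJ: "(\<lambda>n. ennreal A * (\<integral>\<^sup>+s. h n s \<partial>lborel)) \<longlonglongrightarrow> 0"
        using ennreal_tendsto_cmult[OF _ J, of "ennreal A"] by simp
      have le: "Lqs_pow q \<theta> R (\<lambda>x. u (\<sigma> n) x - w x) \<le> ennreal A * (\<integral>\<^sup>+s. h n s \<partial>lborel)" for n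
        unfolding h_def
      proof (rule A'[rule_format, OF _ dm])
        show "AE x in lebesgue. x \<in> hball R \<longrightarrow> u (\<sigma> n) x - w x = V (\<sigma> n) (norm x) - W (norm x)"
          using VA[of "\<sigma> n"] by eventually_elim (simp add: w_def)
      qed
      have L: "(\<lambda>n. Lqs_pow q \<theta> R (\<lambda>x. u (\<sigma> n) x - w x)) \<longlonglongrightarrow> ennreal 0"
        by (rule tendsto_sandwich[OF _ _ tendsto_const[of 0] AJ, THEN back_subst[of "\<lambda>z. _ \<longlonglongrightarrow> z"]]) (auto intro!: always_eventually le)
      from tendsto_enn2real[OF L] have "(\<lambda>n. enn2real (Lqs_pow q \<theta> R (\<lambda>x. u (\<sigma> n) x - w x))) \<longlonglongrightarrow> 0" by simp
      then have "(\<lambda>n. enn2real (Lqs_pow q \<theta> R (\<lambda>x. u (\<sigma> n) x - w x)) powr (1/q)) \<longlonglongrightarrow> 0 powr (1/q)"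
        using q by (intro tendsto_powr'[OF _ tendsto_const]) auto
      then show ?thesis by (simp add: Lqs_norm_def)
    qed
    ultimately show ?thesis using \<sigma>(1) by blast
  qed
  moreover have "cont_embed k p R q \<theta> TYPE('n)"
    by (rule cont_embed_general[OF R p1 k N b \<theta> q]) (use cond in simp)
  ultimately show ?thesis unfolding compact_embed_def by blast
qed

section \<open>Continuity up to the origin in the case N = k, p = 1\<close>

lemma continuous_on_Icc_glue:
  fixes f :: "real \<Rightarrow> real"
  assumes "r > 0" "continuous_on {0..<r} f" "continuous_on {0<..r} f"
  shows "continuous_on {0..r} f"
  unfolding continuous_on_eq_continuous_within
proof
  fix t assume t: "t \<in> {0..r}"
  show "continuous (at t within {0..r}) f"
  proof (cases "t < r")
    case True
    have "at t within {0..r} = at t within {0..<r}"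
      by (rule at_within_nhd[of t "{..<r}"]) (use True in auto)
    then show ?thesis using assms(2) t True by (simp add: continuous_on_eq_continuous_within)
  next
    case False
    have "at t within {0..r} = at t within {0<..r}"
      by (rule at_within_nhd[of t "{0<..}"]) (use False t assms(1) in auto)
    then show ?thesis using assms(1,3) t False by (simp add: continuous_on_eq_continuous_within)
  qed
qed

text \<open>The approximants themselves are continuous at 0, and \<open>chain_sup_bound\<close>
  applied to their increments makes the convergence uniform; so the limit is continuous at 0 too.
  The same bound applied to the approximants controls the supremum.\<close>

lemma radial_continuous_representative:
  assumes R: "R > 0" and k: "k \<ge> 1" and N: "real CARD('n::finite) = real k"
  shows "\<exists>C. \<forall>u :: real^'n \<Rightarrow> real. Wrad k 1 R u \<longrightarrow>
            (\<exists>U. continuous_on (closure (hball R)) U \<and>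
                 (AE x in lebesgue. x \<in> hball R \<longrightarrow> u x = U x) \<and>
                 (\<forall>x\<in>closure (hball R). \<bar>U x\<bar> \<le> C * Wnormc k 1 R u))"
proof -
  let ?r = "tanh (R/2)"
  let ?N = "real CARD('n)"
  have r: "?r > 0" using R by simp
  have N1: "?N \<ge> 1" using N k by simp
  obtain C1 where C1: "C1 > 0" "\<forall>G. chain k ?r G \<longrightarrow> (\<forall>s\<in>{0<..<?r}. ennreal \<bar>G 0 s\<bar> \<le> ennreal C1 * chain_energy k 1 ?N ?r G)"
    using chain_sup_bound[OF r k] unfolding N by (elim exE conjE)
  obtain C2 where C2: "C2 \<ge> 0" "\<forall>\<phi> (u::real^'n \<Rightarrow> real) c. approxW k 1 R \<phi> u \<and> radial R u \<and> (\<lambda>n. Wnorm k 1 R (\<phi> n)) \<longlonglongrightarrow> c \<longrightarrow>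
    (\<exists>G v. radial_profile k 1 ?N R u G v (ennreal (C2 * c powr 1)))"
    using radial_profile_exists[OF R order_refl k, where 'n='n] by (elim exE conjE)
  show ?thesis
  proof (intro exI[of _ "C1 * C2"] allI impI)
    fix u :: "real^'n \<Rightarrow> real" assume u: "Wrad k 1 R u"
    define c where "c = Wnormc k 1 R u"
    obtain \<phi> where \<phi>: "approxW k 1 R \<phi> u" "(\<lambda>n. Wnorm k 1 R (\<phi> n)) \<longlonglongrightarrow> c"
      using Wnormc_limit[OF R order_refl u] by (auto simp: c_def)
    have c0: "c \<ge> 0" by (rule LIMSEQ_le_const[OF \<phi>(2)]) (auto simp: Wnorm_def)
    have rad: "radial R u" using u by (simp add: Wrad_def)
    obtain G v where P0: "radial_profile k 1 ?N R u G v (ennreal (C2 * c powr 1))"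
      using C2(2)[rule_format, OF conjI[OF \<phi>(1) conjI[OF rad \<phi>(2)]]] by (elim exE)
    then have P: "radial_profile k 1 ?N R u G v (ennreal (C2 * c))" using c0 by simp
    have ch: "chain k ?r (G n)" and Gc: "continuous_on {0..<?r} (G n 0)" for n using P by (auto simp: radial_profile_def)
    have li: "liminf (\<lambda>n. chain_energy k 1 ?N ?r (G n)) \<le> ennreal (C2 * c)" using P by (simp add: radial_profile_def)
    obtain M where M: "M \<ge> 0" "\<And>n. chain_energy k 1 ?N ?r (\<lambda>j s. G (Suc n) j s - G n j s) \<le> ennreal (M * 2 powr (- (real n * 1)))"
      using P unfolding radial_profile_def by blast
    from profile_limit[OF R order_refl k N1 P] obtain W where
      W0: "\<forall>j s. j < k \<and> s \<in> {0<..<?r} \<longrightarrow> (\<lambda>n. G n j s) \<longlonglongrightarrow> W j s" and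
      W2: "\<forall>j<k. continuous_on {0<..?r} (W j)" and
      W4: "AE x in lebesgue. x \<in> hball R \<longrightarrow> u x = W 0 (norm x)"
      by (elim exE conjE)
    have cv: "(\<lambda>n. G n 0 s) \<longlonglongrightarrow> W 0 s" if "s \<in> {0<..<?r}" for s using W0 that k by simp
    define D where "D n s = G (Suc n) 0 s - G n 0 s" for n s
    define m where "m n = C1 * M * (1/2) ^ n" for n :: nat
    have D1: "\<bar>D n s\<bar> \<le> m n" if s: "s \<in> {0<..<?r}" for n s
    proof -
      have "ennreal \<bar>D n s\<bar> \<le> ennreal C1 * chain_energy k 1 ?N ?r (\<lambda>j s. G (Suc n) j s - G n j s)"
        unfolding D_def using C1(2)[rule_format, OF chain_diff[OF ch ch] s] .
      also have "\<dots> \<le> ennreal C1 * ennreal (M * 2 powr (- (real n * 1)))" by (intro mult_left_mono M) simp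
      also have "\<dots> = ennreal (C1 * (M * 2 powr (- (real n * 1))))" using C1(1) M(1) by (simp add: ennreal_mult)
      also have "C1 * (M * 2 powr (- (real n * 1))) = m n"
        by (simp add: m_def powr_minus powr_realpow power_one_over inverse_eq_divide)
      finally show ?thesis using C1(1) M(1) by (simp add: m_def)
    qed
    have Dc: "continuous_on {0..<?r} (D n)" for n unfolding D_def[abs_def] by (intro continuous_on_diff Gc)
    have D2: "norm (D n s) \<le> m n" if s: "s \<in> {0..<?r}" for n s
    \<comment> \<open>The sup bound is available for s > 0 only; continuity of the increments on the
      ray carries it to s = 0.\<close>
    proof (cases "s = 0")
      case True
      have cl: "closure {0<..<?r/2} = {0..?r/2}" using r by (intro closure_greaterThanLessThan) simp
      have "{0..?r/2} \<subseteq> {0..<?r}"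
        using r unfolding subset_iff atLeastAtMost_iff atLeastLessThan_iff by linarith
      then have "continuous_on (closure {0<..<?r/2}) (D n)" unfolding cl by (rule continuous_on_subset[OF Dc])
      from continuous_on_closure_norm_le[OF this, of "m n" 0] show ?thesis using D1 r True unfolding cl by auto
    next
      case False
      then show ?thesis using D1[of s n] s by simp
    qed
    have "summable m" unfolding m_def by (intro summable_mult summable_geometric) auto
    from Weierstrass_m_test[OF D2 this]
    have ul: "uniform_limit {0..<?r} (\<lambda>n s. \<Sum>i<n. D i s) (\<lambda>s. \<Sum>i. D i s) sequentially" .
    define V where "V s = G 0 0 s + (\<Sum>i. D i s)" for s
    have "continuous_on {0..<?r} (\<lambda>s. \<Sum>i. D i s)"
      by (rule uniform_limit_theorem[OF _ ul]) (auto intro!: always_eventually continuous_on_sum Dc)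
    then have Vc: "continuous_on {0..<?r} V" unfolding V_def[abs_def] by (intro continuous_on_add Gc)
    have VW: "V s = W 0 s" if s: "s \<in> {0<..<?r}" for s
    proof (rule LIMSEQ_unique[OF _ cv[OF s]])
      have tel: "G n 0 s = G 0 0 s + (\<Sum>i<n. D i s)" for n by (induction n) (auto simp: D_def)
      have "(\<lambda>n. G 0 0 s + (\<Sum>i<n. D i s)) \<longlonglongrightarrow> V s"
        unfolding V_def by (intro tendsto_add tendsto_const tendsto_uniform_limitI[OF ul]) (use s in auto)
      moreover have "(\<lambda>n. G n 0 s) = (\<lambda>n. G 0 0 s + (\<Sum>i<n. D i s))" by (rule ext, rule tel)
      ultimately show "(\<lambda>n. G n 0 s) \<longlonglongrightarrow> V s" by simp
    qed
    \<comment> \<open>V is continuous at 0 and \<open>W 0\<close> at the outer end; they agree in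
      between, so the two can be glued.\<close>
    define F where "F s = (if s < ?r then V s else W 0 s)" for s
    have Fc: "continuous_on {0..?r} F"
    proof (rule continuous_on_Icc_glue[OF r])
      show "continuous_on {0..<?r} F" using Vc by (rule continuous_on_eq) (simp add: F_def)
      have "continuous_on {0<..?r} (W 0)" using W2 k by simp
      then show "continuous_on {0<..?r} F" by (rule continuous_on_eq) (simp add: F_def VW)
    qed
    have F1: "norm (F s) \<le> C1 * C2 * c" if s: "s \<in> {0<..<?r}" for s
    proof -
      have "ennreal \<bar>W 0 s\<bar> \<le> 0 + ennreal C1 * ennreal (C2 * c)"
      proof (rule le_liminf_bound[OF _ _ li])
        show "(\<lambda>n. ennreal \<bar>G n 0 s\<bar>) \<longlonglongrightarrow> ennreal \<bar>W 0 s\<bar>" by (intro tendsto_ennrealI tendsto_rabs cv s)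
        show "ennreal \<bar>G n 0 s\<bar> \<le> 0 + ennreal C1 * chain_energy k 1 ?N ?r (G n)" for n
          using C1(2)[rule_format, OF ch s] by simp
      qed
      also have "\<dots> = ennreal (C1 * C2 * c)" using C1(1) C2(1) c0 by (simp add: ennreal_mult mult.assoc)
      finally have "\<bar>W 0 s\<bar> \<le> C1 * C2 * c" using C1(1) C2(1) c0 by simp
      then show ?thesis using s by (simp add: F_def VW)
    qed
    have cl: "closure {0<..<?r} = {0..?r}" using r by (rule closure_greaterThanLessThan)
    have F2: "norm (F s) \<le> C1 * C2 * c" if "s \<in> {0..?r}" for s
      using continuous_on_closure_norm_le[of "{0<..<?r}" F "C1 * C2 * c" s] F1 Fc that unfolding cl by auto
    have ch: "closure (hball R) = cball (0::real^'n) ?r" by (rule closure_hball[OF R])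
    show "\<exists>U. continuous_on (closure (hball R)) U \<and> (AE x in lebesgue. x \<in> hball R \<longrightarrow> u x = U x) \<and>
                 (\<forall>x\<in>closure (hball R). \<bar>U x\<bar> \<le> C1 * C2 * Wnormc k 1 R u)"
      unfolding ch c_def[symmetric]
    proof (intro exI[of _ "\<lambda>x. F (norm x)"] conjI ballI)
      show "continuous_on (cball (0::real^'n) ?r) (\<lambda>x. F (norm x))"
        by (rule continuous_on_compose2[OF Fc continuous_on_norm_id]) auto
      have "AE x in lborel. x \<noteq> (0::real^'n)" by (rule AE_lborel_singleton)
      then have "AE x in lebesgue. x \<noteq> (0::real^'n)" by (simp only: AE_completion_iff)
      with W4 show "AE x in lebesgue. x \<in> hball R \<longrightarrow> u x = F (norm x)"
      proof eventually_elim
        case (elim x)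
        then show ?case using VW[of "norm x"] R by (auto simp: F_def hball_eq_ball)
      qed
      fix x :: "real^'n" assume "x \<in> cball 0 ?r"
      then show "\<bar>F (norm x)\<bar> \<le> C1 * C2 * c" using F2[of "norm x"] by simp
    qed
  qed
qed

theorem theorem1p3:
  fixes R p :: real and k :: nat
  assumes "R > 0" and "p \<ge> 1" and "k \<ge> 1"
  shows
   "(\<forall>u :: real^'n \<Rightarrow> real. Wrad k p R u \<longrightarrow>
       (\<exists>U. Ck_on (k - 1) (closure (hball R) - {0}) U \<and>
            (AE x in lebesgue. x \<in> hball R \<longrightarrow> u x = U x) \<and>
            (AE x in lebesgue. x \<in> hball R - {0} \<longrightarrow>
               (\<forall>is. length is = k \<longrightarrow> pdl_ex is U x))))
    \<and> (real CARD('n) > real k * p \<longrightarrow>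
         (\<forall>\<theta> q. \<theta> \<ge> 0 \<and> 1 \<le> q \<and> q \<le> (\<theta> + real CARD('n)) * p / (real CARD('n) - real k * p) \<longrightarrow>
            cont_embed k p R q \<theta> TYPE('n)))
    \<and> (real CARD('n) = real k * p \<and> p > 1 \<longrightarrow>
         (\<forall>\<theta> q. \<theta> \<ge> 0 \<and> 1 \<le> q \<longrightarrow> compact_embed k p R q \<theta> TYPE('n)))
    \<and> (real CARD('n) = real k * p \<and> p = 1 \<longrightarrow>
         (\<exists>C. \<forall>u :: real^'n \<Rightarrow> real. Wrad k p R u \<longrightarrow>
            (\<exists>U. continuous_on (closure (hball R)) U \<and>
                 (AE x in lebesgue. x \<in> hball R \<longrightarrow> u x = U x) \<and>
                 (\<forall>x\<in>closure (hball R). \<bar>U x\<bar> \<le> C * Wnormc k p R u))))"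
proof (intro conjI)
  let ?N = "real CARD('n)"
  have kp: "real (k - 1) * p < real k * p" using assms by (simp add: of_nat_diff algebra_simps)
  show "\<forall>u :: real^'n \<Rightarrow> real. Wrad k p R u \<longrightarrow>
       (\<exists>U. Ck_on (k - 1) (closure (hball R) - {0}) U \<and>
            (AE x in lebesgue. x \<in> hball R \<longrightarrow> u x = U x) \<and>
            (AE x in lebesgue. x \<in> hball R - {0} \<longrightarrow>
               (\<forall>is. length is = k \<longrightarrow> pdl_ex is U x)))"
    by (intro allI impI) (rule radial_Ck_representative[OF assms])
  show "?N > real k * p \<longrightarrow>
         (\<forall>\<theta> q. \<theta> \<ge> 0 \<and> 1 \<le> q \<and> q \<le> (\<theta> + ?N) * p / (?N - real k * p) \<longrightarrow> cont_embed k p R q \<theta> TYPE('n))"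
  proof (intro impI allI)
    fix \<theta> q assume N: "?N > real k * p" and tq: "\<theta> \<ge> 0 \<and> 1 \<le> q \<and> q \<le> (\<theta> + ?N) * p / (?N - real k * p)"
    \<comment> \<open>The sharp exponent, for which the upper bound on q reads bq/p <= \<theta> +
      N.\<close>
    define b where "b = ?N - real k * p"
    have b: "b > 0" using N by (simp add: b_def)
    have q: "q \<le> (\<theta> + ?N) * p / b" using tq by (simp add: b_def)
    then have le: "b * q / p \<le> \<theta> + ?N" using b assms(2) by (simp add: field_simps)
    have "real k * p \<ge> 0" using assms(2) by simp
    then have "b \<le> \<theta> + ?N" using tq unfolding b_def by linarith
    \<comment> \<open>The interpolation at the critical exponent splits off |V|^p and so requires q
      >= p; this follows from b <= \<theta> + N.\<close>
    then have "q \<ge> p" if "b * q / p = \<theta> + ?N"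
    proof -
      have "b * p \<le> (\<theta> + ?N) * p" using \<open>b \<le> \<theta> + ?N\<close> assms(2) by (intro mult_right_mono) auto
      also have "\<dots> = b * q" using that assms(2) by (simp add: field_simps)
      finally have "b * p \<le> b * q" .
      then show ?thesis using b by simp
    qed
    then show "cont_embed k p R q \<theta> TYPE('n)"
      using le N kp b tq by (intro cont_embed_general[OF assms, of b]) (auto simp: b_def)
  qed
  show "?N = real k * p \<and> p > 1 \<longrightarrow> (\<forall>\<theta> q. \<theta> \<ge> 0 \<and> 1 \<le> q \<longrightarrow> compact_embed k p R q \<theta> TYPE('n))"
  proof (intro impI allI)
    fix \<theta> q :: real assume N: "?N = real k * p \<and> p > 1" and tq: "\<theta> \<ge> 0 \<and> 1 \<le> q"
    \<comment> \<open>Chosen so that bq/p is half of \<theta> + N, which makes every finite q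
      strictly subcritical.\<close>
    define b where "b = p * (\<theta> + ?N) / (2 * q)"
    have pos: "\<theta> + ?N > 0" using tq by (simp add: add_nonneg_pos)
    have b: "b > 0" using pos tq N by (simp add: b_def)
    have "b * q / p = (\<theta> + ?N) / 2" using tq N by (simp add: b_def)
    then have "b * q / p < \<theta> + ?N" using pos by simp
    then show "compact_embed k p R q \<theta> TYPE('n)"
      using N kp b tq assms by (intro compact_embed_general[of R p k b]) auto
  qed
  show "?N = real k * p \<and> p = 1 \<longrightarrow>
         (\<exists>C. \<forall>u :: real^'n \<Rightarrow> real. Wrad k p R u \<longrightarrow>
            (\<exists>U. continuous_on (closure (hball R)) U \<and>
                 (AE x in lebesgue. x \<in> hball R \<longrightarrow> u x = U x) \<and>
                 (\<forall>x\<in>closure (hball R). \<bar>U x\<bar> \<le> C * Wnormc k p R u)))"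
    using radial_continuous_representative[OF assms(1,3), where 'n='n] by auto
qed

end
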